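(* Let $\mathbb{F}$ be a field of characteristic zero and $X=\{x_1,\ldots,x_n\}$. Suppose $f\in\mathbb{F}\langle X,X^{-1}\rangle$ is an expression of degree $d$ and sparsity $s$, given as a black-box. Then $f$ can be reconstructed deterministically in time polynomial in $n,d,s$ using matrix-valued queries to the black-box. Reconstructing $f$ means computing the list of reduced words occurring in $f$ together with their coefficients.
   Context: $\mathbb{F}\langle X,X^{-1}\rangle$ is the free group algebra over $\mathbb{F}$ on the free group generated by $x_1,\ldots,x_n$. Its elements are finite $\mathbb{F}$-linear combinations $f=\sum_w\alpha_w w$ of reduced words over $\{x_1^{\pm1},\ldots,x_n^{\pm1}\}$, i.e. words with no adjacent $x_ix_i^{-1}$ or $x_i^{-1}x_i$. The degree of $f$ is the maximum length of a reduced word $w$ with $\alpha_w\neq0$. The sparsity of $f$ is the number of reduced words $w$ with $\alpha_w\neq 0$. Black-box access means $f$ can be accessed only through an oracle. The oracle receives invertible square matrices $A_1,\ldots,A_n$ of a common dimension over $\mathbb{F}$. It returns $f(A_1,\ldots,A_n)$, obtained by substituting $A_i$ for $x_i$ and $A_i^{-1}$ for $x_i^{-1}$. *)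

theory Defs
  imports
    "HOL-Library.Poly_Mapping"
    "Jordan_Normal_Form.Gauss_Jordan_Elimination"
begin

section \<open>The free group algebra\<close>

text \<open>The letter \<open>(i, False)\<close> stands for $x_i$ and \<open>(i, True)\<close> for $x_i^{-1}$; the generators
  are numbered from \<open>0\<close>.\<close>

type_synonym letter = "nat \<times> bool"
type_synonym gword = "letter list"

definition reduced :: "gword \<Rightarrow> bool" where
  "reduced w \<longleftrightarrow> successively (\<lambda>x y. \<not> (fst x = fst y \<and> snd x \<noteq> snd y)) w"

definition reduced_words :: "nat \<Rightarrow> gword set" where
  "reduced_words n = {w. reduced w \<and> (\<forall>x \<in> set w. fst x < n)}"

text \<open>The underlying set of the free group algebra on \<open>n\<close> generators. Its elements are the finitely
  supported families of coefficients indexed by reduced words; the product of the algebra is not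
  needed below.\<close>

definition free_group_algebra :: "nat \<Rightarrow> (gword \<Rightarrow>\<^sub>0 'a::zero) set" where
  "free_group_algebra n = {f. Poly_Mapping.keys f \<subseteq> reduced_words n}"

text \<open>The zero element gets degree \<open>0\<close>.\<close>

definition fga_degree :: "(gword \<Rightarrow>\<^sub>0 'a::zero) \<Rightarrow> nat" where
  "fga_degree f = Max (insert 0 (length ` Poly_Mapping.keys f))"

definition fga_sparsity :: "(gword \<Rightarrow>\<^sub>0 'a::zero) \<Rightarrow> nat" where
  "fga_sparsity f = card (Poly_Mapping.keys f)"

section \<open>Evaluation at invertible matrices\<close>

text \<open>Only used when all matrices \<open>A i\<close> that occur are invertible, so that \<open>mat_inverse\<close> is
  \<open>Some\<close> of the inverse.\<close>

definition letter_mat :: "(nat \<Rightarrow> 'a::field mat) \<Rightarrow> letter \<Rightarrow> 'a mat" where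
  "letter_mat A x = (if snd x then the (mat_inverse (A (fst x))) else A (fst x))"

definition word_mat :: "nat \<Rightarrow> (nat \<Rightarrow> 'a::field mat) \<Rightarrow> gword \<Rightarrow> 'a mat" where
  "word_mat D A w = foldr (\<lambda>x M. letter_mat A x * M) w (1\<^sub>m D)"

text \<open>The linear combination of word values, written entrywise because matrices of varying
  dimension do not form a commutative monoid type.\<close>

definition black_box :: "(gword \<Rightarrow>\<^sub>0 'a::field) \<Rightarrow> nat \<Rightarrow> (nat \<Rightarrow> 'a mat) \<Rightarrow> 'a mat" where
  "black_box f D A =
     mat D D (\<lambda>(j, k). \<Sum>w \<in> Poly_Mapping.keys f. Poly_Mapping.lookup f w * (word_mat D A w $$ (j, k)))"

section \<open>The model of computation\<close>

text \<open>
  Deterministic programs for an algebraic random access machine with an oracle. The memory consists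
  of named infinite arrays of natural numbers and named infinite arrays of field elements, where
  array names are fixed in the program text and indices are computed. On naturals there are
  constants, addition, truncated subtraction and comparison; on field elements there are \<open>0\<close>, \<open>1\<close>, the four arithmetic
  operations (with \<open>x / 0 = 0\<close>) and equality tests. There is no multiplication of naturals, so the
  bit length of a natural number grows by at most a constant per step, and charging one unit per
  step is polynomially equivalent to charging bit operations for that part. Field operations have
  unit cost.

  A program is finite and independent of the input. So the expressions in it have bounded size, and
  one time unit per command or test agrees, up to a constant factor, with one unit per operation.
\<close>

datatype nexp =
    NConst nat
  | NGet nat nexp
  | NPlus nexp nexp
  | NMinus nexp nexp

datatype fexp =
    FZero
  | FOne
  | FGet nat nexp
  | FPlus fexp fexp
  | FMinus fexp fexp
  | FTimes fexp fexp
  | FDivide fexp fexp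

datatype bexp =
    NLess nexp nexp
  | FEq fexp fexp
  | BNot bexp
  | BAnd bexp bexp

text \<open>
  \<open>Query a e b\<close> asks the oracle at matrices whose dimension is the value of \<open>e\<close> and whose entries are
  read from the field array \<open>a\<close>; the answer is stored in the field array \<open>b\<close>.
  \<open>EmitLetter i e\<close> appends a letter to the word under construction: its generator is the value of \<open>i\<close>,
  and it is inverted iff the value of \<open>e\<close> is nonzero. \<open>EmitTerm c\<close> writes this word with
  coefficient \<open>c\<close> to the output and starts a new word.
\<close>

datatype com =
    Skip
  | NSet nat nexp nexp
  | FSet nat nexp fexp
  | Seq com com
  | If bexp com com
  | While bexp com
  | Query nat nexp nat
  | EmitLetter nexp nexp
  | EmitTerm fexp

record 'a machine =
  nmem :: "nat \<Rightarrow> nat \<Rightarrow> nat"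
  fmem :: "nat \<Rightarrow> nat \<Rightarrow> 'a"
  cur_word :: gword
  out_terms :: "(gword \<times> 'a) list"

fun nval :: "nexp \<Rightarrow> 'a machine \<Rightarrow> nat" where
  "nval (NConst c) \<sigma> = c"
| "nval (NGet a e) \<sigma> = nmem \<sigma> a (nval e \<sigma>)"
| "nval (NPlus e1 e2) \<sigma> = nval e1 \<sigma> + nval e2 \<sigma>"
| "nval (NMinus e1 e2) \<sigma> = nval e1 \<sigma> - nval e2 \<sigma>"

fun fval :: "fexp \<Rightarrow> 'a::field machine \<Rightarrow> 'a" where
  "fval FZero \<sigma> = 0"
| "fval FOne \<sigma> = 1"
| "fval (FGet a e) \<sigma> = fmem \<sigma> a (nval e \<sigma>)"
| "fval (FPlus e1 e2) \<sigma> = fval e1 \<sigma> + fval e2 \<sigma>"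
| "fval (FMinus e1 e2) \<sigma> = fval e1 \<sigma> - fval e2 \<sigma>"
| "fval (FTimes e1 e2) \<sigma> = fval e1 \<sigma> * fval e2 \<sigma>"
| "fval (FDivide e1 e2) \<sigma> = fval e1 \<sigma> / fval e2 \<sigma>"

fun bval :: "bexp \<Rightarrow> 'a::field machine \<Rightarrow> bool" where
  "bval (NLess e1 e2) \<sigma> = (nval e1 \<sigma> < nval e2 \<sigma>)"
| "bval (FEq e1 e2) \<sigma> = (fval e1 \<sigma> = fval e2 \<sigma>)"
| "bval (BNot b) \<sigma> = (\<not> bval b \<sigma>)"
| "bval (BAnd b1 b2) \<sigma> = (bval b1 \<sigma> \<and> bval b2 \<sigma>)"

definition set_nmem :: "nat \<Rightarrow> nat \<Rightarrow> nat \<Rightarrow> 'a machine \<Rightarrow> 'a machine" where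
  "set_nmem a i v \<sigma> = \<sigma>\<lparr>nmem := (nmem \<sigma>)(a := (nmem \<sigma> a)(i := v))\<rparr>"

definition set_fmem :: "nat \<Rightarrow> nat \<Rightarrow> 'a \<Rightarrow> 'a machine \<Rightarrow> 'a machine" where
  "set_fmem a i v \<sigma> = \<sigma>\<lparr>fmem := (fmem \<sigma>)(a := (fmem \<sigma> a)(i := v))\<rparr>"

text \<open>Matrices are stored row by row, and the matrices of a query one after the other.\<close>

definition query_mat :: "nat \<Rightarrow> nat \<Rightarrow> 'a machine \<Rightarrow> nat \<Rightarrow> 'a mat" where
  "query_mat a D \<sigma> i = mat D D (\<lambda>(j, k). fmem \<sigma> a ((i * D + j) * D + k))"

definition store_mat :: "nat \<Rightarrow> nat \<Rightarrow> 'a mat \<Rightarrow> 'a machine \<Rightarrow> 'a machine" where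
  "store_mat b D M \<sigma> = \<sigma>\<lparr>fmem := (fmem \<sigma>)(b :=
     (\<lambda>m. if m < D * D then M $$ (m div D, m mod D) else fmem \<sigma> b m))\<rparr>"

text \<open>
  \<open>exec n ask c \<sigma> t \<sigma>'\<close>: with \<open>ask\<close> as an oracle in \<open>n\<close> matrices, the program \<open>c\<close> started
  in \<open>\<sigma>\<close> halts in \<open>\<sigma>'\<close> after time \<open>t\<close>. A query at matrices that are not all invertible has no
  transition. The time of a query is that of writing the \<open>n\<close> argument matrices and reading the answer.
\<close>

inductive exec :: "nat \<Rightarrow> (nat \<Rightarrow> (nat \<Rightarrow> 'a mat) \<Rightarrow> 'a mat) \<Rightarrow> com \<Rightarrow>
    'a::field machine \<Rightarrow> nat \<Rightarrow> 'a machine \<Rightarrow> bool"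
  for n :: nat and ask :: "nat \<Rightarrow> (nat \<Rightarrow> 'a mat) \<Rightarrow> 'a mat" where
  Skip: "exec n ask Skip \<sigma> 1 \<sigma>"
| NSet: "exec n ask (NSet a i e) \<sigma> 1 (set_nmem a (nval i \<sigma>) (nval e \<sigma>) \<sigma>)"
| FSet: "exec n ask (FSet a i e) \<sigma> 1 (set_fmem a (nval i \<sigma>) (fval e \<sigma>) \<sigma>)"
| Seq: "exec n ask c1 \<sigma> t1 \<sigma>1 \<Longrightarrow> exec n ask c2 \<sigma>1 t2 \<sigma>2 \<Longrightarrow>
    exec n ask (Seq c1 c2) \<sigma> (t1 + t2) \<sigma>2"
| IfTrue: "bval b \<sigma> \<Longrightarrow> exec n ask c1 \<sigma> t \<sigma>1 \<Longrightarrow>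
    exec n ask (If b c1 c2) \<sigma> (1 + t) \<sigma>1"
| IfFalse: "\<not> bval b \<sigma> \<Longrightarrow> exec n ask c2 \<sigma> t \<sigma>1 \<Longrightarrow>
    exec n ask (If b c1 c2) \<sigma> (1 + t) \<sigma>1"
| WhileFalse: "\<not> bval b \<sigma> \<Longrightarrow> exec n ask (While b c) \<sigma> 1 \<sigma>"
| WhileTrue: "bval b \<sigma> \<Longrightarrow> exec n ask c \<sigma> t1 \<sigma>1 \<Longrightarrow>
    exec n ask (While b c) \<sigma>1 t2 \<sigma>2 \<Longrightarrow>
    exec n ask (While b c) \<sigma> (1 + t1 + t2) \<sigma>2"
| Query: "D = nval e \<sigma> \<Longrightarrow> 0 < D \<Longrightarrow> (\<forall>i < n. invertible_mat (query_mat a D \<sigma> i)) \<Longrightarrow>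
    exec n ask (Query a e b) \<sigma> (1 + (n + 1) * D * D)
      (store_mat b D (ask D (query_mat a D \<sigma>)) \<sigma>)"
| EmitLetter: "exec n ask (EmitLetter i e) \<sigma> 1
    (\<sigma>\<lparr>cur_word := cur_word \<sigma> @ [(nval i \<sigma>, nval e \<sigma> \<noteq> 0)]\<rparr>)"
| EmitTerm: "exec n ask (EmitTerm e) \<sigma> 1
    (\<sigma>\<lparr>cur_word := [], out_terms := out_terms \<sigma> @ [(cur_word \<sigma>, fval e \<sigma>)]\<rparr>)"

inductive_cases exec_SkipE: "exec n ask Skip \<sigma> t \<sigma>'"
inductive_cases exec_NSetE: "exec n ask (NSet a i e) \<sigma> t \<sigma>'"
inductive_cases exec_FSetE: "exec n ask (FSet a i e) \<sigma> t \<sigma>'"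
inductive_cases exec_SeqE: "exec n ask (Seq c1 c2) \<sigma> t \<sigma>'"
inductive_cases exec_IfE: "exec n ask (If b c1 c2) \<sigma> t \<sigma>'"
inductive_cases exec_WhileE: "exec n ask (While b c) \<sigma> t \<sigma>'"
inductive_cases exec_QueryE: "exec n ask (Query a e b) \<sigma> t \<sigma>'"
inductive_cases exec_EmitLetterE: "exec n ask (EmitLetter i e) \<sigma> t \<sigma>'"
inductive_cases exec_EmitTermE: "exec n ask (EmitTerm e) \<sigma> t \<sigma>'"

lemma exec_deterministic:
  "exec n ask c \<sigma> t \<sigma>1 \<Longrightarrow> exec n ask c \<sigma> u \<sigma>2 \<Longrightarrow> u = t \<and> \<sigma>2 = \<sigma>1"
proof (induction arbitrary: u \<sigma>2 rule: exec.induct)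
  case (Skip \<sigma>)
  from Skip.prems show ?case by (rule exec_SkipE) simp
next
  case (NSet a i e \<sigma>)
  from NSet.prems show ?case by (rule exec_NSetE) simp
next
  case (FSet a i e \<sigma>)
  from FSet.prems show ?case by (rule exec_FSetE) simp
next
  case (Seq c1 \<sigma> t1 \<sigma>1 c2 t2 \<sigma>')
  from Seq.prems obtain u1 u2 \<tau> where
    "exec n ask c1 \<sigma> u1 \<tau>" "exec n ask c2 \<tau> u2 \<sigma>2" "u = u1 + u2"
    by (rule exec_SeqE)
  then show ?case using Seq.IH(1)[of u1 \<tau>] Seq.IH(2)[of u2 \<sigma>2] by simp
next
  case (IfTrue b \<sigma> c1 t \<sigma>1 c2)
  from IfTrue.prems obtain u1 where "exec n ask c1 \<sigma> u1 \<sigma>2" "u = 1 + u1"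
    by (rule exec_IfE) (use IfTrue.hyps in simp_all)
  then show ?case using IfTrue.IH[of u1 \<sigma>2] by simp
next
  case (IfFalse b \<sigma> c2 t \<sigma>1 c1)
  from IfFalse.prems obtain u1 where "exec n ask c2 \<sigma> u1 \<sigma>2" "u = 1 + u1"
    by (rule exec_IfE) (use IfFalse.hyps in simp_all)
  then show ?case using IfFalse.IH[of u1 \<sigma>2] by simp
next
  case (WhileFalse b \<sigma> c)
  from WhileFalse.prems show ?case by (rule exec_WhileE) (use WhileFalse.hyps in simp_all)
next
  case (WhileTrue b \<sigma> c t1 \<sigma>1 t2 \<sigma>')
  from WhileTrue.prems obtain u1 u2 \<tau> where
    "exec n ask c \<sigma> u1 \<tau>" "exec n ask (While b c) \<tau> u2 \<sigma>2" "u = 1 + u1 + u2"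
    by (rule exec_WhileE) (use WhileTrue.hyps in simp_all)
  then show ?case using WhileTrue.IH(1)[of u1 \<tau>] WhileTrue.IH(2)[of u2 \<sigma>2] by simp
next
  case (Query D e \<sigma> a b)
  from Query.prems show ?case by (rule exec_QueryE) (simp add: Query.hyps(1))
next
  case (EmitLetter i e \<sigma>)
  from EmitLetter.prems show ?case by (rule exec_EmitLetterE) simp
next
  case (EmitTerm e \<sigma>)
  from EmitTerm.prems show ?case by (rule exec_EmitTermE) simp
qed

text \<open>The input \<open>n, d, s\<close> is in the first three cells of natural number array \<open>0\<close>.\<close>

definition initial :: "nat \<Rightarrow> nat \<Rightarrow> nat \<Rightarrow> 'a::zero machine" where
  "initial n d s = \<lparr>
     nmem = (\<lambda>a i. if a = 0 \<and> i = 0 then n else if a = 0 \<and> i = 1 then d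
                  else if a = 0 \<and> i = 2 then s else 0),
     fmem = (\<lambda>a i. 0), cur_word = [], out_terms = []\<rparr>"

definition is_term_list :: "(gword \<times> 'a) list \<Rightarrow> (gword \<Rightarrow>\<^sub>0 'a::zero) \<Rightarrow> bool" where
  "is_term_list ts f \<longleftrightarrow> distinct (map fst ts) \<and> set ts = (\<lambda>w. (w, Poly_Mapping.lookup f w)) ` Poly_Mapping.keys f"

end

theory Submission
  imports Defs "HOL-Library.Nat_Bijection" "HOL-Computational_Algebra.Polynomial"
begin

text \<open>
  Give every letter a code \<open>c\<close> and consider row vectors with \<open>2 * d + 1\<close> layers of two coordinates.
  Put \<open>p_c = (1, c)\<close>, \<open>q_c = (c, -1)\<close> and let \<open>N_c\<close> map layer \<open>j\<close> to layer \<open>j + 1\<close> by a weighted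
  copy of the rank one matrix \<open>p_c q_c\<close>. Then \<open>N_c N_c = 0\<close>, and a letter with code \<open>c\<close> and inverse
  code \<open>c'\<close> can be represented by \<open>(1 + N_c) (1 - N_c')\<close>, whose inverse is the matrix of the inverse
  letter. A word of length \<open>m\<close> climbs at most \<open>2 * m\<close> layers, and its entry from layer \<open>0\<close> to layer
  \<open>2 * m\<close> is a nonzero constant times the product of the weights of its letters exactly when it is
  reduced, since \<open>q_c p_c' = c - c'\<close>.

  Weights \<open>0\<close> and \<open>1\<close> enforce a prescribed prefix. On the remaining positions the weights are
  \<open>z ^ 2 ^ i\<close> with different \<open>i\<close> for different pairs of position and letter, so different words
  get different powers of \<open>z\<close>. Taking \<open>z = 2 ^ k\<close> for \<open>k < s\<close>, a Vandermonde argument shows that one of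
  the \<open>s\<close> values is nonzero iff some word of length \<open>m\<close> with the given prefix occurs.

  The program extends prefixes letter by letter, from length \<open>d\<close> down to \<open>0\<close>. The terms already
  found are evaluated by the program itself and subtracted from the answers of the oracle, which
  removes the contribution of the longer words. Once the prefix is a complete word, the value divided
  by the entry of that word is the coefficient.
\<close>

section \<open>A matrix representation of the free group\<close>

text \<open>A generator has a single matrix, wherever its letter stands in a word, while a prefix
  test needs weights that depend on the position. The layers supply the position: a word of length
  \<open>m\<close> rises by \<open>2 * m\<close> layers only if each of its letters climbs two, so
  letter number \<open>t\<close> (counted from \<open>0\<close>) is met at layer
  \<open>2 * t\<close>, and a weight on the steps out of that layer acts on that position.

  Two factors per letter are there for repeated letters. With \<open>1 + N_c\<close> for a letter
  and \<open>1 - N_c\<close> for its inverse, a letter written twice would lose its top entry just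
  as a cancelling pair does, since \<open>N_c N_c = 0\<close>. With
  \<open>(1 + N_c) (1 - N_c')\<close> the top term of a square is \<open>N_c N_c' N_c N_c'\<close>,
  which survives, and only a letter followed by its inverse brings equal codes together.

  Characteristic zero enters twice: the codes \<open>1, ..., 2 * n\<close> are distinct scalars, and
  so are the powers of \<open>2\<close> that serve as nodes. The exponents \<open>2 ^ i\<close> are
  huge, but repeated squaring yields each weight with one field operation.\<close>

definition code :: "nat \<Rightarrow> letter \<Rightarrow> nat" where
  "code n l = Suc (fst l) + (if snd l then n else 0)"

definition icode :: "nat \<Rightarrow> nat \<Rightarrow> nat" where
  "icode n c = (if c < Suc n then c + n else c - n)"

text \<open>Code \<open>0\<close> is left free by the letters: it marks an open position of a prefix
  and the padding behind a stored word.\<close>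

lemma code_bounds: "fst l < n \<Longrightarrow> 0 < code n l \<and> code n l \<le> 2 * n"
  by (auto simp: code_def)

lemma icode_code: "fst l < n \<Longrightarrow> icode n (code n l) = code n (fst l, \<not> snd l)"
  by (auto simp: code_def icode_def)

lemma code_inject: "fst l < n \<Longrightarrow> fst l' < n \<Longrightarrow> code n l = code n l' \<longleftrightarrow> l = l'"
  by (cases l; cases l') (auto simp: code_def split: if_splits)

lemma icode_bounds: "0 < c \<Longrightarrow> c \<le> 2 * n \<Longrightarrow> 0 < icode n c \<and> icode n c \<le> 2 * n"
  by (auto simp: icode_def)

lemma icode_icode: "0 < c \<Longrightarrow> c \<le> 2 * n \<Longrightarrow> icode n (icode n c) = c"
  by (auto simp: icode_def)

lemma icode_neq: "0 < c \<Longrightarrow> c \<le> 2 * n \<Longrightarrow> icode n c \<noteq> c"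
  by (auto simp: icode_def)

text \<open>
  Coordinates \<open>2 * j\<close> and \<open>2 * j + 1\<close> form layer \<open>j \<le> 2 * d\<close>. With \<open>p = (1, c)\<close> and
  \<open>q = (c, -1)\<close>, the nilpotent operator of code \<open>c\<close> maps the row vector \<open>v\<close> of layer \<open>j\<close> to
  \<open>(v \<cdot> p) q\<close> in layer \<open>j + 1\<close>; it squares to zero because \<open>q \<cdot> p = 0\<close>, and
  different codes have \<open>q \<cdot> p' \<noteq> 0\<close>. Only the steps out of even layers \<open>2 * t\<close> carry a
  weight, \<open>E t c\<close>.
\<close>

definition nilp :: "nat \<Rightarrow> (nat \<Rightarrow> nat \<Rightarrow> 'a) \<Rightarrow> nat \<Rightarrow> (nat \<Rightarrow> 'a::field) \<Rightarrow> nat \<Rightarrow> 'a" where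
  "nilp d E c v x = (if 2 \<le> x \<and> x < 4 * d + 2 then
     let j = x div 2 - 1 in
       (if even j then E (j div 2) c else 1) * (v (2 * j) + of_nat c * v (2 * j + 1)) *
       (if even x then of_nat c else - 1)
     else 0)"

definition shear :: "nat \<Rightarrow> (nat \<Rightarrow> nat \<Rightarrow> 'a) \<Rightarrow> 'a \<Rightarrow> nat \<Rightarrow> (nat \<Rightarrow> 'a::field) \<Rightarrow> nat \<Rightarrow> 'a" where
  "shear d E \<epsilon> c v x = v x + \<epsilon> * nilp d E c v x"

definition act :: "nat \<Rightarrow> nat \<Rightarrow> (nat \<Rightarrow> nat \<Rightarrow> 'a) \<Rightarrow> nat \<Rightarrow> (nat \<Rightarrow> 'a::field) \<Rightarrow> nat \<Rightarrow> 'a" where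
  "act n d E c v = shear d E (- 1) (icode n c) (shear d E 1 c v)"

definition word_act :: "nat \<Rightarrow> nat \<Rightarrow> (nat \<Rightarrow> nat \<Rightarrow> 'a) \<Rightarrow> gword \<Rightarrow> (nat \<Rightarrow> 'a::field) \<Rightarrow> nat \<Rightarrow> 'a" where
  "word_act n d E w = fold (\<lambda>l. act n d E (code n l)) w"

definition unit_fun :: "nat \<Rightarrow> nat \<Rightarrow> 'a::zero_neq_one" where
  "unit_fun r x = (if x = r then 1 else 0)"

lemma div4_simps:
  "(4 * t + 2) div 2 = 2 * t + (1::nat)" "(4 * t + 3) div 2 = 2 * t + (1::nat)"
  "(4 * t + 4) div 2 = 2 * t + (2::nat)" "(4 * t + 5) div 2 = 2 * t + (2::nat)"
  by presburger+

lemma nilp_eval: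
  assumes "t < d"
  shows "nilp d E c v (4 * t + 2) = E t c * (v (4 * t) + of_nat c * v (4 * t + 1)) * of_nat c"
    and "nilp d E c v (4 * t + 3) = - (E t c * (v (4 * t) + of_nat c * v (4 * t + 1)))"
    and "nilp d E c v (4 * t + 4) = (v (4 * t + 2) + of_nat c * v (4 * t + 3)) * of_nat c"
    and "nilp d E c v (4 * t + 5) = - (v (4 * t + 2) + of_nat c * v (4 * t + 3))"
proof -
  have a: "2 * (2 * t) = 4 * t" "2 * (2 * t + 1) = 4 * t + 2" "2 * t + 2 - 1 = 2 * t + 1"
    "4 * t + 2 + 1 = 4 * t + 3"
    by simp_all
  show "nilp d E c v (4 * t + 2) = E t c * (v (4 * t) + of_nat c * v (4 * t + 1)) * of_nat c"
    using assms by (simp add: nilp_def Let_def div4_simps)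
  show "nilp d E c v (4 * t + 3) = - (E t c * (v (4 * t) + of_nat c * v (4 * t + 1)))"
    using assms by (simp add: nilp_def Let_def div4_simps)
  show "nilp d E c v (4 * t + 4) = (v (4 * t + 2) + of_nat c * v (4 * t + 3)) * of_nat c"
    using assms unfolding nilp_def Let_def div4_simps a by simp
  show "nilp d E c v (4 * t + 5) = - (v (4 * t + 2) + of_nat c * v (4 * t + 3))"
    using assms unfolding nilp_def Let_def div4_simps a by simp
qed

text \<open>Each layer of an image is a multiple of \<open>(c, - 1)\<close>, whose pairing with
  \<open>(1, c)\<close> is \<open>c - c = 0\<close>. Layer \<open>0\<close> is never hit, hence the
  separate case.\<close>

lemma nilp_dot:
  assumes "2 * j + 1 < 4 * d + 2"
  shows "nilp d E c v (2 * j) + of_nat c * nilp d E c v (2 * j + 1) = 0"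
proof (cases "j = 0")
  case True
  then show ?thesis by (simp add: nilp_def)
next
  case False
  have "2 * j div 2 = j" "(2 * j + 1) div 2 = j" "even (2 * j)" "odd (2 * j + 1)" by simp_all
  moreover have "2 \<le> 2 * j \<and> 2 * j < 4 * d + 2" "2 \<le> 2 * j + 1 \<and> 2 * j + 1 < 4 * d + 2"
    using assms False by auto
  ultimately show ?thesis unfolding nilp_def Let_def by simp
qed

lemma nilp_nilp: "nilp d E c (nilp d E c v) x = 0"
proof (cases "2 \<le> x \<and> x < 4 * d + 2")
  case True
  then have "2 * (x div 2 - 1) + 1 < 4 * d + 2" by linarith
  from nilp_dot[OF this, of E c v] show ?thesis
    unfolding nilp_def[of d E c "nilp d E c v"] Let_def by simp
next
  case False
  then show ?thesis unfolding nilp_def[of d E c "nilp d E c v"] by (simp only: if_False)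
qed

lemma nilp_add: "nilp d E c (\<lambda>x. u x + a * v x) x = nilp d E c u x + a * nilp d E c v x"
proof -
  have dist: "e * ((p + a * q) + k * (p' + a * q')) * b = e * (p + k * p') * b + a * (e * (q + k * q') * b)"
    for e p q k p' q' b :: 'a
    by (simp add: algebra_simps)
  show ?thesis
  proof (cases "2 \<le> x \<and> x < 4 * d + 2")
    case True
    show ?thesis unfolding nilp_def Let_def if_P[OF True] by (rule dist)
  next
    case False
    show ?thesis unfolding nilp_def if_not_P[OF False] by simp
  qed
qed

text \<open>\<open>(1 + \<epsilon> N) (1 - \<epsilon> N) = 1 - \<epsilon>^2 N^2\<close>, and
  \<open>N\<close> squares to zero.\<close>

lemma shear_shear: "shear d E \<epsilon> c (shear d E (- \<epsilon>) c v) = v"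
proof
  fix x
  have "nilp d E c (shear d E (- \<epsilon>) c v) x = nilp d E c v x"
    unfolding shear_def by (subst nilp_add) (simp add: nilp_nilp)
  then show "shear d E \<epsilon> c (shear d E (- \<epsilon>) c v) x = v x"
    by (simp add: shear_def)
qed

text \<open>As \<open>icode\<close> is an involution, the composition is
  \<open>(1 + N_c) (1 - N_c') (1 + N_c') (1 - N_c)\<close>: the inner pair cancels, then the outer
  one.\<close>

lemma act_icode_act:
  assumes "0 < c" "c \<le> 2 * n"
  shows "act n d E (icode n c) (act n d E c v) = v"
  using shear_shear[of d E 1] shear_shear[of d E "- 1"]
  by (simp add: act_def icode_icode[OF assms])

text \<open>Linear endomorphisms of the functions that vanish from \<open>D\<close> on, acting on row vectors.\<close>

definition lin_op :: "nat \<Rightarrow> ((nat \<Rightarrow> 'a) \<Rightarrow> nat \<Rightarrow> 'a::field) \<Rightarrow> bool" where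
  "lin_op D T \<longleftrightarrow> (\<forall>u v a. T (\<lambda>x. u x + a * v x) = (\<lambda>x. T u x + a * T v x)) \<and>
     (\<forall>v. (\<forall>x \<ge> D. v x = 0) \<longrightarrow> (\<forall>x \<ge> D. T v x = 0))"

definition op_mat :: "nat \<Rightarrow> ((nat \<Rightarrow> 'a) \<Rightarrow> nat \<Rightarrow> 'a::field) \<Rightarrow> 'a mat" where
  "op_mat D T = mat D D (\<lambda>(r, x). T (unit_fun r) x)"

lemma lin_opD: "lin_op D T \<Longrightarrow> T (\<lambda>x. u x + a * v x) = (\<lambda>x. T u x + a * T v x)"
  by (simp add: lin_op_def)

lemma lin_op_zero: "lin_op D T \<Longrightarrow> T (\<lambda>x. 0) = (\<lambda>x. 0)"
  using lin_opD[of D T "\<lambda>x. 0" "- 1" "\<lambda>x. 0"] by simp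

lemma lin_op_sum:
  assumes "lin_op D T"
  shows "T (\<lambda>x. \<Sum>r<k. a r * u r x) = (\<lambda>x. \<Sum>r<(k::nat). a r * T (u r) x)"
proof (induction k)
  case 0
  show ?case using lin_op_zero[OF assms] by simp
next
  case (Suc k)
  from lin_opD[OF assms, of "\<lambda>x. \<Sum>r<k. a r * u r x" "a k" "u k"] Suc show ?case by simp
qed

lemma lin_op_expand:
  assumes T: "lin_op D T" and v: "\<forall>x \<ge> D. v x = 0"
  shows "T v x = (\<Sum>r<D. v r * T (unit_fun r) x)"
proof -
  have "(\<lambda>x. \<Sum>r<D. v r * unit_fun r x) = v"
  proof
    fix x show "(\<Sum>r<D. v r * unit_fun r x) = v x"
      using v by (cases "x < D") (auto simp: unit_fun_def sum.remove[of "{..<D}" x])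
  qed
  from lin_op_sum[OF T, of v unit_fun D, unfolded this] show ?thesis by simp
qed

text \<open>Row \<open>r\<close> of a matrix is the image of unit vector \<open>r\<close>, so row
  vectors enter from the left and the left factor acts first. A word can thus be read from left to
  right.\<close>

lemma op_mat_mult:
  assumes S: "lin_op D S" and T: "lin_op D T"
  shows "op_mat D S * op_mat D T = op_mat D (\<lambda>v. T (S v))"
proof (rule eq_matI)
  fix i j assume "i < dim_row (op_mat D (\<lambda>v. T (S v)))" "j < dim_col (op_mat D (\<lambda>v. T (S v)))"
  then have ij: "i < D" "j < D" by (simp_all add: op_mat_def)
  have "\<forall>x \<ge> D. S (unit_fun i) x = 0"
    using S ij unfolding lin_op_def unit_fun_def by auto
  from lin_op_expand[OF T this, of j] ij
  show "(op_mat D S * op_mat D T) $$ (i, j) = op_mat D (\<lambda>v. T (S v)) $$ (i, j)"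
    by (simp add: op_mat_def scalar_prod_def atLeast0LessThan)
qed (simp_all add: op_mat_def)

lemma op_mat_id: "op_mat D (\<lambda>v. v) = 1\<^sub>m D"
  by (rule eq_matI) (auto simp: op_mat_def unit_fun_def)

lemma lin_op_comp: "lin_op D S \<Longrightarrow> lin_op D T \<Longrightarrow> lin_op D (\<lambda>v. T (S v))"
  by (simp add: lin_op_def)

lemma lin_op_shear: "lin_op (4 * d + 2) (shear d E \<epsilon> c)"
  unfolding lin_op_def
proof (intro conjI allI impI)
  fix u v :: "nat \<Rightarrow> 'a" and a
  show "shear d E \<epsilon> c (\<lambda>x. u x + a * v x) = (\<lambda>x. shear d E \<epsilon> c u x + a * shear d E \<epsilon> c v x)"
    by (rule ext) (simp add: shear_def nilp_add algebra_simps)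
qed (simp add: shear_def nilp_def)

lemma lin_op_act: "lin_op (4 * d + 2) (act n d E c)"
  using lin_op_comp[OF lin_op_shear[of d E 1 c] lin_op_shear[of d E "- 1" "icode n c"]]
  unfolding act_def[abs_def] .

lemma lin_op_word_act: "lin_op (4 * d + 2) (word_act n d E w)"
proof (induction w)
  case Nil
  then show ?case by (simp add: word_act_def lin_op_def)
next
  case (Cons l w)
  from lin_op_comp[OF lin_op_act[of d n E "code n l"] this] show ?case
    by (simp add: word_act_def o_def)
qed

section \<open>The matrices of the generators and the answer of the black box at them\<close>

context
  fixes n d D :: nat and E :: "nat \<Rightarrow> nat \<Rightarrow> 'a::field" and A :: "nat \<Rightarrow> 'a mat"
  assumes D: "D = 4 * d + 2"
    and A: "\<And>i. i < n \<Longrightarrow> A i = op_mat D (act n d E (Suc i))"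
begin

lemma lin_D: "lin_op D (act n d E c)" "lin_op D (word_act n d E w)"
  unfolding D by (rule lin_op_act, rule lin_op_word_act)

lemma act_mat_inverse:
  assumes "i < n"
  defines "B \<equiv> op_mat D (act n d E (Suc i + n))"
  shows "A i * B = 1\<^sub>m D" "B * A i = 1\<^sub>m D"
proof -
  have ic: "icode n (Suc i) = Suc i + n" "icode n (Suc i + n) = Suc i"
    using assms(1) by (simp_all add: icode_def)
  have "act n d E (Suc i + n) (act n d E (Suc i) v) = v" for v
    using act_icode_act[of "Suc i" n d E v] assms(1) unfolding ic by simp
  then have 1: "(\<lambda>v. act n d E (Suc i + n) (act n d E (Suc i) v)) = (\<lambda>v. v)"
    by (rule ext)
  have "act n d E (Suc i) (act n d E (Suc i + n) v) = v" for v
    using act_icode_act[of "Suc i + n" n d E v] assms(1) unfolding ic by simp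
  then have 2: "(\<lambda>v. act n d E (Suc i) (act n d E (Suc i + n) v)) = (\<lambda>v. v)"
    by (rule ext)
  show "A i * B = 1\<^sub>m D" "B * A i = 1\<^sub>m D"
    unfolding A[OF assms(1)] B_def
    by (subst op_mat_mult[OF lin_D(1) lin_D(1)], (subst 1 | subst 2), rule op_mat_id)+
qed

lemma act_mat_invertible:
  assumes "i < n"
  shows "invertible_mat (A i)"
proof -
  define B where "B = op_mat D (act n d E (Suc i + n))"
  note inv = act_mat_inverse[OF assms, folded B_def]
  have dim: "dim_row (A i) = D" "dim_col (A i) = D" "dim_row B = D"
    unfolding A[OF assms] B_def op_mat_def by simp_all
  show ?thesis
    unfolding invertible_mat_def inverts_mat_def
  proof (intro conjI exI)
    show "square_mat (A i)" using dim by simp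
    show "A i * B = 1\<^sub>m (dim_row (A i))" "B * A i = 1\<^sub>m (dim_row B)"
      unfolding dim by (fact inv)+
  qed
qed

text \<open>The inverse in \<open>letter_mat\<close> is the result of an algorithm that is specified
  through units of the matrix ring. The explicit inverse \<open>B\<close> shows that the matrix is a
  unit, and uniqueness of inverses identifies the result with \<open>B\<close>.\<close>

lemma letter_mat_act:
  assumes "fst l < n"
  shows "letter_mat A l = op_mat D (act n d E (code n l))"
proof (cases "snd l")
  case False
  then show ?thesis using A[OF assms] by (simp add: letter_mat_def code_def)
next
  case True
  define B where "B = op_mat D (act n d E (Suc (fst l) + n))"
  have Ac: "A (fst l) \<in> carrier_mat D D"
    and Bc: "B \<in> carrier_mat D D"
    unfolding A[OF assms] B_def op_mat_def by simp_all
  note inv = act_mat_inverse[OF assms, folded B_def]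
  have "mat_inverse (A (fst l)) \<noteq> None"
  proof
    assume "mat_inverse (A (fst l)) = None"
    from mat_inverse(1)[OF Ac this, of undefined]
    have "A (fst l) \<notin> Units (ring_mat TYPE('a) D undefined)" .
    moreover have "A (fst l) \<in> Units (ring_mat TYPE('a) D undefined)"
      unfolding Units_def mem_Collect_eq
      by (rule conjI[OF _ bexI[of _ B]]) (simp_all only: ring_mat_simps inv Ac Bc simp_thms)
    ultimately show False by contradiction
  qed
  then obtain B' where B': "mat_inverse (A (fst l)) = Some B'" by auto
  from mat_inverse(2)[OF Ac this] have 1: "A (fst l) * B' = 1\<^sub>m D"
    and B'c: "B' \<in> carrier_mat D D" by auto
  have "B' = (B * A (fst l)) * B'" using inv B'c by simp
  also have "\<dots> = B * (A (fst l) * B')" by (rule assoc_mult_mat[OF Bc Ac B'c])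
  also have "\<dots> = B" using 1 Bc by simp
  finally show ?thesis using B' True by (simp add: letter_mat_def B_def code_def)
qed

lemma word_mat_act:
  assumes "\<forall>l \<in> set w. fst l < n"
  shows "word_mat D A w = op_mat D (word_act n d E w)"
  using assms
proof (induction w)
  case Nil
  then show ?case by (simp only: word_mat_def word_act_def op_mat_id foldr.simps fold.simps id_def)
next
  case (Cons l w)
  then have "word_mat D A (l # w) =
      op_mat D (act n d E (code n l)) * op_mat D (word_act n d E w)"
    by (simp add: word_mat_def letter_mat_act)
  also have "\<dots> = op_mat D (word_act n d E (l # w))"
    by (subst op_mat_mult[OF lin_D(1) lin_D(2)]) (simp add: word_act_def o_def)
  finally show ?case .
qed

text \<open>The test entry lies in row \<open>0\<close>, and row \<open>0\<close> of the matrix of a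
  word is the image of the first unit vector. So a known word can be evaluated by moving one vector,
  without matrix products.\<close>

lemma black_box_act:
  assumes "f \<in> free_group_algebra n" "x < D"
  shows "black_box f D A $$ (0, x) =
    (\<Sum>w\<in>Poly_Mapping.keys f. Poly_Mapping.lookup f w * word_act n d E w (unit_fun 0) x)"
proof -
  have "word_mat D A w $$ (0, x) = word_act n d E w (unit_fun 0) x"
    if "w \<in> Poly_Mapping.keys f" for w
  proof -
    have "\<forall>l \<in> set w. fst l < n"
      using assms(1) that by (auto simp: free_group_algebra_def reduced_words_def)
    from word_mat_act[OF this] assms(2) show ?thesis by (simp add: op_mat_def)
  qed
  then show ?thesis using assms(2) by (simp add: black_box_def)
qed

end

text \<open>A vector supported up to layer \<open>2 * t\<close> is paired with
  \<open>(1, c)\<close>, becomes a multiple of \<open>(c, - 1)\<close> in layer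
  \<open>2 * t + 1\<close>, and is paired there with \<open>(1, c')\<close> for
  \<open>c' = icode n c\<close>. This gives \<open>c - c'\<close>, which the sign of the second
  factor turns into the \<open>c' - c\<close> in \<open>e\<close>; what arrives in layer
  \<open>2 * t + 2\<close> is \<open>e\<close> times \<open>(c', - 1)\<close>.\<close>

lemma act_layers:
  fixes E :: "nat \<Rightarrow> nat \<Rightarrow> 'a::field" and c n :: nat
  assumes t: "t < d" and v: "\<And>x. 4 * t + 2 \<le> x \<Longrightarrow> v x = 0"
  defines "e \<equiv> E t c * (v (4 * t) + of_nat c * v (4 * t + 1)) * (of_nat (icode n c) - of_nat c)"
  shows "4 * t + 6 \<le> x \<Longrightarrow> act n d E c v x = 0"
    and "act n d E c v (4 * t + 4) = e * of_nat (icode n c)"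
    and "act n d E c v (4 * t + 5) = - e"
proof -
  let ?u = "shear d E 1 c v"
  have "nilp d E c v x = 0" if x: "x \<ge> 4 * t + 4" for x
  proof -
    \<comment> \<open>The entry at \<open>x\<close> comes from the layer just below, which already
      lies beyond the support of \<open>v\<close>.\<close>
    have "2 * (x div 2 - 1) \<ge> 4 * t + 2" using x by presburger
    then show ?thesis using v by (simp add: nilp_def Let_def)
  qed
  then have u0: "?u x = 0" if "x \<ge> 4 * t + 4" for x
    using v that by (simp add: shear_def)
  have u2: "?u (4 * t + 2) = E t c * (v (4 * t) + of_nat c * v (4 * t + 1)) * of_nat c"
    "?u (4 * t + 3) = - (E t c * (v (4 * t) + of_nat c * v (4 * t + 1)))"
    unfolding shear_def nilp_eval[OF t] using v[of "4 * t + 2"] v[of "4 * t + 3"] by simp_all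
  show "act n d E c v x = 0" if x: "4 * t + 6 \<le> x"
  proof -
    have "2 * (x div 2 - 1) \<ge> 4 * t + 4" using x by presburger
    then show ?thesis using u0 x
      by (simp add: act_def shear_def[of d E "- 1"]) (simp add: nilp_def Let_def)
  qed
  show "act n d E c v (4 * t + 4) = e * of_nat (icode n c)"
    "act n d E c v (4 * t + 5) = - e"
    unfolding act_def shear_def[of d E "- 1"] nilp_eval[OF t] u2 e_def
    using u0[of "4 * t + 4"] u0[of "4 * t + 5"] by (simp_all add: algebra_simps)
qed

lemma reduced_snoc:
  "reduced (w @ [l]) \<longleftrightarrow> reduced w \<and> (w \<noteq> [] \<longrightarrow> \<not> (fst (last w) = fst l \<and> snd (last w) \<noteq> snd l))"
  by (auto simp: reduced_def successively_append_iff)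

text \<open>The constant is chosen before \<open>d\<close> and \<open>E\<close>: it depends on the
  word alone and stays fixed while the weights vary. The induction carries both coordinates of the
  top layer, since the next letter pairs with both: a multiple of \<open>(c', - 1)\<close> with
  \<open>c'\<close> the inverse code of the last letter, or \<open>(1, 0)\<close> up to a scalar for
  the empty word.\<close>

lemma word_act_top:
  fixes n :: nat
  assumes "w \<in> reduced_words n"
  shows "\<exists>\<kappa>. \<kappa> \<noteq> 0 \<and> (\<forall>d (E :: nat \<Rightarrow> nat \<Rightarrow> 'a::field_char_0). length w \<le> d \<longrightarrow>
    (let v = word_act n d E w (unit_fun 0); e = \<kappa> * (\<Prod>t<length w. E t (code n (w ! t))) in
      (\<forall>x \<ge> 4 * length w + 2. v x = 0) \<and>
      v (4 * length w) = e * (if w = [] then 1 else of_nat (icode n (code n (last w)))) \<and>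
      v (4 * length w + 1) = (if w = [] then 0 else - e)))"
  using assms
proof (induction w rule: rev_induct)
  case Nil
  show ?case by (rule exI[of _ 1]) (auto simp: word_act_def unit_fun_def Let_def)
next
  case (snoc l w)
  define c where "c = code n l"
  have w: "w \<in> reduced_words n" and l: "fst l < n"
    using snoc.prems by (auto simp: reduced_words_def reduced_snoc)
  from snoc.IH[OF w] obtain \<kappa> :: 'a where \<kappa>: "\<kappa> \<noteq> 0" and
    IH: "\<And>d (E :: nat \<Rightarrow> nat \<Rightarrow> 'a). length w \<le> d \<Longrightarrow>
    (let v = word_act n d E w (unit_fun 0); e = \<kappa> * (\<Prod>t<length w. E t (code n (w ! t))) in
      (\<forall>x \<ge> 4 * length w + 2. v x = 0) \<and>
      v (4 * length w) = e * (if w = [] then 1 else of_nat (icode n (code n (last w)))) \<and>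
      v (4 * length w + 1) = (if w = [] then 0 else - e))"
    by auto
  \<comment> \<open>The pairing of the current top layer with \<open>(1, c)\<close>, freed of the
    scalar \<open>e\<close>.\<close>
  define \<delta> :: 'a where "\<delta> = (if w = [] then 1 else of_nat (icode n (code n (last w))) - of_nat c)"
  define \<eta> :: 'a where "\<eta> = of_nat (icode n c) - of_nat c"
  \<comment> \<open>Reducedness enters here: the new letter is not the inverse of the last
    one.\<close>
  have "icode n (code n (last w)) \<noteq> c" if "w \<noteq> []"
  proof -
    have lw: "fst (last w) < n" using w that by (auto simp: reduced_words_def)
    have "l \<noteq> (fst (last w), \<not> snd (last w))"
      using snoc.prems that by (auto simp: reduced_words_def reduced_snoc)
    then show ?thesis unfolding c_def icode_code[OF lw]
      using code_inject[of "(fst (last w), \<not> snd (last w))" n l] l lw by auto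
  qed
  then have \<delta>: "\<delta> \<noteq> 0" by (simp add: \<delta>_def)
  have \<eta>: "\<eta> \<noteq> 0"
    using icode_neq[of c n] code_bounds[OF l] by (simp add: \<eta>_def c_def)
  show ?case
  proof (intro exI conjI allI impI)
    show "\<kappa> * \<delta> * \<eta> \<noteq> 0" using \<kappa> \<delta> \<eta> by simp
    fix d and E :: "nat \<Rightarrow> nat \<Rightarrow> 'a"
    assume "length (w @ [l]) \<le> d"
    then have t: "length w < d" by simp
    let ?t = "length w"
    define v where "v = word_act n d E w (unit_fun 0)"
    define e where "e = \<kappa> * (\<Prod>t<?t. E t (code n (w ! t)))"
    note IH' = IH[OF less_imp_le[OF t], of E, unfolded Let_def, folded v_def e_def]
    then have v0: "\<And>x. 4 * ?t + 2 \<le> x \<Longrightarrow> v x = 0" by blast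
    from IH' have v1: "v (4 * ?t) = e * (if w = [] then 1 else of_nat (icode n (code n (last w))))"
      and v2: "v (4 * ?t + 1) = (if w = [] then 0 else - e)"
      by blast+
    have dot: "v (4 * ?t) + of_nat c * v (4 * ?t + 1) = e * \<delta>"
      unfolding v1 v2 \<delta>_def by (simp add: algebra_simps)
    have "(\<Prod>t<Suc ?t. E t (code n ((w @ [l]) ! t))) = (\<Prod>t<?t. E t (code n (w ! t))) * E ?t c"
      by (simp add: nth_append c_def)
    then have e': "\<kappa> * \<delta> * \<eta> * (\<Prod>t<length (w @ [l]). E t (code n ((w @ [l]) ! t))) =
        E ?t c * (e * \<delta>) * \<eta>"
      by (simp add: e_def)
    have wa: "word_act n d E (w @ [l]) (unit_fun 0) = act n d E c v"
      by (simp add: word_act_def v_def c_def)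
    note al = act_layers[where E = E and c = c and n = n and v = v, OF t v0, unfolded dot, folded \<eta>_def]
    show "let v = word_act n d E (w @ [l]) (unit_fun 0);
          e = \<kappa> * \<delta> * \<eta> * (\<Prod>t<length (w @ [l]). E t (code n ((w @ [l]) ! t)))
      in (\<forall>x\<ge>4 * length (w @ [l]) + 2. v x = 0) \<and>
         v (4 * length (w @ [l])) =
         e * (if w @ [l] = [] then 1 else of_nat (icode n (code n (last (w @ [l]))))) \<and>
         v (4 * length (w @ [l]) + 1) = (if w @ [l] = [] then 0 else - e)"
    proof -
      have l: "4 * length (w @ [l]) = 4 * ?t + 4" "4 * ?t + 4 + 2 = 4 * ?t + 6"
        "4 * ?t + 4 + 1 = 4 * ?t + 5"
        by simp_all
      show ?thesis
        unfolding wa e' Let_def l using al by (simp only: c_def last_snoc) simp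
    qed
  qed
qed

text \<open>If the first \<open>card R\<close> power sums vanished, so would the sum of
  \<open>c w * p (lam w)\<close> for every polynomial \<open>p\<close> of degree below
  \<open>card R\<close>. The product of \<open>X - lam b\<close> over all \<open>b\<close> other
  than \<open>a\<close> leaves only the summand of \<open>a\<close>, which is nonzero because the
  nodes are distinct.\<close>

lemma prony_nonzero:
  fixes c lam :: "'b \<Rightarrow> 'a::field"
  assumes R: "finite R" "inj_on lam R" and a: "a \<in> R" "c a \<noteq> 0"
  shows "\<exists>k < card R. (\<Sum>w\<in>R. c w * lam w ^ k) \<noteq> 0"
proof (rule ccontr)
  assume "\<not> ?thesis"
  then have z: "(\<Sum>w\<in>R. c w * lam w ^ k) = 0" if "k < card R" for k using that by blast
  define p where "p = (\<Prod>b\<in>R - {a}. [:- lam b, 1:])"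
  have "degree p \<le> sum (degree \<circ> (\<lambda>b. [:- lam b, 1:])) (R - {a})"
    unfolding p_def by (rule degree_prod_sum_le) (use R(1) in simp)
  also have "\<dots> = card R - 1" using R(1) a(1) by simp
  finally have deg: "degree p \<le> card R - 1" .
  have "card R > 0" using R(1) a(1) by (auto simp: card_gt_0_iff)
  have pz: "poly p (lam w) = 0" if "w \<in> R" "w \<noteq> a" for w
    unfolding p_def poly_prod by (rule prod_zero) (use that R(1) in \<open>auto intro!: bexI[of _ w]\<close>)
  have pa: "poly p (lam a) \<noteq> 0"
    unfolding p_def poly_prod using R(1) inj_onD[OF R(2) _ a(1)] by fastforce
  have "c a * poly p (lam a) = (\<Sum>w\<in>R. c w * poly p (lam w))"
    using pz by (subst sum.remove[OF R(1) a(1)]) simp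
  also have "\<dots> = (\<Sum>w\<in>R. \<Sum>k\<le>degree p. coeff p k * (c w * lam w ^ k))"
    by (simp add: poly_altdef sum_distrib_left mult_ac)
  also have "\<dots> = (\<Sum>k\<le>degree p. coeff p k * (\<Sum>w\<in>R. c w * lam w ^ k))"
    by (subst sum.swap) (simp add: sum_distrib_left)
  also have "\<dots> = 0"
    using z deg \<open>card R > 0\<close> by (intro sum.neutral) auto
  finally show False using pa a by simp
qed

section \<open>Detecting prefixes\<close>

text \<open>The even coordinate of the top layer is the one that gets read. For a nonempty word it
  carries the inverse code of the last letter as an extra factor, nonzero in characteristic zero,
  which is absorbed into the constant.\<close>

lemma word_act_top_coeff:
  assumes w: "w \<in> reduced_words n"
  shows "\<exists>\<kappa>. \<kappa> \<noteq> 0 \<and> (\<forall>d (E :: nat \<Rightarrow> nat \<Rightarrow> 'a::field_char_0). length w \<le> d \<longrightarrow>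
    word_act n d E w (unit_fun 0) (4 * length w) = \<kappa> * (\<Prod>t<length w. E t (code n (w ! t))) \<and>
    (\<forall>x \<ge> 4 * length w + 2. word_act n d E w (unit_fun 0) x = 0))"
proof -
  let ?\<mu> = "if w = [] then 1 else of_nat (icode n (code n (last w))) :: 'a"
  have "fst (last w) < n" if "w \<noteq> []"
    using w that by (auto simp: reduced_words_def)
  then have "icode n (code n (last w)) \<noteq> 0" if "w \<noteq> []"
    using icode_bounds[of "code n (last w)" n] code_bounds[of "last w" n] that by auto
  then have \<mu>: "?\<mu> \<noteq> 0" by simp
  obtain \<kappa> :: 'a where "\<kappa> \<noteq> 0" and
    top: "\<And>d (E :: nat \<Rightarrow> nat \<Rightarrow> 'a). length w \<le> d \<Longrightarrow>
    (let v = word_act n d E w (unit_fun 0); e = \<kappa> * (\<Prod>t<length w. E t (code n (w ! t))) in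
      (\<forall>x \<ge> 4 * length w + 2. v x = 0) \<and> v (4 * length w) = e * ?\<mu> \<and>
      v (4 * length w + 1) = (if w = [] then 0 else - e))"
    using word_act_top[OF w, where 'a = 'a] by blast
  show ?thesis
  proof (intro exI conjI allI impI)
    show "\<kappa> * ?\<mu> \<noteq> 0" using \<open>\<kappa> \<noteq> 0\<close> \<mu> by simp
    fix d and E :: "nat \<Rightarrow> nat \<Rightarrow> 'a"
    assume "length w \<le> d"
    note t = top[OF this, of E, unfolded Let_def]
    show "word_act n d E w (unit_fun 0) (4 * length w) =
        \<kappa> * ?\<mu> * (\<Prod>t<length w. E t (code n (w ! t)))"
      unfolding conjunct1[OF conjunct2[OF t]] by (simp only: mult_ac)
    show "word_act n d E w (unit_fun 0) x = 0" if "4 * length w + 2 \<le> x" for x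
      using conjunct1[OF t] that by blast
  qed
qed

text \<open>An entry \<open>0\<close> of \<open>p\<close> leaves the position free.\<close>

definition weight :: "nat \<Rightarrow> (nat \<Rightarrow> nat) \<Rightarrow> (nat \<Rightarrow> 'a) \<Rightarrow> nat \<Rightarrow> nat \<Rightarrow> 'a::field" where
  "weight n p Z t c = (if p t = 0 then Z (t * (2 * n + 1) + c) else if p t = c then 1 else 0)"

definition matches :: "nat \<Rightarrow> nat \<Rightarrow> (nat \<Rightarrow> nat) \<Rightarrow> gword \<Rightarrow> bool" where
  "matches n m p w \<longleftrightarrow> length w = m \<and> (\<forall>t<m. p t = 0 \<or> p t = code n (w ! t))"

text \<open>Cells number the pairs of position and letter in blocks of length
  \<open>2 * n + 1\<close>, one per position, so that codes up to \<open>2 * n\<close> do not run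
  into the next block.\<close>

definition free_cells :: "nat \<Rightarrow> nat \<Rightarrow> (nat \<Rightarrow> nat) \<Rightarrow> gword \<Rightarrow> nat set" where
  "free_cells n m p w = (\<lambda>t. t * (2 * n + 1) + code n (w ! t)) ` {t. t < m \<and> p t = 0}"

lemma reduced_words_nth: "w \<in> reduced_words n \<Longrightarrow> t < length w \<Longrightarrow> fst (w ! t) < n"
  by (auto simp: reduced_words_def)

lemma cell_inject:
  assumes "t * (2 * n + 1) + c = t' * (2 * n + 1) + (c'::nat)" "c \<le> 2 * n" "c' \<le> 2 * n"
  shows "t = t' \<and> c = c'"
proof -
  have div: "(x * N + y) div N = x" if "y < N" for x y N :: nat using that by simp
  have "t = t'"
    using div[of c "2 * n + 1" t] div[of c' "2 * n + 1" t'] assms by simp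
  with assms(1) show ?thesis by simp
qed

text \<open>The prefix determines the letters at its fixed positions. At the free ones, quotient and
  remainder by \<open>2 * n + 1\<close> recover position and letter from a cell.\<close>

lemma inj_free_cells: "inj_on (free_cells n m p) {w \<in> reduced_words n. matches n m p w}"
proof (rule inj_onI)
  fix w w' assume "w \<in> {w \<in> reduced_words n. matches n m p w}"
    "w' \<in> {w \<in> reduced_words n. matches n m p w}"
  then have w: "w \<in> reduced_words n" "length w = m" "\<And>t. t < m \<Longrightarrow> p t = 0 \<or> p t = code n (w ! t)"
    and w': "w' \<in> reduced_words n" "length w' = m" "\<And>t. t < m \<Longrightarrow> p t = 0 \<or> p t = code n (w' ! t)"
    by (auto simp: matches_def)
  assume eq: "free_cells n m p w = free_cells n m p w'"
  have "w ! t = w' ! t" if t: "t < m" for t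
  proof -
    have f: "fst (w ! t) < n" "fst (w' ! t) < n"
      using reduced_words_nth w(1,2) w'(1,2) t by auto
    have "code n (w ! t) = code n (w' ! t)"
    proof (cases "p t = 0")
      case True
      then have "t * (2 * n + 1) + code n (w ! t) \<in> free_cells n m p w'"
        using t eq unfolding free_cells_def by blast
      then obtain t' where t': "t' < m"
        "t * (2 * n + 1) + code n (w ! t) = t' * (2 * n + 1) + code n (w' ! t')"
        unfolding free_cells_def by blast
      moreover have "fst (w' ! t') < n" using reduced_words_nth w' t' by auto
      ultimately show ?thesis using cell_inject[OF t'(2)] code_bounds f by blast
    next
      case False
      then show ?thesis using w(3)[OF t] w'(3)[OF t] by metis
    qed
    then show ?thesis using code_inject[OF f] by blast
  qed
  then show "w = w'" using w(2) w'(2) by (auto intro: nth_equalityI)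
qed

definition cell_power :: "nat \<Rightarrow> nat \<Rightarrow> 'a::field" where
  "cell_power k i = (2 ^ k) ^ (2 ^ i)"

text \<open>A letter that contradicts the prefix contributes weight \<open>0\<close>. Otherwise the
  product is \<open>2 ^ k\<close> raised to the sum of \<open>2 ^ i\<close> over the free cells, and
  exchanging exponents turns the sample number \<open>k\<close> into the exponent of a node that
  does not depend on \<open>k\<close>.\<close>

lemma prod_weight:
  assumes w: "w \<in> reduced_words n" "length w = m"
  shows "(\<Prod>t<m. weight n p (cell_power k) t (code n (w ! t))) =
    (if matches n m p w then (2 ^ set_encode (free_cells n m p w)) ^ k else (0::'a::field_char_0))"
proof (cases "matches n m p w")
  case True
  let ?F = "{t. t < m \<and> p t = 0}" and ?i = "\<lambda>t. t * (2 * n + 1) + code n (w ! t)"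
  have inj: "inj_on ?i ?F"
    using cell_inject[of _ n] code_bounds reduced_words_nth[OF w(1)] w(2)
    by (intro inj_onI) blast
  have "(\<Prod>t<m. weight n p (cell_power k) t (code n (w ! t))) =
      (\<Prod>t<m. if p t = 0 then cell_power k (?i t) else (1::'a))"
    using True by (intro prod.cong) (auto simp: weight_def matches_def)
  also have "\<dots> = (\<Prod>t\<in>?F. cell_power k (?i t))"
    by (rule prod.mono_neutral_cong_right) auto
  also have "\<dots> = (\<Prod>i\<in>free_cells n m p w. cell_power k i)"
    unfolding free_cells_def by (simp only: prod.reindex[OF inj] o_def)
  also have "\<dots> = (2 ^ k) ^ (\<Sum>i\<in>free_cells n m p w. 2 ^ i)"
    by (simp add: cell_power_def power_sum)
  also have "\<dots> = (2 ^ set_encode (free_cells n m p w)) ^ k"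
    by (simp add: set_encode_def power_mult[symmetric] mult.commute)
  finally show ?thesis using True by simp
next
  case False
  then obtain t where t: "t < m" "p t \<noteq> 0" "p t \<noteq> code n (w ! t)"
    using w by (auto simp: matches_def)
  then have "weight n p (cell_power k) t (code n (w ! t)) = (0::'a)" by (simp add: weight_def)
  with t have "(\<Prod>t<m. weight n p (cell_power k) t (code n (w ! t))) = (0::'a)"
    by (intro prod_zero) auto
  with False show ?thesis by simp
qed

text \<open>What remains of the test entry in sample \<open>k\<close> after the known words have
  been subtracted; \<open>R\<close> stands for the words not found yet.\<close>

definition test_value :: "nat \<Rightarrow> nat \<Rightarrow> nat \<Rightarrow> (nat \<Rightarrow> nat) \<Rightarrow> (gword \<Rightarrow> 'a::field) \<Rightarrow> gword set \<Rightarrow> nat \<Rightarrow> 'a" where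
  "test_value n d m p \<alpha> R k =
    (\<Sum>w\<in>R. \<alpha> w * word_act n d (weight n p (cell_power k)) w (unit_fun 0) (4 * m))"

context
  fixes n d m :: nat and p :: "nat \<Rightarrow> nat" and \<alpha> :: "gword \<Rightarrow> 'a::field_char_0" and R :: "gword set"
  assumes R: "finite R" "R \<subseteq> reduced_words n" and len: "\<And>w. w \<in> R \<Longrightarrow> length w \<le> m" and m: "m \<le> d"
begin

text \<open>As a function of \<open>k\<close>, a word of length \<open>m\<close> contributes a
  constant times a power of its node, or nothing if it violates the prefix. A shorter word ends at
  least two layers lower and does not reach coordinate \<open>4 * m\<close>.\<close>

lemma test_value_prony:
  "\<exists>\<kappa>. (\<forall>w\<in>R. \<kappa> w \<noteq> 0) \<and> (\<forall>k. \<forall>w\<in>R.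
    word_act n d (weight n p (cell_power k)) w (unit_fun 0) (4 * m) =
      (if matches n m p w then \<kappa> w * (2 ^ set_encode (free_cells n m p w)) ^ k else (0::'a)))"
proof -
  have "\<forall>w\<in>R. \<exists>\<kappa>. \<kappa> \<noteq> 0 \<and> (\<forall>k. word_act n d (weight n p (cell_power k)) w (unit_fun 0) (4 * m) =
      (if matches n m p w then \<kappa> * (2 ^ set_encode (free_cells n m p w)) ^ k else (0::'a)))"
  proof
    fix w assume "w \<in> R"
    then have w: "w \<in> reduced_words n" and lm: "length w \<le> m" using R len by auto
    from word_act_top_coeff[OF w, where 'a = 'a] obtain \<kappa> :: 'a where \<kappa>: "\<kappa> \<noteq> 0"
      and top: "\<And>d (E :: nat \<Rightarrow> nat \<Rightarrow> 'a). length w \<le> d \<Longrightarrow>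
    word_act n d E w (unit_fun 0) (4 * length w) = \<kappa> * (\<Prod>t<length w. E t (code n (w ! t))) \<and>
    (\<forall>x \<ge> 4 * length w + 2. word_act n d E w (unit_fun 0) x = 0)"
      by blast
    have "word_act n d (weight n p (cell_power k)) w (unit_fun 0) (4 * m) =
      (if matches n m p w then \<kappa> * (2 ^ set_encode (free_cells n m p w)) ^ k else (0::'a))" for k
    proof (cases "length w = m")
      case True
      then show ?thesis
        using top[of d "weight n p (cell_power k)"] m prod_weight[OF w True, where 'a = 'a, of p k]
        by simp
    next
      case False
      then have "4 * length w + 2 \<le> 4 * m" using lm by linarith
      then show ?thesis
        using top[of d "weight n p (cell_power k)"] m lm False by (auto simp: matches_def)
    qed
    with \<kappa> show "\<exists>\<kappa>. \<kappa> \<noteq> 0 \<and> (\<forall>k. word_act n d (weight n p (cell_power k)) w (unit_fun 0) (4 * m) =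
      (if matches n m p w then \<kappa> * (2 ^ set_encode (free_cells n m p w)) ^ k else (0::'a)))" by blast
  qed
  from bchoice[OF this] show ?thesis by blast
qed

lemma test_value_none:
  assumes "\<And>w. w \<in> R \<Longrightarrow> \<not> matches n m p w"
  shows "test_value n d m p \<alpha> R k = 0"
  using test_value_prony assms unfolding test_value_def by (intro sum.neutral) auto

text \<open>The nodes of the matching words are distinct powers of \<open>2\<close>, so their power
  sums cannot all vanish. Each coefficient merges with its constant \<open>\<kappa> w\<close> into
  one nonzero factor.\<close>

lemma test_value_some:
  assumes "\<And>w. w \<in> R \<Longrightarrow> \<alpha> w \<noteq> 0" and w: "w \<in> R" "matches n m p w"
  shows "\<exists>k < card R. test_value n d m p \<alpha> R k \<noteq> 0"
proof -
  obtain \<kappa> where \<kappa>: "\<And>w. w \<in> R \<Longrightarrow> \<kappa> w \<noteq> 0"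
    and eq: "\<And>k w. w \<in> R \<Longrightarrow> word_act n d (weight n p (cell_power k)) w (unit_fun 0) (4 * m) =
      (if matches n m p w then \<kappa> w * (2 ^ set_encode (free_cells n m p w)) ^ k else (0::'a))"
    using test_value_prony by blast
  let ?S = "{w \<in> R. matches n m p w}" and ?l = "\<lambda>w. 2 ^ set_encode (free_cells n m p w) :: 'a"
  have v: "test_value n d m p \<alpha> R k = (\<Sum>w\<in>?S. \<alpha> w * \<kappa> w * ?l w ^ k)" for k
    unfolding test_value_def
    by (rule sum.mono_neutral_cong_right) (use R eq in auto)
  have "inj_on ?l ?S"
  proof (rule inj_onI)
    fix w w' assume ww: "w \<in> ?S" "w' \<in> ?S" and "?l w = ?l w'"
    \<comment> \<open>Characteristic zero brings the equality of nodes back to natural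
      numbers.\<close>
    then have "(of_nat (2 ^ set_encode (free_cells n m p w)) :: 'a) =
        of_nat (2 ^ set_encode (free_cells n m p w'))" by simp
    then have "set_encode (free_cells n m p w) = set_encode (free_cells n m p w')"
      unfolding of_nat_eq_iff by simp
    then have "free_cells n m p w = free_cells n m p w'"
      by (subst (asm) set_encode_eq) (simp_all add: free_cells_def)
    with inj_free_cells[of n m p] ww R(2) show "w = w'"
      unfolding inj_on_def by blast
  qed
  from prony_nonzero[OF _ this, of w "\<lambda>w. \<alpha> w * \<kappa> w"] obtain k where
    "k < card ?S" "test_value n d m p \<alpha> R k \<noteq> 0"
    using assms \<kappa> R(1) unfolding v by auto
  moreover have "card ?S \<le> card R" using R(1) by (intro card_mono) auto
  ultimately show ?thesis using less_le_trans by blast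
qed

text \<open>Without free positions at most one word matches, so every sample yields its coefficient
  by one division.\<close>

lemma test_value_full:
  fixes k :: nat
  assumes p: "\<And>t. t < m \<Longrightarrow> p t \<noteq> 0" and w: "w \<in> R" "matches n m p w"
  defines "x \<equiv> word_act n d (weight n p (cell_power k)) w (unit_fun 0) (4 * m)"
  shows "test_value n d m p \<alpha> R k = \<alpha> w * x" "x \<noteq> 0"
proof -
  obtain \<kappa> where \<kappa>: "\<And>w. w \<in> R \<Longrightarrow> \<kappa> w \<noteq> 0"
    and eq: "\<And>k w. w \<in> R \<Longrightarrow> word_act n d (weight n p (cell_power k)) w (unit_fun 0) (4 * m) =
      (if matches n m p w then \<kappa> w * (2 ^ set_encode (free_cells n m p w)) ^ k else (0::'a))"
    using test_value_prony by blast
  show "x \<noteq> 0" using eq \<kappa> w by (simp add: x_def)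
  have "free_cells n m p w' = {}" for w'
    using p by (auto simp: free_cells_def)
  with inj_free_cells[of n m p] w R(2) have "\<not> matches n m p w'" if "w' \<in> R" "w' \<noteq> w" for w'
    using that unfolding inj_on_def by blast
  with eq have "word_act n d (weight n p (cell_power k)) w' (unit_fun 0) (4 * m) = (0::'a)"
    if "w' \<in> R" "w' \<noteq> w" for w'
    using that by simp
  then show "test_value n d m p \<alpha> R k = \<alpha> w * x"
    unfolding test_value_def x_def using w R(1) by (subst sum.remove[of R w]) auto
qed

end

section \<open>Reasoning about programs\<close>

fun nwr :: "com \<Rightarrow> nat set" where
  "nwr (NSet a i e) = {a}"
| "nwr (Seq c1 c2) = nwr c1 \<union> nwr c2"
| "nwr (com.If b c1 c2) = nwr c1 \<union> nwr c2"
| "nwr (While b c) = nwr c"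
| "nwr _ = {}"

fun fwr :: "com \<Rightarrow> nat set" where
  "fwr (FSet a i e) = {a}"
| "fwr (Seq c1 c2) = fwr c1 \<union> fwr c2"
| "fwr (com.If b c1 c2) = fwr c1 \<union> fwr c2"
| "fwr (While b c) = fwr c"
| "fwr (Query a e b) = {b}"
| "fwr _ = {}"

fun quiet :: "com \<Rightarrow> bool" where
  "quiet (Seq c1 c2) = (quiet c1 \<and> quiet c2)"
| "quiet (com.If b c1 c2) = (quiet c1 \<and> quiet c2)"
| "quiet (While b c) = quiet c"
| "quiet (EmitLetter i e) = False"
| "quiet (EmitTerm e) = False"
| "quiet _ = True"

text \<open>The arrays that a command can change are read off its syntax, which spares
  postconditions the list of everything that stays the same.\<close>

definition frame :: "com \<Rightarrow> 'a machine \<Rightarrow> 'a machine \<Rightarrow> bool" where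
  "frame c \<sigma> \<sigma>' \<longleftrightarrow> (\<forall>a. a \<notin> nwr c \<longrightarrow> nmem \<sigma>' a = nmem \<sigma> a) \<and>
     (\<forall>a. a \<notin> fwr c \<longrightarrow> fmem \<sigma>' a = fmem \<sigma> a) \<and>
     (quiet c \<longrightarrow> cur_word \<sigma>' = cur_word \<sigma> \<and> out_terms \<sigma>' = out_terms \<sigma>)"

lemma set_mem_simps [simp]:
  "nmem (set_nmem a i v \<sigma>) = (nmem \<sigma>)(a := (nmem \<sigma> a)(i := v))" "fmem (set_nmem a i v \<sigma>) = fmem \<sigma>"
  "cur_word (set_nmem a i v \<sigma>) = cur_word \<sigma>" "out_terms (set_nmem a i v \<sigma>) = out_terms \<sigma>"
  "nmem (set_fmem a i x \<sigma>) = nmem \<sigma>" "fmem (set_fmem a i x \<sigma>) = (fmem \<sigma>)(a := (fmem \<sigma> a)(i := x))"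
  "cur_word (set_fmem a i x \<sigma>) = cur_word \<sigma>" "out_terms (set_fmem a i x \<sigma>) = out_terms \<sigma>"
  by (simp_all add: set_nmem_def set_fmem_def)

lemma exec_frame: "exec n ask c \<sigma> t \<sigma>' \<Longrightarrow> frame c \<sigma> \<sigma>'"
  by (induction rule: exec.induct)
    (auto simp: frame_def store_mat_def)

text \<open>Total correctness with an upper bound on the time, as a predicate on the start state, so
  that it can itself serve as a postcondition of the preceding command.\<close>

definition run :: "nat \<Rightarrow> (nat \<Rightarrow> (nat \<Rightarrow> 'a mat) \<Rightarrow> 'a mat) \<Rightarrow> com \<Rightarrow> nat \<Rightarrow>
    ('a::field machine \<Rightarrow> bool) \<Rightarrow> 'a machine \<Rightarrow> bool" where
  "run n ask c T Q \<sigma> \<longleftrightarrow> (\<exists>t \<sigma>'. exec n ask c \<sigma> t \<sigma>' \<and> t \<le> T \<and> Q \<sigma>')"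

lemma run_conseq:
  assumes "run n ask c T Q \<sigma>" "T \<le> T'" "\<And>\<sigma>'. frame c \<sigma> \<sigma>' \<Longrightarrow> Q \<sigma>' \<Longrightarrow> Q' \<sigma>'"
  shows "run n ask c T' Q' \<sigma>"
  using assms exec_frame unfolding run_def by (meson le_trans)

lemma run_Seq:
  assumes "run n ask c1 T1 (run n ask c2 T2 Q) \<sigma>"
  shows "run n ask (Seq c1 c2) (T1 + T2) Q \<sigma>"
  using assms unfolding run_def by (meson exec.Seq add_mono)

lemma run_SeqI:
  assumes "run n ask c1 T1 P \<sigma>" "\<And>\<sigma>'. frame c1 \<sigma> \<sigma>' \<Longrightarrow> P \<sigma>' \<Longrightarrow> run n ask c2 T2 Q \<sigma>'" "T1 + T2 \<le> T"
  shows "run n ask (Seq c1 c2) T Q \<sigma>"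
proof (rule run_conseq[OF run_Seq])
  show "run n ask c1 T1 (run n ask c2 T2 Q) \<sigma>"
    by (rule run_conseq[OF assms(1)]) (simp_all add: assms(2))
qed (use assms(3) in simp_all)

text \<open>The bounds of both branches are added rather than maximised, so that all time bounds
  stay sums and products.\<close>

lemma run_If:
  assumes "bval b \<sigma> \<Longrightarrow> run n ask c1 T1 Q \<sigma>" "\<not> bval b \<sigma> \<Longrightarrow> run n ask c2 T2 Q \<sigma>"
  shows "run n ask (com.If b c1 c2) (1 + T1 + T2) Q \<sigma>"
proof (cases "bval b \<sigma>")
  case True
  from assms(1)[OF this] obtain t \<sigma>' where "exec n ask c1 \<sigma> t \<sigma>'" "t \<le> T1" "Q \<sigma>'"
    unfolding run_def by blast
  with exec.IfTrue[of b \<sigma> n ask c1 t \<sigma>' c2] True show ?thesis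
    unfolding run_def by (intro exI[of _ "1 + t"] exI[of _ \<sigma>']) simp
next
  case False
  from assms(2)[OF this] obtain t \<sigma>' where "exec n ask c2 \<sigma> t \<sigma>'" "t \<le> T2" "Q \<sigma>'"
    unfolding run_def by blast
  with exec.IfFalse[of b \<sigma> n ask c2 t \<sigma>' c1] False show ?thesis
    unfolding run_def by (intro exI[of _ "1 + t"] exI[of _ \<sigma>']) simp
qed

text \<open>The frame refers to the state before the loop, so an invariant only has to mention what
  the body changes. One unit of the measure pays \<open>B + 1\<close> for one pass and its
  test.\<close>

lemma run_While:
  assumes I: "I \<sigma>"
    and body: "\<And>\<sigma>'. I \<sigma>' \<Longrightarrow> frame c \<sigma> \<sigma>' \<Longrightarrow> bval b \<sigma>' \<Longrightarrow>
      run n ask c B (\<lambda>\<sigma>''. I \<sigma>'' \<and> \<mu> \<sigma>'' < \<mu> \<sigma>') \<sigma>'"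
    and exit: "\<And>\<sigma>'. I \<sigma>' \<Longrightarrow> frame c \<sigma> \<sigma>' \<Longrightarrow> \<not> bval b \<sigma>' \<Longrightarrow> Q \<sigma>'"
    and T: "1 + \<mu> \<sigma> * (B + 1) \<le> T"
  shows "run n ask (While b c) T Q \<sigma>"
proof -
  have "run n ask (While b c) (1 + \<mu> \<sigma>' * (B + 1)) Q \<sigma>'" if "I \<sigma>'" "frame c \<sigma> \<sigma>'" for \<sigma>'
    using that
  proof (induction "\<mu> \<sigma>'" arbitrary: \<sigma>' rule: less_induct)
    case less
    show ?case
    proof (cases "bval b \<sigma>'")
      case False
      with less.prems exit show ?thesis
        using exec.WhileFalse[OF False, of n ask c] unfolding run_def
        by (intro exI[of _ 1] exI[of _ \<sigma>']) simp
    next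
      case True
      from body[OF less.prems True] obtain t1 \<sigma>1 where e1: "exec n ask c \<sigma>' t1 \<sigma>1" "t1 \<le> B"
        and I1: "I \<sigma>1" and \<mu>: "\<mu> \<sigma>1 < \<mu> \<sigma>'"
        unfolding run_def by blast
      have "frame c \<sigma> \<sigma>1"
        using less.prems(2) exec_frame[OF e1(1)] by (simp add: frame_def)
      from less.hyps[OF \<mu> I1 this] obtain t2 \<sigma>2 where e2: "exec n ask (While b c) \<sigma>1 t2 \<sigma>2"
        "t2 \<le> 1 + \<mu> \<sigma>1 * (B + 1)" "Q \<sigma>2"
        unfolding run_def by blast
      have "(\<mu> \<sigma>1 + 1) * (B + 1) \<le> \<mu> \<sigma>' * (B + 1)"
        using \<mu> by (intro mult_right_mono) auto
      then have "1 + t1 + t2 \<le> 1 + \<mu> \<sigma>' * (B + 1)"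
        using e1(2) e2(2) by (simp add: algebra_simps)
      with exec.WhileTrue[OF True e1(1) e2(1)] e2(3) show ?thesis
        unfolding run_def by blast
    qed
  qed
  moreover have "frame c \<sigma> \<sigma>" by (simp add: frame_def)
  ultimately have "run n ask (While b c) (1 + \<mu> \<sigma> * (B + 1)) Q \<sigma>" using I by blast
  then show ?thesis by (rule run_conseq[OF _ T])
qed

lemma run_Query:
  assumes "D = nval e \<sigma>" "0 < D" "\<And>i. i < n \<Longrightarrow> invertible_mat (query_mat a D \<sigma> i)"
    and "Q (store_mat b D (ask D (query_mat a D \<sigma>)) \<sigma>)"
  shows "run n ask (Query a e b) (1 + (n + 1) * D * D) Q \<sigma>"
  using exec.Query[of D e \<sigma> n a ask b] assms unfolding run_def by blast

fun straight :: "com \<Rightarrow> bool" where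
  "straight (Seq c1 c2) = (straight c1 \<and> straight c2)"
| "straight (com.If b c1 c2) = (straight c1 \<and> straight c2)"
| "straight (While b c) = False"
| "straight (Query a e b) = False"
| "straight _ = True"

text \<open>Commands without loops and queries are executed symbolically: the resulting state
  expression is evaluated by the simplifier.\<close>

fun eff :: "com \<Rightarrow> 'a::field machine \<Rightarrow> 'a machine" where
  "eff (NSet a i e) \<sigma> = set_nmem a (nval i \<sigma>) (nval e \<sigma>) \<sigma>"
| "eff (FSet a i e) \<sigma> = set_fmem a (nval i \<sigma>) (fval e \<sigma>) \<sigma>"
| "eff (Seq c1 c2) \<sigma> = eff c2 (eff c1 \<sigma>)"
| "eff (com.If b c1 c2) \<sigma> = (if bval b \<sigma> then eff c1 \<sigma> else eff c2 \<sigma>)"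
| "eff (EmitLetter i e) \<sigma> = \<sigma>\<lparr>cur_word := cur_word \<sigma> @ [(nval i \<sigma>, nval e \<sigma> \<noteq> 0)]\<rparr>"
| "eff (EmitTerm e) \<sigma> = \<sigma>\<lparr>cur_word := [], out_terms := out_terms \<sigma> @ [(cur_word \<sigma>, fval e \<sigma>)]\<rparr>"
| "eff _ \<sigma> = \<sigma>"

fun cost :: "com \<Rightarrow> nat" where
  "cost (Seq c1 c2) = cost c1 + cost c2"
| "cost (com.If b c1 c2) = 1 + cost c1 + cost c2"
| "cost _ = 1"

lemma run_straight_eff: "straight c \<Longrightarrow> run n ask c (cost c) (\<lambda>\<sigma>'. \<sigma>' = eff c \<sigma>) \<sigma>"
proof (induction c arbitrary: \<sigma>)
  case (Seq c1 c2)
  have "run n ask (Seq c1 c2) (cost c1 + cost c2) (\<lambda>\<sigma>'. \<sigma>' = eff c2 (eff c1 \<sigma>)) \<sigma>"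
    by (rule run_SeqI[OF Seq.IH(1)]) (use Seq in auto)
  then show ?case by simp
next
  case (If b c1 c2)
  have "run n ask (com.If b c1 c2) (1 + cost c1 + cost c2) (\<lambda>\<sigma>'. \<sigma>' = eff (com.If b c1 c2) \<sigma>) \<sigma>"
    by (rule run_If) (use If in auto)
  then show ?case by simp
next
  case (EmitLetter i e)
  show ?case using exec.EmitLetter[of n ask i e \<sigma>] unfolding run_def by auto
qed (auto simp: run_def intro: exec.intros)

lemma run_straight:
  assumes "straight c" "cost c \<le> T" "Q (eff c \<sigma>)"
  shows "run n ask c T Q \<sigma>"
  by (rule run_conseq[OF run_straight_eff]) (use assms in auto)

lemma run_straight_to:
  assumes "eff c \<sigma> = \<sigma>'" "Q \<sigma>'" "straight c" "cost c \<le> T"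
  shows "run n ask c T Q \<sigma>"
  by (rule run_straight) (use assms in auto)

lemma run_straight_Seq:
  assumes "straight c" "run n ask c' T' Q (eff c \<sigma>)" "cost c + T' \<le> T"
  shows "run n ask (Seq c c') T Q \<sigma>"
  by (rule run_SeqI[OF run_straight_eff[OF assms(1)], where ?T2.0 = T']) (use assms in auto)

lemma run_after:
  assumes "run n ask c' T' Q \<sigma>'" "straight c" "eff c \<sigma> = \<sigma>'" "cost c + T' \<le> T"
  shows "run n ask (Seq c c') T Q \<sigma>"
  using run_straight_Seq[of c n ask c' T' Q \<sigma>] assms by simp

section \<open>Polynomial bounds in three arguments, closed under sums and products\<close>

definition poly_bounded :: "(nat \<Rightarrow> nat \<Rightarrow> nat \<Rightarrow> nat) \<Rightarrow> bool" where
  "poly_bounded T \<longleftrightarrow> (\<exists>C k. \<forall>n d s. T n d s \<le> C * (n + d + s + 1) ^ k)"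

lemma poly_bounded_const: "poly_bounded (\<lambda>n d s. c)"
  unfolding poly_bounded_def by (intro exI[of _ c] exI[of _ 0]) simp

lemma poly_bounded_arg:
  "poly_bounded (\<lambda>n d s. n)" "poly_bounded (\<lambda>n d s. d)" "poly_bounded (\<lambda>n d s. s)"
proof -
  have "poly_bounded T" if "\<And>n d s. T n d s \<le> n + d + s + 1" for T
    using that unfolding poly_bounded_def by (intro exI[of _ 1]) simp
  then show "poly_bounded (\<lambda>n d s. n)" "poly_bounded (\<lambda>n d s. d)" "poly_bounded (\<lambda>n d s. s)"
    by simp_all
qed

lemma poly_bounded_add:
  assumes "poly_bounded S" "poly_bounded T"
  shows "poly_bounded (\<lambda>n d s. S n d s + T n d s)"
proof -
  from assms obtain C k C' k' where
    b: "\<And>n d s. S n d s \<le> C * (n + d + s + 1) ^ k" "\<And>n d s. T n d s \<le> C' * (n + d + s + 1) ^ k'"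
    unfolding poly_bounded_def by blast
  have "S n d s + T n d s \<le> (C + C') * (n + d + s + 1) ^ (k + k')" for n d s
  proof -
    let ?X = "n + d + s + 1"
    \<comment> \<open>The base is at least \<open>1\<close>, so both exponents may be raised to a
      common one.\<close>
    have "C * ?X ^ k \<le> C * ?X ^ (k + k')" "C' * ?X ^ k' \<le> C' * ?X ^ (k + k')"
      by (auto intro!: mult_left_mono power_increasing)
    with b[of n d s] show ?thesis by (simp only: add_mult_distrib)
  qed
  then show ?thesis unfolding poly_bounded_def by blast
qed

lemma poly_bounded_mult:
  assumes "poly_bounded S" "poly_bounded T"
  shows "poly_bounded (\<lambda>n d s. S n d s * T n d s)"
proof -
  from assms obtain C k C' k' where
    b: "\<And>n d s. S n d s \<le> C * (n + d + s + 1) ^ k" "\<And>n d s. T n d s \<le> C' * (n + d + s + 1) ^ k'"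
    unfolding poly_bounded_def by blast
  have "S n d s * T n d s \<le> (C * C') * (n + d + s + 1) ^ (k + k')" for n d s
    using mult_mono[OF b[of n d s]] by (simp add: power_add mult_ac)
  then show ?thesis unfolding poly_bounded_def by blast
qed

lemmas poly_bounded_intros =
  poly_bounded_const poly_bounded_arg poly_bounded_add poly_bounded_mult

section \<open>The program\<close>

abbreviation (input) seq_com (infixr ";;" 55) where "c1 ;; c2 \<equiv> Seq c1 c2"

text \<open>Names of the arrays of the program. Scalars live in cell \<open>0\<close>. The words found so far are
  stored in \<open>nWORDS\<close> with stride \<open>d\<close>, padded with \<open>0\<close>, and the current prefix occupies the next
  slot; \<open>nTOP\<close> is one more than the current word length, so that \<open>0\<close> can signal the end.\<close>

abbreviation (input) "nGEN \<equiv> (2::nat)"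
abbreviation (input) "nDEG \<equiv> (3::nat)"
abbreviation (input) "nSPARSE \<equiv> (4::nat)"
abbreviation (input) "nSTRIDE \<equiv> (5::nat)"
abbreviation (input) "nDIM \<equiv> (6::nat)"
abbreviation (input) "nWORDS \<equiv> (7::nat)"
abbreviation (input) "nROWS \<equiv> (8::nat)"
abbreviation (input) "nSLOT \<equiv> (9::nat)"
abbreviation (input) "nFOUND \<equiv> (10::nat)"
abbreviation (input) "nTOP \<equiv> (11::nat)"
abbreviation (input) "nPOS \<equiv> (12::nat)"
abbreviation (input) "nK \<equiv> (13::nat)"
abbreviation (input) "nT \<equiv> (14::nat)"
abbreviation (input) "nCODE \<equiv> (15::nat)"
abbreviation (input) "nBASE \<equiv> (16::nat)"
abbreviation (input) "nROW \<equiv> (17::nat)"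
abbreviation (input) "nX \<equiv> (18::nat)"
abbreviation (input) "nG \<equiv> (19::nat)"
abbreviation (input) "nOFF \<equiv> (20::nat)"
abbreviation (input) "nQ \<equiv> (21::nat)"
abbreviation (input) "nL \<equiv> (22::nat)"
abbreviation (input) "nI \<equiv> (23::nat)"

abbreviation (input) "fMATS \<equiv> (2::nat)"
abbreviation (input) "fNUMS \<equiv> (3::nat)"
abbreviation (input) "fCELLS \<equiv> (4::nat)"
abbreviation (input) "fVEC \<equiv> (5::nat)"
abbreviation (input) "fANS \<equiv> (6::nat)"
abbreviation (input) "fCOEF \<equiv> (7::nat)"
abbreviation (input) "fVAL \<equiv> (8::nat)"
abbreviation (input) "fZ \<equiv> (9::nat)"
abbreviation (input) "fSIGN \<equiv> (10::nat)"
abbreviation (input) "fWEIGHT \<equiv> (11::nat)"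
abbreviation (input) "fU \<equiv> (12::nat)"

abbreviation (input) "nv a \<equiv> NGet a (NConst 0)"
abbreviation (input) "fv a \<equiv> FGet a (NConst 0)"
abbreviation (input) "nset a e \<equiv> NSet a (NConst 0) e"
abbreviation (input) "fset a e \<equiv> FSet a (NConst 0) e"
abbreviation (input) "ninc a k \<equiv> nset a (NPlus (nv a) (NConst k))"
abbreviation (input) "NEq e1 e2 \<equiv> BAnd (BNot (NLess e1 e2)) (BNot (NLess e2 e1))"
abbreviation (input) "npos e \<equiv> NLess (NConst 0) e"
abbreviation (input) "quadruple e \<equiv> NPlus (NPlus e e) (NPlus e e)"
abbreviation (input) "eTOP \<equiv> NMinus (nv nTOP) (NConst 1)"

abbreviation (input) "prefix_letter \<equiv> NGet nWORDS (NPlus (nv nSLOT) (nv nT))"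

text \<open>The machine does not multiply naturals, so the offset \<open>t * (2 * n + 1)\<close> of
  a block of cells is looked up in the table \<open>nROWS\<close>.\<close>

definition weight_com :: com where
  "weight_com =
    com.If (npos prefix_letter)
      (com.If (NEq prefix_letter (nv nCODE)) (fset fWEIGHT FOne) (fset fWEIGHT FZero))
      (fset fWEIGHT (FGet fCELLS (NPlus (NGet nROWS (nv nT)) (nv nCODE))))"

abbreviation (input) "cell k \<equiv> NPlus (nv nBASE) (NPlus (nv nX) (NConst k))"

text \<open>A shear in place. Each layer needs the old value of the layer below, so the work
  proceeds downwards, and within block \<open>t\<close> the upper of the two steps comes before the
  lower. \<open>fU\<close> holds the signed pairing with \<open>(1, c)\<close>, in the lower step
  multiplied by the weight.\<close>

definition layer_com :: "nat \<Rightarrow> com" where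
  "layer_com a =
    nset nT (NMinus (nv nT) (NConst 1)) ;;
    weight_com ;;
    nset nX (quadruple (nv nT)) ;;
    fset fU (FTimes (fv fSIGN) (FPlus (FGet a (cell 2)) (FTimes (FGet fNUMS (nv nCODE)) (FGet a (cell 3))))) ;;
    FSet a (cell 4) (FPlus (FGet a (cell 4)) (FTimes (fv fU) (FGet fNUMS (nv nCODE)))) ;;
    FSet a (cell 5) (FMinus (FGet a (cell 5)) (fv fU)) ;;
    fset fU (FTimes (FTimes (fv fSIGN) (fv fWEIGHT))
      (FPlus (FGet a (cell 0)) (FTimes (FGet fNUMS (nv nCODE)) (FGet a (cell 1))))) ;;
    FSet a (cell 2) (FPlus (FGet a (cell 2)) (FTimes (fv fU) (FGet fNUMS (nv nCODE)))) ;;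
    FSet a (cell 3) (FMinus (FGet a (cell 3)) (fv fU))"

definition shear_com :: "nat \<Rightarrow> com" where
  "shear_com a = nset nT (nv nDEG) ;; While (npos (nv nT)) (layer_com a)"

definition act_com :: "nat \<Rightarrow> com" where
  "act_com a =
    fset fSIGN FOne ;;
    shear_com a ;;
    com.If (NLess (nv nCODE) (NPlus (nv nGEN) (NConst 1)))
      (nset nCODE (NPlus (nv nCODE) (nv nGEN))) (nset nCODE (NMinus (nv nCODE) (nv nGEN))) ;;
    fset fSIGN (FMinus FZero FOne) ;;
    shear_com a"

definition unit_com :: "nat \<Rightarrow> com" where
  "unit_com a =
    nset nX (NConst 0) ;;
    While (NLess (nv nX) (nv nDIM)) (FSet a (NPlus (nv nBASE) (nv nX)) FZero ;; ninc nX 1) ;;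
    FSet a (NPlus (nv nBASE) (nv nROW)) FOne"

text \<open>Every slot has \<open>d\<close> cells; code \<open>0\<close> is padding and leaves the
  vector alone.\<close>

definition word_com :: com where
  "word_com =
    (nset nBASE (NConst 0) ;; nset nROW (NConst 0)) ;;
    unit_com fVEC ;;
    nset nL (NConst 0) ;;
    While (NLess (nv nL) (nv nDEG))
      (nset nCODE (NGet nWORDS (NPlus (nv nOFF) (nv nL))) ;;
       com.If (npos (nv nCODE)) (act_com fVEC) Skip ;;
       ninc nL 1)"

text \<open>Each cell is the square of the one before, which gives the weights
  \<open>z ^ 2 ^ i\<close>.\<close>

definition fill_com :: com where
  "fill_com =
    (FSet fCELLS (NConst 0) (fv fZ) ;; nset nI (NConst 0)) ;;
    While (NLess (nv nI) (NGet nROWS (nv nDEG)))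
      (FSet fCELLS (NPlus (nv nI) (NConst 1)) (FTimes (FGet fCELLS (nv nI)) (FGet fCELLS (nv nI))) ;;
       ninc nI 1)"

definition row_com :: com where
  "row_com =
    unit_com fMATS ;;
    nset nCODE (NPlus (nv nG) (NConst 1)) ;;
    act_com fMATS ;;
    (nset nBASE (NPlus (nv nBASE) (nv nDIM)) ;; ninc nROW 1)"

text \<open>The rows of all matrices lie one after the other, and a row is the image of a unit
  vector. The base address therefore only grows by the dimension, and no index has to be
  multiplied.\<close>

definition build_com :: com where
  "build_com =
    (nset nG (NConst 0) ;; nset nBASE (NConst 0)) ;;
    While (NLess (nv nG) (nv nGEN))
      (nset nROW (NConst 0) ;;
       While (NLess (nv nROW) (nv nDIM)) row_com ;;
       ninc nG 1)"

definition subtract_com :: com where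
  "subtract_com =
    (nset nQ (NConst 0) ;; nset nOFF (NConst 0)) ;;
    While (NLess (nv nQ) (nv nFOUND))
      (word_com ;;
       (fset fVAL (FMinus (fv fVAL) (FTimes (FGet fCOEF (nv nQ)) (FGet fVEC (quadruple eTOP)))) ;;
        ninc nQ 1 ;; nset nOFF (NPlus (nv nOFF) (nv nDEG))))"

definition sample_com :: com where
  "sample_com =
    fill_com ;;
    build_com ;;
    Query fMATS (nv nDIM) fANS ;;
    fset fVAL (FGet fANS (quadruple eTOP)) ;;
    subtract_com ;;
    (ninc nK 1 ;; fset fZ (FPlus (fv fZ) (fv fZ)))"

text \<open>The loop stops at the first nonzero sample. Its value and its weights stay in memory,
  where the recording of a complete word needs them.\<close>

definition test_com :: com where
  "test_com =
    (fset fVAL FZero ;; nset nK (NConst 0) ;; fset fZ FOne) ;;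
    While (BAnd (NLess (nv nK) (nv nSPARSE)) (FEq (fv fVAL) FZero)) sample_com"

definition record_com :: com where
  "record_com =
    nset nOFF (nv nSLOT) ;;
    word_com ;;
    (FSet fCOEF (nv nFOUND) (FDivide (fv fVAL) (FGet fVEC (quadruple eTOP))) ;; nset nL (NConst 0)) ;;
    While (NLess (nv nL) eTOP)
      (nset nCODE (NGet nWORDS (NPlus (nv nOFF) (nv nL))) ;;
       com.If (NLess (nv nCODE) (NPlus (nv nGEN) (NConst 1)))
         (EmitLetter (NMinus (nv nCODE) (NConst 1)) (NConst 0))
         (EmitLetter (NMinus (NMinus (nv nCODE) (NConst 1)) (nv nGEN)) (NConst 1)) ;;
       ninc nL 1) ;;
    (EmitTerm (FGet fCOEF (nv nFOUND)) ;;
     ninc nFOUND 1 ;; nset nSLOT (NPlus (nv nSLOT) (nv nDEG)) ;; nset nPOS (NConst 0))"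

abbreviation (input) "last_letter \<equiv> NMinus (NPlus (nv nSLOT) (nv nPOS)) (NConst 1)"

text \<open>A failed test tries the next code as last letter, or passes to the next shorter length
  if the prefix is empty. A successful one appends the least code or records the complete word.
  There is no backtracking: in a nonempty prefix without a match only the last letter is
  wrong.\<close>

definition step_com :: com where
  "step_com =
    test_com ;;
    com.If (FEq (fv fVAL) FZero)
      (com.If (npos (nv nPOS))
        (NSet nWORDS last_letter (NPlus (NGet nWORDS last_letter) (NConst 1)))
        (nset nTOP (NMinus (nv nTOP) (NConst 1))))
      (com.If (NLess (nv nPOS) eTOP)
        (NSet nWORDS (NPlus (nv nSLOT) (nv nPOS)) (NConst 1) ;; ninc nPOS 1)
        record_com)"

text \<open>The loop counters and the entries of both tables at index \<open>0\<close> rely on the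
  memory being zero at the start.\<close>

definition init_com :: com where
  "init_com =
    (nset nGEN (NGet 0 (NConst 0)) ;; nset nDEG (NGet 0 (NConst 1)) ;; nset nSPARSE (NGet 0 (NConst 2)) ;;
     nset nSTRIDE (NPlus (NPlus (nv nGEN) (nv nGEN)) (NConst 1)) ;;
     nset nDIM (NPlus (quadruple (nv nDEG)) (NConst 2)) ;; nset nTOP (NPlus (nv nDEG) (NConst 1))) ;;
    While (NLess (nv nT) (nv nDEG))
      (NSet nROWS (NPlus (nv nT) (NConst 1)) (NPlus (NGet nROWS (nv nT)) (nv nSTRIDE)) ;; ninc nT 1) ;;
    While (NLess (nv nI) (nv nSTRIDE))
      (FSet fNUMS (NPlus (nv nI) (NConst 1)) (FPlus (FGet fNUMS (nv nI)) FOne) ;; ninc nI 1)"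

definition reconstruct_com :: com where
  "reconstruct_com = init_com ;; While (npos (nv nTOP)) step_com"

lemma writes [simp]:
  "nwr weight_com = {}" "fwr weight_com = {fWEIGHT}" "quiet weight_com" "straight weight_com" "cost weight_com = 5"
  "nwr (layer_com a) = {nT, nX}" "fwr (layer_com a) = {fWEIGHT, fU, a}" "quiet (layer_com a)"
  "straight (layer_com a)" "cost (layer_com a) = 13"
  by (auto simp: weight_com_def layer_com_def)

lemma writes_act [simp]:
  "nwr (shear_com a) = {nT, nX}" "fwr (shear_com a) = {fWEIGHT, fU, a}" "quiet (shear_com a)"
  "nwr (act_com a) = {nT, nX, nCODE}" "fwr (act_com a) = {fWEIGHT, fU, fSIGN, a}" "quiet (act_com a)"
  "nwr (unit_com a) = {nX}" "fwr (unit_com a) = {a}" "quiet (unit_com a)"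
  by (auto simp: shear_com_def act_com_def unit_com_def)

lemma writes_word [simp]:
  "nwr word_com = {nT, nX, nCODE, nBASE, nROW, nL}" "fwr word_com = {fWEIGHT, fU, fSIGN, fVEC}" "quiet word_com"
  "nwr fill_com = {nI}" "fwr fill_com = {fCELLS}" "quiet fill_com"
  "nwr row_com = {nT, nX, nCODE, nBASE, nROW}" "fwr row_com = {fWEIGHT, fU, fSIGN, fMATS}" "quiet row_com"
  by (auto simp: word_com_def fill_com_def row_com_def)

lemma writes_test [simp]:
  "nwr build_com = {nT, nX, nCODE, nBASE, nROW, nG}" "fwr build_com = {fWEIGHT, fU, fSIGN, fMATS}" "quiet build_com"
  "nwr subtract_com = {nT, nX, nCODE, nBASE, nROW, nL, nQ, nOFF}"
  "fwr subtract_com = {fWEIGHT, fU, fSIGN, fVEC, fVAL}" "quiet subtract_com"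
  by (auto simp: build_com_def subtract_com_def)

lemma writes_sample [simp]:
  "nwr sample_com = {nT, nX, nCODE, nBASE, nROW, nL, nQ, nOFF, nG, nI, nK}"
  "fwr sample_com = {fWEIGHT, fU, fSIGN, fVEC, fVAL, fMATS, fANS, fCELLS, fZ}" "quiet sample_com"
  by (auto simp: sample_com_def)

lemma writes_step [simp]:
  "nwr test_com = {nT, nX, nCODE, nBASE, nROW, nL, nQ, nOFF, nG, nI, nK}"
  "fwr test_com = {fWEIGHT, fU, fSIGN, fVEC, fVAL, fMATS, fANS, fCELLS, fZ}" "quiet test_com"
  "nwr record_com = {nT, nX, nCODE, nBASE, nROW, nL, nOFF, nFOUND, nSLOT, nPOS}"
  "fwr record_com = {fWEIGHT, fU, fSIGN, fVEC, fCOEF}"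
  by (auto simp: test_com_def record_com_def)

text \<open>A vector \<open>v\<close> of length \<open>D\<close> stored at address \<open>b\<close>
  of an array that is \<open>g\<close> elsewhere. In this form a write to a memory cell becomes an
  update of the vector.\<close>

definition patch :: "nat \<Rightarrow> nat \<Rightarrow> (nat \<Rightarrow> 'a) \<Rightarrow> (nat \<Rightarrow> 'a) \<Rightarrow> nat \<Rightarrow> 'a" where
  "patch b D v g y = (if b \<le> y \<and> y < b + D then v (y - b) else g y)"

lemma patch_apply: "x < D \<Longrightarrow> patch b D v g (b + x) = v x"
  by (simp add: patch_def)

lemma patch_upd: "x < D \<Longrightarrow> (patch b D v g)(b + x := z) = patch b D (v(x := z)) g"
  by (auto simp: patch_def fun_eq_iff)

lemma patch_cong: "(\<And>x. x < D \<Longrightarrow> v x = v' x) \<Longrightarrow> patch b D v g = patch b D v' g"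
  by (auto simp: patch_def fun_eq_iff)

definition env :: "nat \<Rightarrow> nat \<Rightarrow> nat \<Rightarrow> 'a::field machine \<Rightarrow> bool" where
  "env n d s \<sigma> \<longleftrightarrow> nmem \<sigma> nGEN 0 = n \<and> nmem \<sigma> nDEG 0 = d \<and> nmem \<sigma> nSPARSE 0 = s \<and>
     nmem \<sigma> nDIM 0 = 4 * d + 2 \<and> (\<forall>t \<le> d. nmem \<sigma> nROWS t = t * (2 * n + 1)) \<and>
     (\<forall>c \<le> 2 * n. fmem \<sigma> fNUMS c = of_nat c)"

definition prefix :: "'a machine \<Rightarrow> nat \<Rightarrow> nat" where
  "prefix \<sigma> t = nmem \<sigma> nWORDS (nmem \<sigma> nSLOT 0 + t)"

lemma eff_weight_com:
  assumes "env n d s \<sigma>" "nmem \<sigma> nT 0 < d"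
  shows "eff weight_com \<sigma> = set_fmem fWEIGHT 0
    (weight n (prefix \<sigma>) (fmem \<sigma> fCELLS) (nmem \<sigma> nT 0) (nmem \<sigma> nCODE 0)) \<sigma>"
  using assms by (auto simp: weight_com_def weight_def prefix_def env_def)


definition weight_at :: "nat \<Rightarrow> 'a::field machine \<Rightarrow> nat \<Rightarrow> nat \<Rightarrow> 'a" where
  "weight_at n \<sigma> = weight n (prefix \<sigma>) (fmem \<sigma> fCELLS)"

lemma eff_layer_com:
  fixes \<sigma> :: "'a::field machine"
  assumes env: "env n d s \<sigma>" and a: "a = fMATS \<or> a = fVEC" and t: "nmem \<sigma> nT 0 = Suc t" "t < d"
    and c: "nmem \<sigma> nCODE 0 = c" "c \<le> 2 * n"
    and fa: "fmem \<sigma> a = patch (nmem \<sigma> nBASE 0) (4 * d + 2) v g"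
  defines "\<epsilon> \<equiv> fmem \<sigma> fSIGN 0" and "\<sigma>' \<equiv> eff (layer_com a) \<sigma>"
  shows "nmem \<sigma>' nT 0 = t"
    and "fmem \<sigma>' a = patch (nmem \<sigma> nBASE 0) (4 * d + 2)
      (v(4 * t + 4 := v (4 * t + 4) + \<epsilon> * (v (4 * t + 2) + of_nat c * v (4 * t + 3)) * of_nat c,
         4 * t + 5 := v (4 * t + 5) - \<epsilon> * (v (4 * t + 2) + of_nat c * v (4 * t + 3)),
         4 * t + 2 := v (4 * t + 2) + \<epsilon> * weight_at n \<sigma> t c * (v (4 * t) + of_nat c * v (4 * t + 1)) * of_nat c,
         4 * t + 3 := v (4 * t + 3) - \<epsilon> * weight_at n \<sigma> t c * (v (4 * t) + of_nat c * v (4 * t + 1)))) g"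
proof -
  let ?b = "nmem \<sigma> nBASE 0"
  define \<tau> where "\<tau> = set_nmem nT 0 t \<sigma>"
  have e\<tau>: "env n d s \<tau>" "nmem \<tau> nT 0 = t" "nmem \<tau> nCODE 0 = c" "prefix \<tau> = prefix \<sigma>" "fmem \<tau> = fmem \<sigma>"
    using env c by (auto simp: \<tau>_def set_nmem_def env_def prefix_def fun_eq_iff)
  have ew: "eff weight_com \<tau> = set_fmem fWEIGHT 0 (weight_at n \<sigma> t c) \<tau>"
    using eff_weight_com[OF e\<tau>(1)] t e\<tau> by (simp add: weight_at_def)
  have nums: "fmem \<sigma> fNUMS c = of_nat c" using env c by (simp add: env_def)
  have fa': "fmem \<sigma> a (?b + x) = v x" if "x < 4 * d + 2" for x
    unfolding fa by (rule patch_apply[OF that])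
  have quad: "t + t + (t + t) = 4 * t" by simp
  have lt: "4 * t < 4 * d + 2" "4 * t + 1 < 4 * d + 2" "4 * t + 2 < 4 * d + 2"
    "4 * t + 3 < 4 * d + 2" "4 * t + 4 < 4 * d + 2" "4 * t + 5 < 4 * d + 2"
    using t by simp_all
  show "nmem \<sigma>' nT 0 = t"
    unfolding \<sigma>'_def layer_com_def using t
    by (simp add: ew[unfolded \<tau>_def] fun_upd_def)
  have "fmem \<sigma>' a = (fmem \<sigma> a)
      (?b + (4 * t + 4) := v (4 * t + 4) + \<epsilon> * (v (4 * t + 2) + of_nat c * v (4 * t + 3)) * of_nat c,
       ?b + (4 * t + 5) := v (4 * t + 5) - \<epsilon> * (v (4 * t + 2) + of_nat c * v (4 * t + 3)),
       ?b + (4 * t + 2) := v (4 * t + 2) + \<epsilon> * weight_at n \<sigma> t c * (v (4 * t) + of_nat c * v (4 * t + 1)) * of_nat c,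
       ?b + (4 * t + 3) := v (4 * t + 3) - \<epsilon> * weight_at n \<sigma> t c * (v (4 * t) + of_nat c * v (4 * t + 1)))"
    unfolding \<sigma>'_def layer_com_def
    using t(1) a c(1) nums fa'[OF lt(1)] fa'[OF lt(2)] fa'[OF lt(3)] fa'[OF lt(4)] fa'[OF lt(5)] fa'[OF lt(6)]
    \<comment> \<open>Once the array name is concrete, the simplifier can tell the vector apart from
      the scratch arrays.\<close>
    by (elim disjE; hypsubst) (simp_all add: ew[unfolded \<tau>_def] \<epsilon>_def quad)
  also have "\<dots> = patch ?b (4 * d + 2)
      (v(4 * t + 4 := v (4 * t + 4) + \<epsilon> * (v (4 * t + 2) + of_nat c * v (4 * t + 3)) * of_nat c,
         4 * t + 5 := v (4 * t + 5) - \<epsilon> * (v (4 * t + 2) + of_nat c * v (4 * t + 3)),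
         4 * t + 2 := v (4 * t + 2) + \<epsilon> * weight_at n \<sigma> t c * (v (4 * t) + of_nat c * v (4 * t + 1)) * of_nat c,
         4 * t + 3 := v (4 * t + 3) - \<epsilon> * weight_at n \<sigma> t c * (v (4 * t) + of_nat c * v (4 * t + 1)))) g"
    unfolding fa by (simp only: patch_upd lt)
  finally show "fmem \<sigma>' a = \<dots>" .
qed

section \<open>Correctness and running time\<close>

text \<open>Keeps \<open>4 * d + 2\<close> and cell indices from being rewritten into successor form.\<close>

declare add_2_eq_Suc [simp del] add_2_eq_Suc' [simp del]

lemma frame_nmem: "frame c \<sigma> \<sigma>' \<Longrightarrow> a \<notin> nwr c \<Longrightarrow> nmem \<sigma>' a = nmem \<sigma> a"
  and frame_fmem: "frame c \<sigma> \<sigma>' \<Longrightarrow> a \<notin> fwr c \<Longrightarrow> fmem \<sigma>' a = fmem \<sigma> a"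
  and frame_out: "frame c \<sigma> \<sigma>' \<Longrightarrow> quiet c \<Longrightarrow> cur_word \<sigma>' = cur_word \<sigma>"
    "frame c \<sigma> \<sigma>' \<Longrightarrow> quiet c \<Longrightarrow> out_terms \<sigma>' = out_terms \<sigma>"
  by (simp_all add: frame_def)

lemma env_cong:
  assumes "nmem \<sigma>' nGEN = nmem \<sigma> nGEN" "nmem \<sigma>' nDEG = nmem \<sigma> nDEG" "nmem \<sigma>' nSPARSE = nmem \<sigma> nSPARSE"
    "nmem \<sigma>' nDIM = nmem \<sigma> nDIM" "nmem \<sigma>' nROWS = nmem \<sigma> nROWS" "fmem \<sigma>' fNUMS = fmem \<sigma> fNUMS"
  shows "env n d s \<sigma>' = env n d s \<sigma>"
  using assms by (simp add: env_def)

lemma env_frame: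
  assumes "frame c \<sigma> \<sigma>'" "nwr c \<inter> {nGEN, nDEG, nSPARSE, nDIM, nROWS} = {}" "fNUMS \<notin> fwr c"
  shows "env n d s \<sigma>' = env n d s \<sigma>"
  by (rule env_cong) (use assms in \<open>auto intro!: frame_nmem frame_fmem\<close>)

lemma env_upd [simp]:
  "a \<notin> {nGEN, nDEG, nSPARSE, nDIM, nROWS} \<Longrightarrow> env n d s (set_nmem a i x \<sigma>) = env n d s \<sigma>"
  "a \<noteq> fNUMS \<Longrightarrow> env n d s (set_fmem a i y \<sigma>) = env n d s \<sigma>"
  by (rule env_cong; simp)+

lemma weight_at_cong:
  assumes "nmem \<sigma>' nWORDS = nmem \<sigma> nWORDS" "nmem \<sigma>' nSLOT = nmem \<sigma> nSLOT" "fmem \<sigma>' fCELLS = fmem \<sigma> fCELLS"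
  shows "weight_at n \<sigma>' = weight_at n \<sigma>"
proof -
  have "prefix \<sigma>' = prefix \<sigma>" using assms by (simp add: prefix_def fun_eq_iff)
  then show ?thesis using assms(3) by (simp add: weight_at_def)
qed

lemma weight_at_frame:
  assumes "frame c \<sigma> \<sigma>'" "nwr c \<inter> {nWORDS, nSLOT} = {}" "fCELLS \<notin> fwr c"
  shows "weight_at n \<sigma>' = weight_at n \<sigma>"
  by (rule weight_at_cong) (use assms in \<open>auto intro!: frame_nmem frame_fmem\<close>)

lemma weight_at_upd [simp]:
  "a \<notin> {nWORDS, nSLOT} \<Longrightarrow> weight_at n (set_nmem a i x \<sigma>) = weight_at n \<sigma>"
  "a \<noteq> fCELLS \<Longrightarrow> weight_at n (set_fmem a i y \<sigma>) = weight_at n \<sigma>"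
  by (rule weight_at_cong; simp)+

text \<open>\<open>u\<close> is the half finished vector: sheared from coordinate
  \<open>4 * Suc t + 2\<close> on, old below. Block \<open>t\<close> reads only old values and moves
  the border down by four.\<close>

lemma shear_step:
  fixes E :: "nat \<Rightarrow> nat \<Rightarrow> 'a::field" and \<epsilon> :: 'a and c :: nat and v :: "nat \<Rightarrow> 'a"
  assumes t: "t < d" and x: "x < 4 * d + 2"
  defines "u \<equiv> \<lambda>x. if x < 4 * Suc t + 2 then v x else shear d E \<epsilon> c v x"
  shows "(u(4 * t + 4 := u (4 * t + 4) + \<epsilon> * (u (4 * t + 2) + of_nat c * u (4 * t + 3)) * of_nat c,
         4 * t + 5 := u (4 * t + 5) - \<epsilon> * (u (4 * t + 2) + of_nat c * u (4 * t + 3)),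
         4 * t + 2 := u (4 * t + 2) + \<epsilon> * E t c * (u (4 * t) + of_nat c * u (4 * t + 1)) * of_nat c,
         4 * t + 3 := u (4 * t + 3) - \<epsilon> * E t c * (u (4 * t) + of_nat c * u (4 * t + 1)))) x =
    (if x < 4 * t + 2 then v x else shear d E \<epsilon> c v x)"
proof -
  have u: "u (4 * t) = v (4 * t)" "u (4 * t + 1) = v (4 * t + 1)" "u (4 * t + 2) = v (4 * t + 2)"
    "u (4 * t + 3) = v (4 * t + 3)" "u (4 * t + 4) = v (4 * t + 4)" "u (4 * t + 5) = v (4 * t + 5)"
    by (simp_all add: u_def)
  have s: "shear d E \<epsilon> c v (4 * t + 2) = v (4 * t + 2) + \<epsilon> * E t c * (v (4 * t) + of_nat c * v (4 * t + 1)) * of_nat c"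
    "shear d E \<epsilon> c v (4 * t + 3) = v (4 * t + 3) - \<epsilon> * E t c * (v (4 * t) + of_nat c * v (4 * t + 1))"
    "shear d E \<epsilon> c v (4 * t + 4) = v (4 * t + 4) + \<epsilon> * (v (4 * t + 2) + of_nat c * v (4 * t + 3)) * of_nat c"
    "shear d E \<epsilon> c v (4 * t + 5) = v (4 * t + 5) - \<epsilon> * (v (4 * t + 2) + of_nat c * v (4 * t + 3))"
    unfolding shear_def nilp_eval[OF t] by (simp_all only: mult.assoc mult_minus_right diff_conv_add_uminus)
  consider "x < 4 * t + 2" | "x = 4 * t + 2" | "x = 4 * t + 3" | "x = 4 * t + 4" | "x = 4 * t + 5"
    | "4 * Suc t + 2 \<le> x" by fastforce
  then show ?thesis
    unfolding u
  proof cases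
    case 6
    then show "(u(4 * t + 4 := v (4 * t + 4) + \<epsilon> * (v (4 * t + 2) + of_nat c * v (4 * t + 3)) * of_nat c,
         4 * t + 5 := v (4 * t + 5) - \<epsilon> * (v (4 * t + 2) + of_nat c * v (4 * t + 3)),
         4 * t + 2 := v (4 * t + 2) + \<epsilon> * E t c * (v (4 * t) + of_nat c * v (4 * t + 1)) * of_nat c,
         4 * t + 3 := v (4 * t + 3) - \<epsilon> * E t c * (v (4 * t) + of_nat c * v (4 * t + 1)))) x =
      (if x < 4 * t + 2 then v x else shear d E \<epsilon> c v x)"
      by (simp add: u_def)
  next
    case 1
    then show "(u(4 * t + 4 := v (4 * t + 4) + \<epsilon> * (v (4 * t + 2) + of_nat c * v (4 * t + 3)) * of_nat c,
         4 * t + 5 := v (4 * t + 5) - \<epsilon> * (v (4 * t + 2) + of_nat c * v (4 * t + 3)),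
         4 * t + 2 := v (4 * t + 2) + \<epsilon> * E t c * (v (4 * t) + of_nat c * v (4 * t + 1)) * of_nat c,
         4 * t + 3 := v (4 * t + 3) - \<epsilon> * E t c * (v (4 * t) + of_nat c * v (4 * t + 1)))) x =
      (if x < 4 * t + 2 then v x else shear d E \<epsilon> c v x)"
      by (simp add: u_def)
  qed (simp_all add: s del: add_2_eq_Suc' add_2_eq_Suc)
qed

lemma run_shear_com:
  fixes \<sigma> :: "'a::field machine"
  assumes env: "env n d s \<sigma>" and a: "a = fMATS \<or> a = fVEC"
    and c: "nmem \<sigma> nCODE 0 = c" "c \<le> 2 * n" and fa: "fmem \<sigma> a = patch (nmem \<sigma> nBASE 0) (4 * d + 2) v g"
  shows "run n ask (shear_com a) (2 + d * 14) (\<lambda>\<sigma>'. fmem \<sigma>' a =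
    patch (nmem \<sigma> nBASE 0) (4 * d + 2) (shear d (weight_at n \<sigma>) (fmem \<sigma> fSIGN 0) c v) g) \<sigma>"
proof -
  let ?b = "nmem \<sigma> nBASE 0" and ?D = "4 * d + 2" and ?\<epsilon> = "fmem \<sigma> fSIGN 0" and ?E = "weight_at n \<sigma>"
  let ?w = "\<lambda>t x. if x < 4 * t + 2 then v x else shear d ?E ?\<epsilon> c v x"
  let ?I = "\<lambda>\<sigma>'. nmem \<sigma>' nT 0 \<le> d \<and> fmem \<sigma>' a = patch ?b ?D (?w (nmem \<sigma>' nT 0)) g"
  let ?\<sigma> = "set_nmem nT 0 d \<sigma>"
  have a': "a \<notin> {fNUMS, fCELLS, fSIGN, fWEIGHT, fU}" using a by auto
  have "run n ask (While (npos (nv nT)) (layer_com a)) (1 + d * 14)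
    (\<lambda>\<sigma>'. fmem \<sigma>' a = patch ?b ?D (shear d ?E ?\<epsilon> c v) g) ?\<sigma>"
  proof (rule run_While[where I = ?I and \<mu> = "\<lambda>\<sigma>'. nmem \<sigma>' nT 0" and B = 13])
    \<comment> \<open>With counter \<open>d\<close> the border is the dimension itself, so nothing
      is sheared yet.\<close>
    have "patch ?b ?D v g = patch ?b ?D (?w d) g" by (rule patch_cong) simp
    then show "?I ?\<sigma>" using fa by simp
  next
    fix \<sigma>' assume I: "?I \<sigma>'" and fr: "frame (layer_com a) ?\<sigma> \<sigma>'" and "bval (npos (nv nT)) \<sigma>'"
    then obtain t where t: "nmem \<sigma>' nT 0 = Suc t" "t < d" by (cases "nmem \<sigma>' nT 0") auto
    have env': "env n d s \<sigma>'" using env_frame[OF fr] env a' by simp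
    have wa: "weight_at n \<sigma>' = ?E" using weight_at_frame[OF fr] a' by simp
    have eq: "nmem \<sigma>' nCODE 0 = c" "nmem \<sigma>' nBASE 0 = ?b" "fmem \<sigma>' fSIGN 0 = ?\<epsilon>"
      using frame_nmem[OF fr, of nCODE] frame_nmem[OF fr, of nBASE] frame_fmem[OF fr, of fSIGN] a' c
      by simp_all
    have fa': "fmem \<sigma>' a = patch (nmem \<sigma>' nBASE 0) ?D (?w (Suc t)) g"
      using I t eq by simp
    note e = eff_layer_com[OF env' a t eq(1) c(2) fa', unfolded eq wa]
    show "run n ask (layer_com a) 13 (\<lambda>\<sigma>''. ?I \<sigma>'' \<and> nmem \<sigma>'' nT 0 < nmem \<sigma>' nT 0) \<sigma>'"
    proof (rule run_straight)
      have "fmem (eff (layer_com a) \<sigma>') a = patch ?b ?D (?w t) g"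
        unfolding e(2) by (rule patch_cong, rule shear_step[OF t(2)])
      then show "?I (eff (layer_com a) \<sigma>') \<and> nmem (eff (layer_com a) \<sigma>') nT 0 < nmem \<sigma>' nT 0"
        using e(1) t by simp
    qed simp_all
  next
    fix \<sigma>' assume I: "?I \<sigma>'" and "\<not> bval (npos (nv nT)) \<sigma>'"
    then have "fmem \<sigma>' a = patch ?b ?D (?w 0) g" by simp
    also have "\<dots> = patch ?b ?D (shear d ?E ?\<epsilon> c v) g"
      \<comment> \<open>Only layer \<open>0\<close> is left over, and a shear fixes it.\<close>
      by (rule patch_cong) (simp add: shear_def nilp_def)
    finally show "fmem \<sigma>' a = \<dots>" .
  qed simp
  then show ?thesis
    unfolding shear_com_def by (rule run_after) (use env in \<open>simp_all add: env_def\<close>)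
qed

lemma run_act_com:
  fixes \<sigma> :: "'a::field machine"
  assumes env: "env n d s \<sigma>" and a: "a = fMATS \<or> a = fVEC"
    and c: "nmem \<sigma> nCODE 0 = c" "0 < c" "c \<le> 2 * n"
    and fa: "fmem \<sigma> a = patch (nmem \<sigma> nBASE 0) (4 * d + 2) v g"
  shows "run n ask (act_com a) (20 + d * 28) (\<lambda>\<sigma>'. fmem \<sigma>' a =
    patch (nmem \<sigma> nBASE 0) (4 * d + 2) (act n d (weight_at n \<sigma>) c v) g) \<sigma>"
proof -
  have a': "a \<notin> {fNUMS, fCELLS, fSIGN, fWEIGHT, fU}" using a by auto
  let ?b = "nmem \<sigma> nBASE 0" and ?D = "4 * d + 2" and ?E = "weight_at n \<sigma>"
  let ?\<sigma> = "set_fmem fSIGN 0 1 \<sigma>"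
  have "run n ask (shear_com a) (2 + d * 14) (\<lambda>\<sigma>'. fmem \<sigma>' a =
    patch ?b ?D (shear d ?E 1 c v) g) ?\<sigma>"
    using run_shear_com[of n d s ?\<sigma> a c v g ask] env a a' c fa by simp
  then have "run n ask (shear_com a ;;
    com.If (NLess (nv nCODE) (NPlus (nv nGEN) (NConst 1)))
      (nset nCODE (NPlus (nv nCODE) (nv nGEN))) (nset nCODE (NMinus (nv nCODE) (nv nGEN))) ;;
    fset fSIGN (FMinus FZero FOne) ;;
    shear_com a) (10 + d * 28)
     (\<lambda>\<sigma>'. fmem \<sigma>' a = patch ?b ?D (act n d ?E c v) g) ?\<sigma>"
  proof (rule run_SeqI)
    fix \<sigma>1 assume fr: "frame (shear_com a) ?\<sigma> \<sigma>1" and f1: "fmem \<sigma>1 a = patch ?b ?D (shear d ?E 1 c v) g"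
    let ?\<sigma>2 = "set_fmem fSIGN 0 (- 1) (set_nmem nCODE 0 (icode n c) \<sigma>1)"
    have env1: "env n d s \<sigma>1" using env_frame[OF fr] env a' by simp
    have wa: "weight_at n \<sigma>1 = ?E" using weight_at_frame[OF fr] a' by simp
    have eq: "nmem \<sigma>1 nCODE 0 = c" "nmem \<sigma>1 nBASE 0 = ?b"
      using frame_nmem[OF fr, of nCODE] frame_nmem[OF fr, of nBASE] c by simp_all
    have "run n ask (shear_com a) (2 + d * 14) (\<lambda>\<sigma>'. fmem \<sigma>' a =
      patch ?b ?D (act n d ?E c v) g) ?\<sigma>2"
      using run_shear_com[of n d s ?\<sigma>2 a "icode n c" "shear d ?E 1 c v" g ask] env1 a a' f1 eq wa
        icode_bounds[OF c(2,3)] by (simp add: act_def)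
    then have "run n ask (fset fSIGN (FMinus FZero FOne) ;; shear_com a) (3 + d * 14)
      (\<lambda>\<sigma>'. fmem \<sigma>' a = patch ?b ?D (act n d ?E c v) g) (set_nmem nCODE 0 (icode n c) \<sigma>1)"
      by (rule run_after) simp_all
    moreover have "nmem \<sigma>1 nGEN 0 = n" using env1 by (simp add: env_def)
    ultimately show "run n ask (com.If (NLess (nv nCODE) (NPlus (nv nGEN) (NConst 1)))
      (nset nCODE (NPlus (nv nCODE) (nv nGEN))) (nset nCODE (NMinus (nv nCODE) (nv nGEN))) ;;
    fset fSIGN (FMinus FZero FOne) ;;
    shear_com a) (8 + d * 14) (\<lambda>\<sigma>'. fmem \<sigma>' a = patch ?b ?D (act n d ?E c v) g) \<sigma>1"
      by (elim run_after) (simp_all add: eq icode_def)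
  qed simp
  then show ?thesis
    unfolding act_com_def by (rule run_after) simp_all
qed

definition act_time :: "nat \<Rightarrow> nat" where "act_time d = 20 + d * 28"
definition unit_time :: "nat \<Rightarrow> nat" where "unit_time d = 3 + (4 * d + 2) * 3"
definition word_time :: "nat \<Rightarrow> nat" where "word_time d = 4 + unit_time d + d * (act_time d + 6)"

lemma run_unit_com:
  fixes \<sigma> :: "'a::field machine"
  assumes env: "env n d s \<sigma>" and a: "a = fMATS \<or> a = fVEC" and r: "nmem \<sigma> nROW 0 = r" "r < 4 * d + 2"
  shows "run n ask (unit_com a) (unit_time d) (\<lambda>\<sigma>'. fmem \<sigma>' a =
    patch (nmem \<sigma> nBASE 0) (4 * d + 2) (unit_fun r) (fmem \<sigma> a)) \<sigma>"
proof -
  let ?b = "nmem \<sigma> nBASE 0" and ?D = "4 * d + 2"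
  let ?I = "\<lambda>\<sigma>'. nmem \<sigma>' nX 0 \<le> ?D \<and> fmem \<sigma>' a = patch ?b (nmem \<sigma>' nX 0) (\<lambda>_. 0) (fmem \<sigma> a)"
  let ?\<sigma> = "set_nmem nX 0 0 \<sigma>"
  let ?c = "FSet a (NPlus (nv nBASE) (nv nX)) FZero ;; ninc nX 1"
  have a': "a \<notin> {fNUMS, fCELLS, fSIGN, fWEIGHT, fU}" using a by auto
  have "run n ask (While (NLess (nv nX) (nv nDIM)) ?c ;; FSet a (NPlus (nv nBASE) (nv nROW)) FOne)
    (2 + ?D * 3) (\<lambda>\<sigma>'. fmem \<sigma>' a = patch ?b ?D (unit_fun r) (fmem \<sigma> a)) ?\<sigma>"
  proof (rule run_SeqI[where ?T2.0 = 1 and ?T1.0 = "1 + ?D * 3"])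
    show "run n ask (While (NLess (nv nX) (nv nDIM)) ?c) (1 + ?D * 3)
      (\<lambda>\<sigma>'. fmem \<sigma>' a = patch ?b ?D (\<lambda>_. 0) (fmem \<sigma> a)) ?\<sigma>"
    proof (rule run_While[where I = ?I and \<mu> = "\<lambda>\<sigma>'. ?D - nmem \<sigma>' nX 0" and B = 2])
      show "?I ?\<sigma>" by (auto simp: patch_def fun_eq_iff)
    next
      fix \<sigma>' assume I: "?I \<sigma>'" and fr: "frame ?c ?\<sigma> \<sigma>'" and b: "bval (NLess (nv nX) (nv nDIM)) \<sigma>'"
      have "env n d s \<sigma>'" using env_frame[OF fr] env a' by simp
      with b have lt: "nmem \<sigma>' nX 0 < ?D" by (simp add: env_def)
      have base: "nmem \<sigma>' nBASE 0 = ?b" using frame_nmem[OF fr, of nBASE] by simp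
      have "(patch ?b x (\<lambda>_. 0) (fmem \<sigma> a))(?b + x := 0) = patch ?b (Suc x) (\<lambda>_. 0) (fmem \<sigma> a)" for x
        by (auto simp: patch_def fun_eq_iff)
      with lt I base show "run n ask ?c 2 (\<lambda>\<sigma>''. ?I \<sigma>'' \<and> ?D - nmem \<sigma>'' nX 0 < ?D - nmem \<sigma>' nX 0) \<sigma>'"
        by (intro run_straight) simp_all
    next
      fix \<sigma>' assume I: "?I \<sigma>'" and fr: "frame ?c ?\<sigma> \<sigma>'" and b: "\<not> bval (NLess (nv nX) (nv nDIM)) \<sigma>'"
      have "env n d s \<sigma>'" using env_frame[OF fr] env a' by simp
      with b I have "nmem \<sigma>' nX 0 = ?D" by (simp add: env_def)
      with I show "fmem \<sigma>' a = patch ?b ?D (\<lambda>_. 0) (fmem \<sigma> a)" by simp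
    qed simp
  next
    fix \<sigma>' assume fr: "frame (While (NLess (nv nX) (nv nDIM)) ?c) ?\<sigma> \<sigma>'"
      and f: "fmem \<sigma>' a = patch ?b ?D (\<lambda>_. 0) (fmem \<sigma> a)"
    have "nmem \<sigma>' nBASE 0 = ?b" "nmem \<sigma>' nROW 0 = r"
      using frame_nmem[OF fr, of nBASE] frame_nmem[OF fr, of nROW] r by simp_all
    then show "run n ask (FSet a (NPlus (nv nBASE) (nv nROW)) FOne) 1
      (\<lambda>\<sigma>'. fmem \<sigma>' a = patch ?b ?D (unit_fun r) (fmem \<sigma> a)) \<sigma>'"
      using r(2) by (intro run_straight) (simp_all add: f patch_upd, intro patch_cong, simp add: unit_fun_def)
  qed simp
  then show ?thesis
    unfolding unit_com_def by (rule run_after) (simp_all add: unit_time_def)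
qed

definition stored :: "nat \<Rightarrow> nat \<Rightarrow> gword \<Rightarrow> (nat \<Rightarrow> nat) \<Rightarrow> bool" where
  "stored n d w p \<longleftrightarrow> length w \<le> d \<and> (\<forall>t<d. p t = (if t < length w then code n (w ! t) else 0))"

lemma run_word_com:
  fixes \<sigma> :: "'a::field machine"
  assumes env: "env n d s \<sigma>" and w: "w \<in> reduced_words n"
    and st: "stored n d w (\<lambda>t. nmem \<sigma> nWORDS (nmem \<sigma> nOFF 0 + t))"
  shows "run n ask word_com (word_time d) (\<lambda>\<sigma>'. \<forall>x < 4 * d + 2.
    fmem \<sigma>' fVEC x = word_act n d (weight_at n \<sigma>) w (unit_fun 0) x) \<sigma>"
proof -
  let ?D = "4 * d + 2" and ?E = "weight_at n \<sigma>" and ?o = "nmem \<sigma> nOFF 0"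
  let ?\<sigma> = "set_nmem nROW 0 0 (set_nmem nBASE 0 0 \<sigma>)"
  let ?c = "nset nCODE (NGet nWORDS (NPlus (nv nOFF) (nv nL))) ;;
       com.If (npos (nv nCODE)) (act_com fVEC) Skip ;;
       ninc nL 1"
  let ?b = "NLess (nv nL) (nv nDEG)"
  let ?g = "fmem \<sigma> fVEC" and ?v = "\<lambda>l. word_act n d ?E (take l w) (unit_fun 0)"
  let ?I = "\<lambda>\<sigma>'. nmem \<sigma>' nL 0 \<le> d \<and> fmem \<sigma>' fVEC = patch 0 ?D (?v (nmem \<sigma>' nL 0)) ?g"
  have lw: "length w \<le> d" using st by (simp add: stored_def)
  have loop: "run n ask (While ?b ?c) (1 + d * (act_time d + 6))
    (\<lambda>\<sigma>'. fmem \<sigma>' fVEC = patch 0 ?D (?v d) ?g) \<sigma>1"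
    if I: "?I \<sigma>1" "nmem \<sigma>1 nL 0 = 0" and env1: "env n d s \<sigma>1" and wa1: "weight_at n \<sigma>1 = ?E"
      and eq1: "nmem \<sigma>1 nBASE 0 = 0" "nmem \<sigma>1 nWORDS = nmem \<sigma> nWORDS" "nmem \<sigma>1 nOFF = nmem \<sigma> nOFF"
    for \<sigma>1
  proof (rule run_While[where I = ?I and \<mu> = "\<lambda>\<sigma>'. d - nmem \<sigma>' nL 0" and B = "act_time d + 5"])
    fix \<sigma>' assume I: "?I \<sigma>'" and fr: "frame ?c \<sigma>1 \<sigma>'" and b: "bval ?b \<sigma>'"
    have env': "env n d s \<sigma>'" using env_frame[OF fr] env1 by simp
    have wa: "weight_at n \<sigma>' = ?E" using weight_at_frame[OF fr] wa1 by simp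
    obtain l where l: "nmem \<sigma>' nL 0 = l" "l < d" using b env' by (auto simp: env_def)
    define x where "x = (if l < length w then code n (w ! l) else 0)"
    have eq: "nmem \<sigma>' nBASE 0 = 0" "nmem \<sigma>' nWORDS (nmem \<sigma>' nOFF 0 + l) = x"
      using frame_nmem[OF fr, of nBASE] frame_nmem[OF fr, of nWORDS] frame_nmem[OF fr, of nOFF] eq1 st l
      by (simp_all add: stored_def x_def)
    let ?\<sigma>2 = "set_nmem nCODE 0 x \<sigma>'"
    have "run n ask (com.If (npos (nv nCODE)) (act_com fVEC) Skip ;; ninc nL 1) (act_time d + 4)
      (\<lambda>\<sigma>''. ?I \<sigma>'' \<and> d - nmem \<sigma>'' nL 0 < d - nmem \<sigma>' nL 0) ?\<sigma>2"
    proof (rule run_SeqI)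
      show "run n ask (com.If (npos (nv nCODE)) (act_com fVEC) Skip) (1 + act_time d + 1)
        (\<lambda>\<sigma>''. fmem \<sigma>'' fVEC = patch 0 ?D (?v (Suc l)) ?g) ?\<sigma>2"
      proof (rule run_If)
        assume "bval (npos (nv nCODE)) ?\<sigma>2"
        then have lt: "l < length w" by (auto simp: x_def split: if_splits)
        then have "x = code n (w ! l)" by (simp add: x_def)
        moreover have "fst (w ! l) < n" by (rule reduced_words_nth[OF w lt])
        ultimately have x: "0 < x" "x \<le> 2 * n" using code_bounds by auto
        have "?v (Suc l) = act n d ?E x (?v l)"
          using lt by (simp add: take_Suc_conv_app_nth word_act_def \<open>x = code n (w ! l)\<close>)
        with run_act_com[of n d s ?\<sigma>2 fVEC x "?v l" ?g ask] env' x eq I l wa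
        show "run n ask (act_com fVEC) (act_time d) (\<lambda>\<sigma>''. fmem \<sigma>'' fVEC = patch 0 ?D (?v (Suc l)) ?g) ?\<sigma>2"
          by (simp add: act_time_def)
      next
        assume "\<not> bval (npos (nv nCODE)) ?\<sigma>2"
        then have "x = 0" by simp
        then have "\<not> l < length w" by (auto simp: x_def code_def)
        \<comment> \<open>Behind the end of the word \<open>take\<close> no longer grows.\<close>
        then have "?v (Suc l) = ?v l" by simp
        then show "run n ask Skip 1 (\<lambda>\<sigma>''. fmem \<sigma>'' fVEC = patch 0 ?D (?v (Suc l)) ?g) ?\<sigma>2"
          using I l by (intro run_straight) simp_all
      qed
    next
      fix \<sigma>3 assume fr3: "frame (com.If (npos (nv nCODE)) (act_com fVEC) Skip) ?\<sigma>2 \<sigma>3"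
        and f3: "fmem \<sigma>3 fVEC = patch 0 ?D (?v (Suc l)) ?g"
      have "nmem \<sigma>3 nL 0 = l" using frame_nmem[OF fr3, of nL] l by simp
      with f3 l show "run n ask (ninc nL 1) 1 (\<lambda>\<sigma>''. ?I \<sigma>'' \<and> d - nmem \<sigma>'' nL 0 < d - nmem \<sigma>' nL 0) \<sigma>3"
        by (intro run_straight) simp_all
    qed simp
    then show "run n ask ?c (act_time d + 5) (\<lambda>\<sigma>''. ?I \<sigma>'' \<and> d - nmem \<sigma>'' nL 0 < d - nmem \<sigma>' nL 0) \<sigma>'"
      by (rule run_after) (simp_all add: l eq)
  next
    fix \<sigma>' assume I: "?I \<sigma>'" and fr: "frame ?c \<sigma>1 \<sigma>'" and b: "\<not> bval ?b \<sigma>'"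
    have env': "env n d s \<sigma>'" using env_frame[OF fr] env1 by simp
    with b I have "nmem \<sigma>' nL 0 = d" by (simp add: env_def)
    with I show "fmem \<sigma>' fVEC = patch 0 ?D (?v d) ?g" by simp
  qed (use I in simp_all)
  have "run n ask (unit_com fVEC ;; nset nL (NConst 0) ;; While ?b ?c) (unit_time d + (2 + d * (act_time d + 6)))
    (\<lambda>\<sigma>'. fmem \<sigma>' fVEC = patch 0 ?D (?v d) ?g) ?\<sigma>"
  proof (rule run_SeqI)
    show "run n ask (unit_com fVEC) (unit_time d) (\<lambda>\<sigma>'. fmem \<sigma>' fVEC = patch 0 ?D (unit_fun 0) ?g) ?\<sigma>"
      using run_unit_com[of n d s ?\<sigma> fVEC 0 ask] env by simp
  next
    fix \<sigma>1 assume fr: "frame (unit_com fVEC) ?\<sigma> \<sigma>1" and f1: "fmem \<sigma>1 fVEC = patch 0 ?D (unit_fun 0) ?g"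
    have "env n d s \<sigma>1" using env_frame[OF fr] env by simp
    moreover have "weight_at n \<sigma>1 = ?E" using weight_at_frame[OF fr] by simp
    moreover have "nmem \<sigma>1 nBASE 0 = 0" "nmem \<sigma>1 nWORDS = nmem \<sigma> nWORDS" "nmem \<sigma>1 nOFF = nmem \<sigma> nOFF"
      using frame_nmem[OF fr, of nBASE] frame_nmem[OF fr, of nWORDS] frame_nmem[OF fr, of nOFF] by simp_all
    ultimately have "run n ask (While ?b ?c) (1 + d * (act_time d + 6))
      (\<lambda>\<sigma>'. fmem \<sigma>' fVEC = patch 0 ?D (?v d) ?g) (set_nmem nL 0 0 \<sigma>1)"
      by (intro loop) (simp_all add: f1 word_act_def)
    then show "run n ask (nset nL (NConst 0) ;; While ?b ?c) (2 + d * (act_time d + 6))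
      (\<lambda>\<sigma>'. fmem \<sigma>' fVEC = patch 0 ?D (?v d) ?g) \<sigma>1"
      by (rule run_after) simp_all
  qed simp
  then have "run n ask word_com (word_time d) (\<lambda>\<sigma>'. fmem \<sigma>' fVEC = patch 0 ?D (?v d) ?g) \<sigma>"
    unfolding word_com_def by (rule run_after) (simp_all add: word_time_def)
  then show ?thesis
    by (rule run_conseq) (use lw in \<open>auto simp: patch_def\<close>)
qed

lemma run_fill_com:
  fixes \<sigma> :: "'a::field machine"
  assumes env: "env n d s \<sigma>"
  shows "run n ask fill_com (3 + (d * (2 * n + 1)) * 3) (\<lambda>\<sigma>'. \<forall>i \<le> d * (2 * n + 1).
    fmem \<sigma>' fCELLS i = fmem \<sigma> fZ 0 ^ 2 ^ i) \<sigma>"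
proof -
  let ?P = "d * (2 * n + 1)" and ?z = "fmem \<sigma> fZ 0"
  let ?\<sigma> = "set_nmem nI 0 0 (set_fmem fCELLS 0 ?z \<sigma>)"
  let ?I = "\<lambda>\<sigma>'. nmem \<sigma>' nI 0 \<le> ?P \<and> (\<forall>i \<le> nmem \<sigma>' nI 0. fmem \<sigma>' fCELLS i = ?z ^ 2 ^ i)"
  let ?b = "NLess (nv nI) (NGet nROWS (nv nDEG))"
  let ?c = "FSet fCELLS (NPlus (nv nI) (NConst 1)) (FTimes (FGet fCELLS (nv nI)) (FGet fCELLS (nv nI))) ;;
       ninc nI 1"
  have "run n ask (While ?b ?c) (1 + ?P * 3) (\<lambda>\<sigma>'. \<forall>i \<le> ?P. fmem \<sigma>' fCELLS i = ?z ^ 2 ^ i) ?\<sigma>"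
  proof (rule run_While[where I = ?I and \<mu> = "\<lambda>\<sigma>'. ?P - nmem \<sigma>' nI 0" and B = 2])
    show "?I ?\<sigma>" by simp
  next
    fix \<sigma>' assume I: "?I \<sigma>'" and fr: "frame ?c ?\<sigma> \<sigma>'" and b: "bval ?b \<sigma>'"
    have "env n d s \<sigma>'" using env_frame[OF fr] env by simp
    with b have lt: "nmem \<sigma>' nI 0 < ?P" by (simp add: env_def)
    have sq: "?z ^ 2 ^ Suc i = ?z ^ 2 ^ i * ?z ^ 2 ^ i" for i
      by (simp add: mult_2 power_add)
    have "fmem \<sigma>' fCELLS (nmem \<sigma>' nI 0) = ?z ^ 2 ^ nmem \<sigma>' nI 0" using I by blast
    with I lt show "run n ask ?c 2 (\<lambda>\<sigma>''. ?I \<sigma>'' \<and> ?P - nmem \<sigma>'' nI 0 < ?P - nmem \<sigma>' nI 0) \<sigma>'"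
      by (intro run_straight) (simp_all only: sq, auto simp: le_Suc_eq sq simp del: power_Suc)
  next
    fix \<sigma>' assume I: "?I \<sigma>'" and fr: "frame ?c ?\<sigma> \<sigma>'" and b: "\<not> bval ?b \<sigma>'"
    have "env n d s \<sigma>'" using env_frame[OF fr] env by simp
    with b have "\<not> nmem \<sigma>' nI 0 < ?P" by (simp add: env_def)
    with I show "\<forall>i \<le> ?P. fmem \<sigma>' fCELLS i = ?z ^ 2 ^ i" by auto
  qed simp
  then show ?thesis
    unfolding fill_com_def by (rule run_after) simp_all
qed

lemma nilp_cong:
  assumes "\<And>t. t < d \<Longrightarrow> E t c = E' t c"
  shows "nilp d E c v = nilp d E' c v"
proof
  fix x
  show "nilp d E c v x = nilp d E' c v x"
  proof (cases "2 \<le> x \<and> x < 4 * d + 2 \<and> even (x div 2 - 1)")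
    case True
    \<comment> \<open>An entry below \<open>4 * d + 2\<close> comes from a layer below
      \<open>2 * d\<close>.\<close>
    then have "(x div 2 - 1) div 2 < d" by presburger
    from assms[OF this] show ?thesis by (simp add: nilp_def Let_def)
  next
    case False
    then show ?thesis by (auto simp: nilp_def Let_def)
  qed
qed

text \<open>Memory holds the intended weights only for positions below \<open>d\<close> and codes up
  to \<open>2 * n\<close>; these are the weights that the operators of the letters see.\<close>

lemma word_act_cong:
  assumes E: "\<And>t c. t < d \<Longrightarrow> c \<le> 2 * n \<Longrightarrow> E t c = E' t c" and w: "w \<in> reduced_words n"
  shows "word_act n d E w = word_act n d E' w"
proof -
  have act: "act n d E (code n l) = act n d E' (code n l)" if "l \<in> set w" for l
  proof -
    have "fst l < n" using w that by (auto simp: reduced_words_def)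
    then have c: "code n l \<le> 2 * n" "icode n (code n l) \<le> 2 * n"
      using code_bounds icode_bounds by blast+
    have "nilp d E (code n l) = nilp d E' (code n l)"
      "nilp d E (icode n (code n l)) = nilp d E' (icode n (code n l))"
      by (rule ext, rule nilp_cong, rule E, simp, rule c)+
    then have "shear d E \<epsilon> (code n l) v = shear d E' \<epsilon> (code n l) v"
      "shear d E \<epsilon> (icode n (code n l)) v = shear d E' \<epsilon> (icode n (code n l)) v" for \<epsilon> v
      by (simp_all add: shear_def fun_eq_iff)
    then show ?thesis by (intro ext) (simp only: act_def)
  qed
  show ?thesis unfolding word_act_def by (rule ext, rule fold_cong) (simp_all add: act)
qed

section \<open>Building the query matrices\<close>

definition row_time :: "nat \<Rightarrow> nat" where "row_time d = unit_time d + act_time d + 3"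
definition build_time :: "nat \<Rightarrow> nat \<Rightarrow> nat" where
  "build_time n d = 3 + n * (4 + (4 * d + 2) * (row_time d + 1))"

lemma run_row_com:
  fixes \<sigma> :: "'a::field machine"
  assumes env: "env n d s \<sigma>" and r: "nmem \<sigma> nROW 0 = r" "r < 4 * d + 2"
    and i: "nmem \<sigma> nG 0 = i" "i < n"
  shows "run n ask row_com (row_time d) (\<lambda>\<sigma>'. nmem \<sigma>' nBASE 0 = nmem \<sigma> nBASE 0 + (4 * d + 2) \<and>
    nmem \<sigma>' nROW 0 = Suc r \<and> fmem \<sigma>' fMATS =
      patch (nmem \<sigma> nBASE 0) (4 * d + 2) (act n d (weight_at n \<sigma>) (Suc i) (unit_fun r)) (fmem \<sigma> fMATS)) \<sigma>"
proof -
  let ?b = "nmem \<sigma> nBASE 0" and ?D = "4 * d + 2" and ?E = "weight_at n \<sigma>" and ?g = "fmem \<sigma> fMATS"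
  let ?Q = "\<lambda>\<sigma>'. nmem \<sigma>' nBASE 0 = ?b + ?D \<and> nmem \<sigma>' nROW 0 = Suc r \<and>
    fmem \<sigma>' fMATS = patch ?b ?D (act n d ?E (Suc i) (unit_fun r)) ?g"
  let ?c3 = "nset nBASE (NPlus (nv nBASE) (nv nDIM)) ;; ninc nROW 1"
  have "run n ask row_com (unit_time d + (act_time d + 3)) ?Q \<sigma>"
    unfolding row_com_def
  proof (rule run_SeqI[OF run_unit_com[OF env _ r]])
    fix \<sigma>1 assume fr: "frame (unit_com fMATS) \<sigma> \<sigma>1" and f1: "fmem \<sigma>1 fMATS = patch ?b ?D (unit_fun r) ?g"
    have env1: "env n d s \<sigma>1" using env_frame[OF fr] env by simp
    have wa: "weight_at n \<sigma>1 = ?E" using weight_at_frame[OF fr] by simp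
    have eq: "nmem \<sigma>1 nBASE 0 = ?b" "nmem \<sigma>1 nROW 0 = r" "nmem \<sigma>1 nG 0 = i"
      using frame_nmem[OF fr, of nBASE] frame_nmem[OF fr, of nROW] frame_nmem[OF fr, of nG] r i by simp_all
    let ?\<sigma>2 = "set_nmem nCODE 0 (Suc i) \<sigma>1"
    have "run n ask (act_com fMATS ;; ?c3) (act_time d + 2) ?Q ?\<sigma>2"
    proof (rule run_SeqI[where ?T2.0 = 2])
      show "run n ask (act_com fMATS) (act_time d)
        (\<lambda>\<sigma>'. fmem \<sigma>' fMATS = patch ?b ?D (act n d ?E (Suc i) (unit_fun r)) ?g) ?\<sigma>2"
        using run_act_com[of n d s ?\<sigma>2 fMATS "Suc i" "unit_fun r" ?g ask] env1 eq i f1 wa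
        by (simp add: act_time_def)
    next
      fix \<sigma>3 assume fr3: "frame (act_com fMATS) ?\<sigma>2 \<sigma>3"
        and f3: "fmem \<sigma>3 fMATS = patch ?b ?D (act n d ?E (Suc i) (unit_fun r)) ?g"
      have "env n d s \<sigma>3" using env_frame[OF fr3] env1 by simp
      then have "nmem \<sigma>3 nBASE 0 = ?b" "nmem \<sigma>3 nROW 0 = r" "nmem \<sigma>3 nDIM 0 = ?D"
        using frame_nmem[OF fr3, of nBASE] frame_nmem[OF fr3, of nROW] eq by (simp_all add: env_def)
      with f3 show "run n ask ?c3 2 ?Q \<sigma>3" by (intro run_straight) simp_all
    qed simp
    then show "run n ask (nset nCODE (NPlus (nv nG) (NConst 1)) ;; act_com fMATS ;; ?c3) (act_time d + 3) ?Q \<sigma>1"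
      by (rule run_after) (simp_all add: eq)
  qed simp_all
  then show ?thesis by (simp add: row_time_def add.assoc)
qed

text \<open>Rows are counted through all matrices: row \<open>r\<close> of generator
  \<open>i\<close> has number \<open>i * (4 * d + 2) + r\<close>, which \<open>div\<close> and
  \<open>mod\<close> take apart again.\<close>

definition rows_done :: "nat \<Rightarrow> nat \<Rightarrow> (nat \<Rightarrow> nat \<Rightarrow> 'a::field) \<Rightarrow> nat \<Rightarrow> 'a machine \<Rightarrow> bool" where
  "rows_done n d E m \<sigma> \<longleftrightarrow> nmem \<sigma> nBASE 0 = m * (4 * d + 2) \<and> (\<forall>j<m. \<forall>k < 4 * d + 2.
     fmem \<sigma> fMATS (j * (4 * d + 2) + k) =
       act n d E (Suc (j div (4 * d + 2))) (unit_fun (j mod (4 * d + 2))) k)"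

lemma rows_done_upd [simp]: "a \<noteq> nBASE \<Longrightarrow> rows_done n d E m (set_nmem a i x \<sigma>) = rows_done n d E m \<sigma>"
  by (simp add: rows_done_def)

lemma rows_done_Suc:
  assumes J: "rows_done n d E (i * (4 * d + 2) + r) \<sigma>" and r: "r < 4 * d + 2"
    and b: "nmem \<sigma>' nBASE 0 = nmem \<sigma> nBASE 0 + (4 * d + 2)"
    and f: "fmem \<sigma>' fMATS = patch (nmem \<sigma> nBASE 0) (4 * d + 2) (act n d E (Suc i) (unit_fun r)) (fmem \<sigma> fMATS)"
  shows "rows_done n d E (i * (4 * d + 2) + Suc r) \<sigma>'"
proof -
  define D where "D = 4 * d + 2"
  define m where "m = i * D + r"
  have base: "nmem \<sigma> nBASE 0 = m * D" using J by (simp add: rows_done_def m_def D_def)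
  have dm: "m div D = i" "m mod D = r" using r by (simp_all add: m_def D_def)
  have "fmem \<sigma>' fMATS (j * D + k) = act n d E (Suc (j div D)) (unit_fun (j mod D)) k"
    if j: "j < Suc m" and k: "k < D" for j k
  proof (cases "j = m")
    case True
    then show ?thesis using k dm by (simp add: f base D_def[symmetric] patch_def)
  next
    case False
    then have "j + 1 \<le> m" using j by simp
    then have "(j + 1) * D \<le> m * D" by (rule mult_right_mono) simp
    \<comment> \<open>Finished rows lie below the window that is being overwritten.\<close>
    then have "j * D + k < m * D" using k by (simp add: algebra_simps)
    then have "fmem \<sigma>' fMATS (j * D + k) = fmem \<sigma> fMATS (j * D + k)"
      by (simp add: f base D_def[symmetric] patch_def)
    also have "\<dots> = act n d E (Suc (j div D)) (unit_fun (j mod D)) k"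
      using J j False k unfolding rows_done_def D_def[symmetric] m_def[symmetric] by auto
    finally show ?thesis .
  qed
  then show ?thesis
    using b base unfolding rows_done_def D_def[symmetric] by (simp add: m_def algebra_simps)
qed

lemma run_build_com:
  fixes \<sigma> :: "'a::field machine"
  assumes env: "env n d s \<sigma>"
  shows "run n ask build_com (build_time n d) (\<lambda>\<sigma>'. \<forall>i<n.
    query_mat fMATS (4 * d + 2) \<sigma>' i = op_mat (4 * d + 2) (act n d (weight_at n \<sigma>) (Suc i))) \<sigma>"
proof -
  let ?D = "4 * d + 2" and ?E = "weight_at n \<sigma>"
  let ?J = "rows_done n d ?E"
  let ?\<sigma> = "set_nmem nBASE 0 0 (set_nmem nG 0 0 \<sigma>)"
  let ?bi = "NLess (nv nROW) (nv nDIM)" and ?bo = "NLess (nv nG) (nv nGEN)"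
  let ?co = "nset nROW (NConst 0) ;; While ?bi row_com ;; ninc nG 1"
  let ?Ti = "1 + ?D * (row_time d + 1)"
  have inner: "run n ask (While ?bi row_com) ?Ti (\<lambda>\<sigma>'. ?J (i * ?D + ?D) \<sigma>') \<sigma>1"
    if env1: "env n d s \<sigma>1" and wa1: "weight_at n \<sigma>1 = ?E" and i: "nmem \<sigma>1 nG 0 = i" "i < n"
      and r: "nmem \<sigma>1 nROW 0 = 0" and J: "?J (i * ?D) \<sigma>1" for \<sigma>1 i
  proof -
    let ?I = "\<lambda>\<sigma>'. nmem \<sigma>' nROW 0 \<le> ?D \<and> ?J (i * ?D + nmem \<sigma>' nROW 0) \<sigma>'"
    show ?thesis
    proof (rule run_While[where I = ?I and \<mu> = "\<lambda>\<sigma>'. ?D - nmem \<sigma>' nROW 0" and B = "row_time d"])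
      show "?I \<sigma>1" using r J by simp
    next
      fix \<sigma>' assume I: "?I \<sigma>'" and fr: "frame row_com \<sigma>1 \<sigma>'" and b: "bval ?bi \<sigma>'"
      have env': "env n d s \<sigma>'" using env_frame[OF fr] env1 by simp
      have wa: "weight_at n \<sigma>' = ?E" using weight_at_frame[OF fr] wa1 by simp
      have i': "nmem \<sigma>' nG 0 = i" using frame_nmem[OF fr, of nG] i by simp
      have lt: "nmem \<sigma>' nROW 0 < ?D" using b env' by (simp add: env_def)
      show "run n ask row_com (row_time d) (\<lambda>\<sigma>''. ?I \<sigma>'' \<and> ?D - nmem \<sigma>'' nROW 0 < ?D - nmem \<sigma>' nROW 0) \<sigma>'"
      proof (rule run_conseq[OF run_row_com[OF env' refl lt i' i(2)]])
        fix \<sigma>'' :: "'a machine" assume Q: "nmem \<sigma>'' nBASE 0 = nmem \<sigma>' nBASE 0 + ?D \<and> nmem \<sigma>'' nROW 0 = Suc (nmem \<sigma>' nROW 0) \<and>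
          fmem \<sigma>'' fMATS = patch (nmem \<sigma>' nBASE 0) ?D
            (act n d (weight_at n \<sigma>') (Suc i) (unit_fun (nmem \<sigma>' nROW 0))) (fmem \<sigma>' fMATS)"
        then have "?J (i * ?D + Suc (nmem \<sigma>' nROW 0)) \<sigma>''"
          by (intro rows_done_Suc[OF conjunct2[OF I] lt]) (simp_all add: wa)
        with Q lt show "?I \<sigma>'' \<and> ?D - nmem \<sigma>'' nROW 0 < ?D - nmem \<sigma>' nROW 0" by simp
      qed simp
    next
      fix \<sigma>' assume I: "?I \<sigma>'" and fr: "frame row_com \<sigma>1 \<sigma>'" and b: "\<not> bval ?bi \<sigma>'"
      have env': "env n d s \<sigma>'" using env_frame[OF fr] env1 by simp
      with b I have "nmem \<sigma>' nROW 0 = ?D" by (simp add: env_def)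
      with I show "?J (i * ?D + ?D) \<sigma>'" by simp
    qed (use r in simp)
  qed
  let ?I = "\<lambda>\<sigma>'. nmem \<sigma>' nG 0 \<le> n \<and> ?J (nmem \<sigma>' nG 0 * ?D) \<sigma>'"
  have "run n ask (While ?bo ?co) (1 + n * (?Ti + 3)) (?J (n * ?D)) ?\<sigma>"
  proof (rule run_While[where I = ?I and \<mu> = "\<lambda>\<sigma>'. n - nmem \<sigma>' nG 0" and B = "?Ti + 2"])
    show "?I ?\<sigma>" by (simp add: rows_done_def)
  next
    fix \<sigma>' assume I: "?I \<sigma>'" and fr: "frame ?co ?\<sigma> \<sigma>'" and b: "bval ?bo \<sigma>'"
    have env': "env n d s \<sigma>'" using env_frame[OF fr] env by simp
    have wa: "weight_at n \<sigma>' = ?E" using weight_at_frame[OF fr] by simp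
    obtain i where i: "nmem \<sigma>' nG 0 = i" "i < n" using b env' by (auto simp: env_def)
    let ?\<sigma>1 = "set_nmem nROW 0 0 \<sigma>'"
    have J: "?J (i * ?D) ?\<sigma>1" using I i by simp
    have "run n ask (While ?bi row_com ;; ninc nG 1) (?Ti + 1)
      (\<lambda>\<sigma>''. ?I \<sigma>'' \<and> n - nmem \<sigma>'' nG 0 < n - nmem \<sigma>' nG 0) ?\<sigma>1"
    proof (rule run_SeqI[where ?T2.0 = 1])
      show "run n ask (While ?bi row_com) ?Ti (?J (i * ?D + ?D)) ?\<sigma>1"
        by (rule inner) (use env' wa i J in simp_all)
    next
      fix \<sigma>2 assume fr2: "frame (While ?bi row_com) ?\<sigma>1 \<sigma>2" and J2: "?J (i * ?D + ?D) \<sigma>2"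
      have "nmem \<sigma>2 nG 0 = i" using frame_nmem[OF fr2, of nG] i by simp
      moreover have "?J (Suc i * ?D) \<sigma>2" using J2 by (simp only: mult_Suc add.commute)
      ultimately show "run n ask (ninc nG 1) 1 (\<lambda>\<sigma>''. ?I \<sigma>'' \<and> n - nmem \<sigma>'' nG 0 < n - nmem \<sigma>' nG 0) \<sigma>2"
        using i by (intro run_straight) (simp_all del: mult_Suc)
    qed simp
    then show "run n ask ?co (?Ti + 2) (\<lambda>\<sigma>''. ?I \<sigma>'' \<and> n - nmem \<sigma>'' nG 0 < n - nmem \<sigma>' nG 0) \<sigma>'"
      by (rule run_after) simp_all
  next
    fix \<sigma>' assume I: "?I \<sigma>'" and fr: "frame ?co ?\<sigma> \<sigma>'" and b: "\<not> bval ?bo \<sigma>'"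
    have env': "env n d s \<sigma>'" using env_frame[OF fr] env by simp
    with b I have "nmem \<sigma>' nG 0 = n" by (simp add: env_def)
    with I show "?J (n * ?D) \<sigma>'" by simp
  qed simp
  then have "run n ask build_com (build_time n d) (?J (n * ?D)) \<sigma>"
    unfolding build_com_def by (rule run_after) (simp_all add: build_time_def algebra_simps)
  then show ?thesis
  proof (rule run_conseq)
    fix \<sigma>' assume J: "?J (n * ?D) \<sigma>'"
    show "\<forall>i<n. query_mat fMATS ?D \<sigma>' i = op_mat ?D (act n d ?E (Suc i))"
    proof (intro allI impI eq_matI)
      fix i j k assume i: "i < n" and "j < dim_row (op_mat ?D (act n d ?E (Suc i)))"
        "k < dim_col (op_mat ?D (act n d ?E (Suc i)))"
      then have jk: "j < ?D" "k < ?D" by (simp_all add: op_mat_def)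
      have "(i + 1) * ?D \<le> n * ?D" using i by (intro mult_right_mono) auto
      then have "i * ?D + j < n * ?D" using jk by (simp add: algebra_simps)
      with J jk have "fmem \<sigma>' fMATS ((i * ?D + j) * ?D + k) =
          act n d ?E (Suc ((i * ?D + j) div ?D)) (unit_fun ((i * ?D + j) mod ?D)) k"
        unfolding rows_done_def by blast
      moreover have "(i * ?D + j) div ?D = i" "(i * ?D + j) mod ?D = j" using jk by simp_all
      ultimately show "query_mat fMATS ?D \<sigma>' i $$ (j, k) = op_mat ?D (act n d ?E (Suc i)) $$ (j, k)"
        using jk unfolding query_mat_def op_mat_def by simp
    qed (simp_all add: query_mat_def op_mat_def)
  qed simp
qed

section \<open>Sampling and testing the words not found yet\<close>

definition recorded :: "nat \<Rightarrow> nat \<Rightarrow> nat \<Rightarrow> (gword \<Rightarrow> 'a) \<Rightarrow> gword list \<Rightarrow> 'a::field machine \<Rightarrow> bool" where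
  "recorded n d m \<alpha> fs \<sigma> \<longleftrightarrow> nmem \<sigma> nFOUND 0 = length fs \<and> nmem \<sigma> nTOP 0 = Suc m \<and> m \<le> d \<and>
     set fs \<subseteq> reduced_words n \<and> (\<forall>q<length fs.
       stored n d (fs ! q) (\<lambda>t. nmem \<sigma> nWORDS (q * d + t)) \<and> fmem \<sigma> fCOEF q = \<alpha> (fs ! q))"

lemma recorded_cong:
  assumes "nmem \<sigma>' nFOUND = nmem \<sigma> nFOUND" "nmem \<sigma>' nTOP = nmem \<sigma> nTOP" "nmem \<sigma>' nWORDS = nmem \<sigma> nWORDS"
    "fmem \<sigma>' fCOEF = fmem \<sigma> fCOEF"
  shows "recorded n d m \<alpha> fs \<sigma>' = recorded n d m \<alpha> fs \<sigma>"
  using assms by (simp add: recorded_def)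

lemma recorded_frame:
  assumes "frame c \<sigma> \<sigma>'" "nwr c \<inter> {nFOUND, nTOP, nWORDS} = {}" "fCOEF \<notin> fwr c"
  shows "recorded n d m \<alpha> fs \<sigma>' = recorded n d m \<alpha> fs \<sigma>"
  by (rule recorded_cong) (use assms in \<open>auto intro!: frame_nmem frame_fmem\<close>)

lemma recorded_upd [simp]:
  "a \<notin> {nFOUND, nTOP, nWORDS} \<Longrightarrow> recorded n d m \<alpha> fs (set_nmem a i x \<sigma>) = recorded n d m \<alpha> fs \<sigma>"
  "a \<noteq> fCOEF \<Longrightarrow> recorded n d m \<alpha> fs (set_fmem a i y \<sigma>) = recorded n d m \<alpha> fs \<sigma>"
  by (rule recorded_cong; simp)+

lemma run_subtract_com:
  fixes \<sigma> :: "'a::field machine"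
  assumes env: "env n d s \<sigma>" and rec: "recorded n d m \<alpha> fs \<sigma>"
  shows "run n ask subtract_com (3 + length fs * (word_time d + 4)) (\<lambda>\<sigma>'. fmem \<sigma>' fVAL 0 = fmem \<sigma> fVAL 0 -
    (\<Sum>q<length fs. \<alpha> (fs ! q) * word_act n d (weight_at n \<sigma>) (fs ! q) (unit_fun 0) (4 * m))) \<sigma>"
proof -
  let ?E = "weight_at n \<sigma>"
  let ?S = "\<lambda>r. \<Sum>q<r. \<alpha> (fs ! q) * word_act n d ?E (fs ! q) (unit_fun 0) (4 * m)"
  let ?\<sigma> = "set_nmem nOFF 0 0 (set_nmem nQ 0 0 \<sigma>)"
  let ?b = "NLess (nv nQ) (nv nFOUND)"
  let ?u = "fset fVAL (FMinus (fv fVAL) (FTimes (FGet fCOEF (nv nQ)) (FGet fVEC (quadruple eTOP)))) ;;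
        ninc nQ 1 ;; nset nOFF (NPlus (nv nOFF) (nv nDEG))"
  let ?c = "word_com ;; ?u"
  let ?I = "\<lambda>\<sigma>'. nmem \<sigma>' nQ 0 \<le> length fs \<and> nmem \<sigma>' nOFF 0 = nmem \<sigma>' nQ 0 * d \<and>
    fmem \<sigma>' fVAL 0 = fmem \<sigma> fVAL 0 - ?S (nmem \<sigma>' nQ 0)"
  have "run n ask (While ?b ?c) (1 + length fs * (word_time d + 4))
    (\<lambda>\<sigma>'. fmem \<sigma>' fVAL 0 = fmem \<sigma> fVAL 0 - ?S (length fs)) ?\<sigma>"
  proof (rule run_While[where I = ?I and \<mu> = "\<lambda>\<sigma>'. length fs - nmem \<sigma>' nQ 0" and B = "word_time d + 3"])
    show "?I ?\<sigma>" by simp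
  next
    fix \<sigma>' assume I: "?I \<sigma>'" and fr: "frame ?c ?\<sigma> \<sigma>'" and b: "bval ?b \<sigma>'"
    have env': "env n d s \<sigma>'" using env_frame[OF fr] env by simp
    have wa: "weight_at n \<sigma>' = ?E" using weight_at_frame[OF fr] by simp
    have rec': "recorded n d m \<alpha> fs \<sigma>'" using recorded_frame[OF fr] rec by simp
    obtain q where q: "nmem \<sigma>' nQ 0 = q" "q < length fs" using b rec' by (auto simp: recorded_def)
    have w: "fs ! q \<in> reduced_words n" using rec' q by (auto simp: recorded_def)
    have st: "stored n d (fs ! q) (\<lambda>t. nmem \<sigma>' nWORDS (nmem \<sigma>' nOFF 0 + t))"
      using rec' q I by (simp add: recorded_def)
    show "run n ask ?c (word_time d + 3) (\<lambda>\<sigma>''. ?I \<sigma>'' \<and> length fs - nmem \<sigma>'' nQ 0 < length fs - nmem \<sigma>' nQ 0) \<sigma>'"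
    proof (rule run_SeqI[OF run_word_com[OF env' w st], where ?T2.0 = 3])
      fix \<sigma>1 assume fr1: "frame word_com \<sigma>' \<sigma>1"
        and v: "\<forall>x<4 * d + 2. fmem \<sigma>1 fVEC x = word_act n d (weight_at n \<sigma>') (fs ! q) (unit_fun 0) x"
      have rec1: "recorded n d m \<alpha> fs \<sigma>1" using recorded_frame[OF fr1] rec' by simp
      have env1: "env n d s \<sigma>1" using env_frame[OF fr1] env' by simp
      have eq: "nmem \<sigma>1 nQ 0 = q" "nmem \<sigma>1 nOFF 0 = q * d" "fmem \<sigma>1 fVAL 0 = fmem \<sigma> fVAL 0 - ?S q"
        "fmem \<sigma>1 fCOEF q = \<alpha> (fs ! q)" "nmem \<sigma>1 nTOP 0 = Suc m" "nmem \<sigma>1 nDEG 0 = d"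
        using frame_nmem[OF fr1, of nQ] frame_nmem[OF fr1, of nOFF] frame_fmem[OF fr1, of fVAL]
          I q rec1 env1 by (simp_all add: recorded_def env_def)
      have "m \<le> d" using rec by (simp add: recorded_def)
      then have v4: "fmem \<sigma>1 fVEC (m + m + (m + m)) = word_act n d ?E (fs ! q) (unit_fun 0) (4 * m)"
        using v wa by (simp add: mult_2[symmetric])
      show "run n ask ?u 3 (\<lambda>\<sigma>''. ?I \<sigma>'' \<and> length fs - nmem \<sigma>'' nQ 0 < length fs - nmem \<sigma>' nQ 0) \<sigma>1"
        using q by (intro run_straight) (simp_all add: eq v4 add.commute)
    qed simp
  next
    fix \<sigma>' assume I: "?I \<sigma>'" and fr: "frame ?c ?\<sigma> \<sigma>'" and b: "\<not> bval ?b \<sigma>'"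
    have "recorded n d m \<alpha> fs \<sigma>'" using recorded_frame[OF fr] rec by simp
    with b I have "nmem \<sigma>' nQ 0 = length fs" by (simp add: recorded_def)
    with I show "fmem \<sigma>' fVAL 0 = fmem \<sigma> fVAL 0 - ?S (length fs)" by simp
  qed simp
  then show ?thesis
    unfolding subtract_com_def by (rule run_after) simp_all
qed

definition sample_time :: "nat \<Rightarrow> nat \<Rightarrow> nat \<Rightarrow> nat" where
  "sample_time n d s = (3 + (d * (2 * n + 1)) * 3) + (build_time n d + ((1 + (n + 1) * (4 * d + 2) * (4 * d + 2)) +
     (1 + ((3 + s * (word_time d + 4)) + 2))))"

definition weight_ok :: "nat \<Rightarrow> nat \<Rightarrow> nat \<Rightarrow> 'a::field machine \<Rightarrow> bool" where
  "weight_ok n d k \<sigma> \<longleftrightarrow> (\<forall>t<d. \<forall>c \<le> 2 * n. weight_at n \<sigma> t c = weight n (prefix \<sigma>) (cell_power k) t c)"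

lemma prefix_cong:
  "nmem \<sigma>' nWORDS = nmem \<sigma> nWORDS \<Longrightarrow> nmem \<sigma>' nSLOT = nmem \<sigma> nSLOT \<Longrightarrow> prefix \<sigma>' = prefix \<sigma>"
  by (simp add: prefix_def fun_eq_iff)

lemma prefix_frame: "frame c \<sigma> \<sigma>' \<Longrightarrow> nwr c \<inter> {nWORDS, nSLOT} = {} \<Longrightarrow> prefix \<sigma>' = prefix \<sigma>"
  by (rule prefix_cong) (auto intro!: frame_nmem)

lemma weight_ok_word_act:
  "weight_ok n d k \<sigma> \<Longrightarrow> w \<in> reduced_words n \<Longrightarrow>
    word_act n d (weight_at n \<sigma>) w = word_act n d (weight n (prefix \<sigma>) (cell_power k)) w"
  by (rule word_act_cong) (auto simp: weight_ok_def)

text \<open>The query and the known words are evaluated under the same weights, so the subtraction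
  removes exactly the summands of \<open>fs\<close> and leaves those of the other words.\<close>

lemma run_sample_com:
  fixes \<sigma> :: "'a::field_char_0 machine"
  assumes env: "env n d s \<sigma>" and rec: "recorded n d m (Poly_Mapping.lookup f) fs \<sigma>"
    and f: "f \<in> free_group_algebra n" and fs: "set fs \<subseteq> Poly_Mapping.keys f" "distinct fs" "length fs \<le> s"
    and k: "nmem \<sigma> nK 0 = k" "fmem \<sigma> fZ 0 = 2 ^ k"
  shows "run n (black_box f) sample_com (sample_time n d s) (\<lambda>\<sigma>'. nmem \<sigma>' nK 0 = Suc k \<and> fmem \<sigma>' fZ 0 = 2 ^ Suc k \<and>
    weight_ok n d k \<sigma>' \<and>
    fmem \<sigma>' fVAL 0 = test_value n d m (prefix \<sigma>) (Poly_Mapping.lookup f) (Poly_Mapping.keys f - set fs) k) \<sigma>"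
proof -
  let ?D = "4 * d + 2" and ?\<alpha> = "Poly_Mapping.lookup f" and ?K = "Poly_Mapping.keys f"
  let ?Q = "\<lambda>\<sigma>'. nmem \<sigma>' nK 0 = Suc k \<and> fmem \<sigma>' fZ 0 = 2 ^ Suc k \<and> weight_ok n d k \<sigma>' \<and>
    fmem \<sigma>' fVAL 0 = test_value n d m (prefix \<sigma>) ?\<alpha> (?K - set fs) k"
  let ?c6 = "ninc nK 1 ;; fset fZ (FPlus (fv fZ) (fv fZ))"
  let ?c4 = "fset fVAL (FGet fANS (quadruple eTOP))"
  have m: "m \<le> d" using rec by (simp add: recorded_def)
  show ?thesis
    unfolding sample_com_def sample_time_def
  proof (rule run_SeqI[OF run_fill_com[OF env]])
    fix \<sigma>1 assume fr1: "frame fill_com \<sigma> \<sigma>1"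
      and z: "\<forall>i \<le> d * (2 * n + 1). fmem \<sigma>1 fCELLS i = fmem \<sigma> fZ 0 ^ 2 ^ i"
    have env1: "env n d s \<sigma>1" using env_frame[OF fr1] env by simp
    have rec1: "recorded n d m ?\<alpha> fs \<sigma>1" using recorded_frame[OF fr1] rec by simp
    have pre1: "prefix \<sigma>1 = prefix \<sigma>" using prefix_frame[OF fr1] by simp
    have k1: "nmem \<sigma>1 nK 0 = k" "fmem \<sigma>1 fZ 0 = 2 ^ k"
      using frame_nmem[OF fr1, of nK] frame_fmem[OF fr1, of fZ] k by simp_all
    let ?E = "weight_at n \<sigma>1"
    have ok1: "weight_ok n d k \<sigma>1"
      unfolding weight_ok_def
    proof (intro allI impI)
      fix t c assume t: "t < d" and c: "c \<le> 2 * n"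
      \<comment> \<open>The block of a position \<open>t < d\<close> ends within the cells that have
        been filled.\<close>
      have "t * (2 * n + 1) + (2 * n + 1) \<le> d * (2 * n + 1)"
        using mult_right_mono[of "t + 1" d "2 * n + 1"] t by simp
      then have "t * (2 * n + 1) + c \<le> d * (2 * n + 1)" using c by linarith
      with z show "?E t c = weight n (prefix \<sigma>1) (cell_power k) t c"
        unfolding weight_at_def weight_def cell_power_def k(2) by simp
    qed
    have E: "word_act n d ?E w = word_act n d (weight n (prefix \<sigma>) (cell_power k)) w" if "w \<in> ?K" for w
      using weight_ok_word_act[OF ok1, of w] f that pre1 by (auto simp: free_group_algebra_def)
    show "run n (black_box f) (build_com ;; Query fMATS (nv nDIM) fANS ;; ?c4 ;; subtract_com ;; ?c6)
      (build_time n d + ((1 + (n + 1) * ?D * ?D) + (1 + ((3 + s * (word_time d + 4)) + 2)))) ?Q \<sigma>1"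
    proof (rule run_SeqI[OF run_build_com[OF env1]])
      fix \<sigma>2 assume fr2: "frame build_com \<sigma>1 \<sigma>2"
        and q: "\<forall>i<n. query_mat fMATS ?D \<sigma>2 i = op_mat ?D (act n d ?E (Suc i))"
      have env2: "env n d s \<sigma>2" using env_frame[OF fr2] env1 by simp
      then have D: "?D = nval (nv nDIM) \<sigma>2" by (simp add: env_def)
      have inv: "invertible_mat (query_mat fMATS ?D \<sigma>2 i)" if "i < n" for i
        by (rule act_mat_invertible[OF refl _ that, of _ d ?E]) (use q in simp)
      define M where "M = black_box f ?D (query_mat fMATS ?D \<sigma>2)"
      show "run n (black_box f) (Query fMATS (nv nDIM) fANS ;; ?c4 ;; subtract_com ;; ?c6)
        ((1 + (n + 1) * ?D * ?D) + (1 + ((3 + s * (word_time d + 4)) + 2))) ?Q \<sigma>2"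
      proof (rule run_SeqI)
        show "run n (black_box f) (Query fMATS (nv nDIM) fANS) (1 + (n + 1) * ?D * ?D)
          (\<lambda>\<sigma>'. \<sigma>' = store_mat fANS ?D M \<sigma>2) \<sigma>2"
          by (rule run_Query[OF D _ inv]) (simp_all add: M_def)
      next
        fix \<sigma>3 assume fr3: "frame (Query fMATS (nv nDIM) fANS) \<sigma>2 \<sigma>3" and s3: "\<sigma>3 = store_mat fANS ?D M \<sigma>2"
        let ?v = "\<Sum>w\<in>?K. ?\<alpha> w * word_act n d ?E w (unit_fun 0) (4 * m)"
        let ?\<sigma>4 = "set_fmem fVAL 0 ?v \<sigma>3"
        have env3: "env n d s \<sigma>3" using env_frame[OF fr3] env2 by simp
        have rec3: "recorded n d m ?\<alpha> fs \<sigma>3"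
          using recorded_frame[OF fr3] recorded_frame[OF fr2] rec1 by simp
        have wa3: "weight_at n \<sigma>3 = ?E" using weight_at_frame[OF fr3] weight_at_frame[OF fr2] by simp
        have pre3: "prefix \<sigma>3 = prefix \<sigma>" using prefix_frame[OF fr3] prefix_frame[OF fr2] pre1 by simp
        have k3: "nmem \<sigma>3 nK 0 = k" "fmem \<sigma>3 fZ 0 = 2 ^ k"
          using frame_nmem[OF fr3, of nK] frame_nmem[OF fr2, of nK] frame_fmem[OF fr3, of fZ]
            frame_fmem[OF fr2, of fZ] k1 by simp_all
        have quad: "m + m + (m + m) = 4 * m" by simp
        \<comment> \<open>An index below the dimension lies in row \<open>0\<close> of the stored
          answer, where it is also the column.\<close>
        have lt: "4 * m < ?D" using m by simp
        also have "\<dots> \<le> ?D * ?D" by (rule le_square)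
        finally have "fmem \<sigma>3 fANS (m + m + (m + m)) = M $$ (0, 4 * m)"
          unfolding quad using lt by (simp add: s3 store_mat_def)
        also have "\<dots> = ?v"
          unfolding M_def by (rule black_box_act[OF refl _ f lt]) (use q in simp)
        finally have ans: "fmem \<sigma>3 fANS (m + m + (m + m)) = ?v" .
        \<comment> \<open>The words of \<open>fs\<close> are distinct, so the sum over their indices
          is a sum over a subset of the words of \<open>f\<close>.\<close>
        have tv: "?v - (\<Sum>q<length fs. ?\<alpha> (fs ! q) * word_act n d ?E (fs ! q) (unit_fun 0) (4 * m)) =
          test_value n d m (prefix \<sigma>) ?\<alpha> (?K - set fs) k"
        proof -
          have "(\<Sum>q<length fs. ?\<alpha> (fs ! q) * word_act n d ?E (fs ! q) (unit_fun 0) (4 * m)) =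
              (\<Sum>w\<in>set fs. ?\<alpha> w * word_act n d ?E w (unit_fun 0) (4 * m))"
            by (rule sum.reindex_bij_betw) (use bij_betw_nth[OF fs(2) refl refl] in simp)
          then have "?v - (\<Sum>q<length fs. ?\<alpha> (fs ! q) * word_act n d ?E (fs ! q) (unit_fun 0) (4 * m)) =
              (\<Sum>w\<in>?K - set fs. ?\<alpha> w * word_act n d ?E w (unit_fun 0) (4 * m))"
            using sum_diff[of ?K "set fs" "\<lambda>w. ?\<alpha> w * word_act n d ?E w (unit_fun 0) (4 * m)"] fs(1) by simp
          also have "\<dots> = test_value n d m (prefix \<sigma>) ?\<alpha> (?K - set fs) k"
            unfolding test_value_def by (rule sum.cong) (simp_all add: E)
          finally show ?thesis .
        qed
        have "run n (black_box f) (subtract_com ;; ?c6) ((3 + s * (word_time d + 4)) + 2) ?Q ?\<sigma>4"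
        proof (rule run_SeqI[OF run_subtract_com[where d = d and s = s and fs = fs and m = m and \<alpha> = ?\<alpha>], where ?T2.0 = 2])
          fix \<sigma>5 assume fr5: "frame subtract_com ?\<sigma>4 \<sigma>5"
            and v5: "fmem \<sigma>5 fVAL 0 = fmem ?\<sigma>4 fVAL 0 - (\<Sum>q<length fs. ?\<alpha> (fs ! q) *
              word_act n d (weight_at n ?\<sigma>4) (fs ! q) (unit_fun 0) (4 * m))"
          have k5: "nmem \<sigma>5 nK 0 = k" "fmem \<sigma>5 fZ 0 = 2 ^ k"
            using frame_nmem[OF fr5, of nK] frame_fmem[OF fr5, of fZ] k3 by simp_all
          have "weight_at n \<sigma>5 = ?E" using weight_at_frame[OF fr5] wa3 by simp
          moreover have "prefix \<sigma>5 = prefix \<sigma>1"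
            using prefix_frame[OF fr5] prefix_cong[of ?\<sigma>4 \<sigma>3] pre3 pre1 by simp
          ultimately have ok5: "weight_ok n d k \<sigma>5" using ok1 by (simp add: weight_ok_def)
          let ?\<sigma>6 = "set_fmem fZ 0 (2 ^ Suc k) (set_nmem nK 0 (Suc k) \<sigma>5)"
          have "prefix ?\<sigma>6 = prefix \<sigma>5" by (rule prefix_cong) simp_all
          then have "weight_ok n d k ?\<sigma>6" using ok5 by (simp add: weight_ok_def)
          then have Q: "?Q ?\<sigma>6" using v5 tv wa3 by simp
          have "eff ?c6 \<sigma>5 = ?\<sigma>6" by (simp add: k5)
          then show "run n (black_box f) ?c6 2 ?Q \<sigma>5" using Q by (intro run_straight) (simp_all only:, simp_all)
        qed (use env3 rec3 fs(3) in simp_all)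
        then show "run n (black_box f) (?c4 ;; subtract_com ;; ?c6) (1 + ((3 + s * (word_time d + 4)) + 2)) ?Q \<sigma>3"
          by (rule run_after) (use rec3 ans in \<open>simp_all add: recorded_def\<close>)
      qed simp
    qed simp
  qed simp
qed

definition test_time :: "nat \<Rightarrow> nat \<Rightarrow> nat \<Rightarrow> nat" where
  "test_time n d s = 4 + s * (sample_time n d s + 1)"

text \<open>A zero result certifies all \<open>s\<close> samples at once. A nonzero result comes
  with its sample: value and weights in memory belong to the same \<open>k\<close>, as the later
  division requires.\<close>

lemma run_test_com:
  fixes \<sigma> :: "'a::field_char_0 machine"
  assumes env: "env n d s \<sigma>" and rec: "recorded n d m (Poly_Mapping.lookup f) fs \<sigma>"
    and f: "f \<in> free_group_algebra n" and fs: "set fs \<subseteq> Poly_Mapping.keys f" "distinct fs" "length fs \<le> s"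
  defines "tv \<equiv> test_value n d m (prefix \<sigma>) (Poly_Mapping.lookup f) (Poly_Mapping.keys f - set fs)"
  shows "run n (black_box f) test_com (test_time n d s) (\<lambda>\<sigma>'.
    (fmem \<sigma>' fVAL 0 = 0 \<longrightarrow> (\<forall>k<s. tv k = 0)) \<and>
    (fmem \<sigma>' fVAL 0 \<noteq> 0 \<longrightarrow> (\<exists>k. fmem \<sigma>' fVAL 0 = tv k \<and> weight_ok n d k \<sigma>'))) \<sigma>"
proof -
  let ?b = "BAnd (NLess (nv nK) (nv nSPARSE)) (FEq (fv fVAL) FZero)"
  let ?\<sigma> = "set_fmem fZ 0 1 (set_nmem nK 0 0 (set_fmem fVAL 0 0 \<sigma>))"
  let ?R = "\<lambda>\<sigma>'. fmem \<sigma>' fVAL 0 \<noteq> 0 \<longrightarrow> (\<exists>k. fmem \<sigma>' fVAL 0 = tv k \<and> weight_ok n d k \<sigma>')"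
  let ?I = "\<lambda>\<sigma>'. nmem \<sigma>' nK 0 \<le> s \<and> fmem \<sigma>' fZ 0 = 2 ^ nmem \<sigma>' nK 0 \<and> ?R \<sigma>' \<and>
    (fmem \<sigma>' fVAL 0 = 0 \<longrightarrow> (\<forall>k<nmem \<sigma>' nK 0. tv k = 0))"
  have "run n (black_box f) (While ?b sample_com) (1 + s * (sample_time n d s + 1))
    (\<lambda>\<sigma>'. (fmem \<sigma>' fVAL 0 = 0 \<longrightarrow> (\<forall>k<s. tv k = 0)) \<and> ?R \<sigma>') ?\<sigma>"
  proof (rule run_While[where I = ?I and \<mu> = "\<lambda>\<sigma>'. s - nmem \<sigma>' nK 0" and B = "sample_time n d s"])
    fix \<sigma>' assume I: "?I \<sigma>'" and fr: "frame sample_com ?\<sigma> \<sigma>'" and b: "bval ?b \<sigma>'"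
    have env': "env n d s \<sigma>'" using env_frame[OF fr] env by simp
    have rec': "recorded n d m (Poly_Mapping.lookup f) fs \<sigma>'" using recorded_frame[OF fr] rec by simp
    have pre: "prefix \<sigma>' = prefix \<sigma>" using prefix_frame[OF fr] prefix_cong[of ?\<sigma> \<sigma>] by simp
    obtain k where k: "nmem \<sigma>' nK 0 = k" "k < s" "fmem \<sigma>' fVAL 0 = 0" using b env' by (auto simp: env_def)
    have z: "fmem \<sigma>' fZ 0 = 2 ^ k" using I k by simp
    show "run n (black_box f) sample_com (sample_time n d s) (\<lambda>\<sigma>''. ?I \<sigma>'' \<and> s - nmem \<sigma>'' nK 0 < s - nmem \<sigma>' nK 0) \<sigma>'"
    proof (rule run_conseq[OF run_sample_com[OF env' rec' f fs k(1) z]])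
      fix \<sigma>'' :: "'a machine"
      assume "nmem \<sigma>'' nK 0 = Suc k \<and> fmem \<sigma>'' fZ 0 = 2 ^ Suc k \<and> weight_ok n d k \<sigma>'' \<and>
        fmem \<sigma>'' fVAL 0 = test_value n d m (prefix \<sigma>') (Poly_Mapping.lookup f) (Poly_Mapping.keys f - set fs) k"
      with I k show "?I \<sigma>'' \<and> s - nmem \<sigma>'' nK 0 < s - nmem \<sigma>' nK 0"
        unfolding pre tv_def[symmetric] by (auto simp: less_Suc_eq)
    qed simp
  next
    fix \<sigma>' assume I: "?I \<sigma>'" and fr: "frame sample_com ?\<sigma> \<sigma>'" and b: "\<not> bval ?b \<sigma>'"
    have env': "env n d s \<sigma>'" using env_frame[OF fr] env by simp
    with b I show "(fmem \<sigma>' fVAL 0 = 0 \<longrightarrow> (\<forall>k<s. tv k = 0)) \<and> ?R \<sigma>'"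
      by (auto simp: env_def)
  qed simp_all
  then show ?thesis
    unfolding test_com_def by (rule run_after) (simp_all add: test_time_def)
qed

definition record_time :: "nat \<Rightarrow> nat" where "record_time d = 8 + word_time d + d * 6"

text \<open>Dividing by the entry of \<open>w\<close> under the weights left in memory isolates
  \<open>\<alpha>\<close>. Moving the slot pointer by \<open>d\<close> turns the finished prefix
  into a stored word.\<close>

lemma run_record_com:
  fixes \<sigma> :: "'a::field machine"
  assumes env: "env n d s \<sigma>" and top: "nmem \<sigma> nTOP 0 = Suc (length w)" and cur: "cur_word \<sigma> = []"
    and w: "w \<in> reduced_words n" and st: "stored n d w (prefix \<sigma>)"
    and val: "fmem \<sigma> fVAL 0 = \<alpha> * word_act n d (weight_at n \<sigma>) w (unit_fun 0) (4 * length w)"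
    and nz: "word_act n d (weight_at n \<sigma>) w (unit_fun 0) (4 * length w) \<noteq> 0"
  defines "r \<equiv> nmem \<sigma> nFOUND 0"
  shows "run n ask record_com (record_time d) (\<lambda>\<sigma>'. nmem \<sigma>' nFOUND 0 = Suc r \<and>
    nmem \<sigma>' nSLOT 0 = nmem \<sigma> nSLOT 0 + d \<and> nmem \<sigma>' nPOS 0 = 0 \<and> fmem \<sigma>' fCOEF = (fmem \<sigma> fCOEF)(r := \<alpha>) \<and>
    cur_word \<sigma>' = [] \<and> out_terms \<sigma>' = out_terms \<sigma> @ [(w, \<alpha>)]) \<sigma>"
proof -
  let ?Q = "\<lambda>\<sigma>'. nmem \<sigma>' nFOUND 0 = Suc r \<and>
    nmem \<sigma>' nSLOT 0 = nmem \<sigma> nSLOT 0 + d \<and> nmem \<sigma>' nPOS 0 = 0 \<and> fmem \<sigma>' fCOEF = (fmem \<sigma> fCOEF)(r := \<alpha>) \<and>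
    cur_word \<sigma>' = [] \<and> out_terms \<sigma>' = out_terms \<sigma> @ [(w, \<alpha>)]"
  let ?m = "length w" and ?o = "nmem \<sigma> nSLOT 0"
  let ?\<sigma> = "set_nmem nOFF 0 ?o \<sigma>"
  let ?c2 = "FSet fCOEF (nv nFOUND) (FDivide (fv fVAL) (FGet fVEC (quadruple eTOP))) ;; nset nL (NConst 0)"
  let ?b = "NLess (nv nL) eTOP"
  let ?c = "nset nCODE (NGet nWORDS (NPlus (nv nOFF) (nv nL))) ;;
       com.If (NLess (nv nCODE) (NPlus (nv nGEN) (NConst 1)))
         (EmitLetter (NMinus (nv nCODE) (NConst 1)) (NConst 0))
         (EmitLetter (NMinus (NMinus (nv nCODE) (NConst 1)) (nv nGEN)) (NConst 1)) ;;
       ninc nL 1"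
  let ?c4 = "EmitTerm (FGet fCOEF (nv nFOUND)) ;;
     ninc nFOUND 1 ;; nset nSLOT (NPlus (nv nSLOT) (nv nDEG)) ;; nset nPOS (NConst 0)"
  have lw: "?m \<le> d" using st by (simp add: stored_def)
  have st': "stored n d w (\<lambda>t. nmem ?\<sigma> nWORDS (nmem ?\<sigma> nOFF 0 + t))"
    using st by (simp add: prefix_def[abs_def])
  have env': "env n d s ?\<sigma>" using env by simp
  have "run n ask (word_com ;; ?c2 ;; While ?b ?c ;; ?c4) (word_time d + (2 + ((1 + d * 6) + 4))) ?Q ?\<sigma>"
  proof (rule run_SeqI[OF run_word_com[OF env' w st']])
    fix \<sigma>1 assume fr1: "frame word_com ?\<sigma> \<sigma>1"
      and v: "\<forall>x<4 * d + 2. fmem \<sigma>1 fVEC x = word_act n d (weight_at n ?\<sigma>) w (unit_fun 0) x"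
    have env1: "env n d s \<sigma>1" using env_frame[OF fr1] env by simp
    have v4: "fmem \<sigma>1 fVEC (?m + ?m + (?m + ?m)) = word_act n d (weight_at n \<sigma>) w (unit_fun 0) (4 * ?m)"
      using v lw by (simp add: mult_2[symmetric])
    have eq1: "nmem \<sigma>1 nTOP 0 = Suc ?m" "nmem \<sigma>1 nFOUND 0 = r" "nmem \<sigma>1 nSLOT 0 = ?o" "nmem \<sigma>1 nOFF 0 = ?o"
        "nmem \<sigma>1 nWORDS = nmem \<sigma> nWORDS" "fmem \<sigma>1 fVAL = fmem \<sigma> fVAL" "fmem \<sigma>1 fCOEF = fmem \<sigma> fCOEF"
        "cur_word \<sigma>1 = []" "out_terms \<sigma>1 = out_terms \<sigma>"
      using frame_nmem[OF fr1, of nTOP] frame_nmem[OF fr1, of nFOUND] frame_nmem[OF fr1, of nSLOT]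
        frame_nmem[OF fr1, of nOFF] frame_nmem[OF fr1, of nWORDS] frame_fmem[OF fr1, of fVAL]
        frame_fmem[OF fr1, of fCOEF] frame_out[OF fr1] cur top by (simp_all add: r_def)
    let ?\<sigma>2 = "set_nmem nL 0 0 (set_fmem fCOEF r \<alpha> \<sigma>1)"
    have "run n ask (While ?b ?c ;; ?c4) ((1 + d * 6) + 4) ?Q ?\<sigma>2"
    proof (rule run_SeqI[where ?T2.0 = 4])
      let ?I = "\<lambda>\<sigma>'. nmem \<sigma>' nL 0 \<le> ?m \<and> cur_word \<sigma>' = take (nmem \<sigma>' nL 0) w \<and> out_terms \<sigma>' = out_terms \<sigma>"
      show "run n ask (While ?b ?c) (1 + d * 6) (\<lambda>\<sigma>'. cur_word \<sigma>' = w \<and> out_terms \<sigma>' = out_terms \<sigma>) ?\<sigma>2"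
      proof (rule run_While[where I = ?I and \<mu> = "\<lambda>\<sigma>'. ?m - nmem \<sigma>' nL 0" and B = 5])
        show "?I ?\<sigma>2" using eq1 by simp
      next
        fix \<sigma>' assume I: "?I \<sigma>'" and fr: "frame ?c ?\<sigma>2 \<sigma>'" and b: "bval ?b \<sigma>'"
        have eq: "nmem \<sigma>' nTOP 0 = Suc ?m" "nmem \<sigma>' nOFF 0 = ?o" "nmem \<sigma>' nWORDS = nmem \<sigma> nWORDS"
          using frame_nmem[OF fr, of nTOP] frame_nmem[OF fr, of nOFF] frame_nmem[OF fr, of nWORDS] eq1 by simp_all
        have gen: "nmem \<sigma>' nGEN 0 = n" using frame_nmem[OF fr, of nGEN] env1 by (simp add: env_def)
        obtain l where l: "nmem \<sigma>' nL 0 = l" "l < ?m" using b eq by auto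
        have x: "nmem \<sigma> nWORDS (?o + l) = code n (w ! l)"
          using st l lw by (simp add: stored_def prefix_def)
        obtain i e where ie: "w ! l = (i, e)" "i < n" using reduced_words_nth[OF w l(2)] by (cases "w ! l") auto
        have snoc: "take (Suc l) w = take l w @ [(i, e)]" using l ie by (simp add: take_Suc_conv_app_nth)
        show "run n ask ?c 5 (\<lambda>\<sigma>''. ?I \<sigma>'' \<and> ?m - nmem \<sigma>'' nL 0 < ?m - nmem \<sigma>' nL 0) \<sigma>'"
          using I l ie by (intro run_straight) (auto simp: eq gen x code_def snoc)
      next
        fix \<sigma>' assume I: "?I \<sigma>'" and fr: "frame ?c ?\<sigma>2 \<sigma>'" and b: "\<not> bval ?b \<sigma>'"
        have "nmem \<sigma>' nTOP 0 = Suc ?m" using frame_nmem[OF fr, of nTOP] eq1 by simp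
        with b I show "cur_word \<sigma>' = w \<and> out_terms \<sigma>' = out_terms \<sigma>" by simp
      qed (use lw in simp)
    next
      fix \<sigma>3 assume fr3: "frame (While ?b ?c) ?\<sigma>2 \<sigma>3" and o: "cur_word \<sigma>3 = w \<and> out_terms \<sigma>3 = out_terms \<sigma>"
      have "env n d s \<sigma>3" using env_frame[OF fr3] env1 by simp
      then have "nmem \<sigma>3 nDEG 0 = d" by (simp add: env_def)
      moreover have "nmem \<sigma>3 nFOUND 0 = r" "nmem \<sigma>3 nSLOT 0 = ?o" "fmem \<sigma>3 fCOEF = (fmem \<sigma> fCOEF)(r := \<alpha>)"
        using frame_nmem[OF fr3, of nFOUND] frame_nmem[OF fr3, of nSLOT] frame_fmem[OF fr3, of fCOEF] eq1
        by simp_all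
      ultimately show "run n ask ?c4 4 ?Q \<sigma>3" using o by (intro run_straight) simp_all
    qed simp
    then show "run n ask (?c2 ;; While ?b ?c ;; ?c4) (2 + ((1 + d * 6) + 4)) ?Q \<sigma>1"
      by (rule run_after) (use nz in \<open>simp_all add: eq1 v4 val\<close>)
  qed simp
  then show ?thesis
    unfolding record_com_def by (rule run_after) (simp_all add: record_time_def)
qed

section \<open>The search for the remaining words and its potential\<close>

definition progress :: "nat \<Rightarrow> 'a machine \<Rightarrow> nat" where
  "progress n \<sigma> = (if nmem \<sigma> nPOS 0 = 0 then 0
     else (nmem \<sigma> nPOS 0 - 1) * (2 * n + 1) + prefix \<sigma> (nmem \<sigma> nPOS 0 - 1))"

text \<open>Progress reads prefix length and last letter as one number of at most
  \<open>d * (2 * n + 1)\<close>, which grows with every letter tried or appended. Recording a word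
  resets it to \<open>0\<close>, so a word is worth one unit more than that range. A failed test at
  the empty prefix is paid for by \<open>nTOP\<close>. The initial value bounds the number of steps
  polynomially.\<close>

definition potential :: "nat \<Rightarrow> nat \<Rightarrow> nat \<Rightarrow> 'a machine \<Rightarrow> nat" where
  "potential n d s \<sigma> = (s - nmem \<sigma> nFOUND 0) * (d * (2 * n + 1) + 1) +
     (d * (2 * n + 1) - progress n \<sigma>) + nmem \<sigma> nTOP 0"

text \<open>The last letter of a nonempty prefix may lag behind that of some remaining word; all earlier
  letters are known to be right.\<close>

definition search_inv :: "nat \<Rightarrow> nat \<Rightarrow> nat \<Rightarrow> (gword \<Rightarrow>\<^sub>0 'a) \<Rightarrow> gword list \<Rightarrow> 'a::field machine \<Rightarrow> bool" where
  "search_inv n d s f fs \<sigma> \<longleftrightarrow> env n d s \<sigma> \<and> cur_word \<sigma> = [] \<and>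
     out_terms \<sigma> = map (\<lambda>w. (w, Poly_Mapping.lookup f w)) fs \<and> distinct fs \<and> set fs \<subseteq> Poly_Mapping.keys f \<and>
     nmem \<sigma> nFOUND 0 = length fs \<and> nmem \<sigma> nSLOT 0 = length fs * d \<and> nmem \<sigma> nTOP 0 \<le> Suc d \<and>
     (\<forall>w \<in> Poly_Mapping.keys f - set fs. length w < nmem \<sigma> nTOP 0) \<and>
     (\<forall>q<length fs. stored n d (fs ! q) (\<lambda>t. nmem \<sigma> nWORDS (q * d + t)) \<and>
       fmem \<sigma> fCOEF q = Poly_Mapping.lookup f (fs ! q)) \<and>
     nmem \<sigma> nPOS 0 \<le> nmem \<sigma> nTOP 0 - 1 \<and> (\<forall>t < nmem \<sigma> nPOS 0. 0 < prefix \<sigma> t) \<and>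
     (\<forall>t \<ge> nmem \<sigma> nPOS 0. prefix \<sigma> t = 0) \<and>
     (0 < nmem \<sigma> nPOS 0 \<longrightarrow> (\<exists>w \<in> Poly_Mapping.keys f - set fs. length w = nmem \<sigma> nTOP 0 - 1 \<and>
        (\<forall>t < nmem \<sigma> nPOS 0 - 1. prefix \<sigma> t = code n (w ! t)) \<and>
        prefix \<sigma> (nmem \<sigma> nPOS 0 - 1) \<le> code n (w ! (nmem \<sigma> nPOS 0 - 1))))"

lemma search_inv_frame:
  assumes "frame c \<sigma> \<sigma>'" "nwr c \<inter> {nGEN, nDEG, nSPARSE, nDIM, nROWS, nWORDS, nFOUND, nSLOT, nTOP, nPOS} = {}"
    "fwr c \<inter> {fNUMS, fCOEF} = {}" "quiet c"
  shows "search_inv n d s f fs \<sigma>' = search_inv n d s f fs \<sigma>" "potential n d s \<sigma>' = potential n d s \<sigma>"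
proof -
  have "nmem \<sigma>' nWORDS = nmem \<sigma> nWORDS" "nmem \<sigma>' nFOUND = nmem \<sigma> nFOUND" "nmem \<sigma>' nSLOT = nmem \<sigma> nSLOT"
    "nmem \<sigma>' nTOP = nmem \<sigma> nTOP" "nmem \<sigma>' nPOS = nmem \<sigma> nPOS" "fmem \<sigma>' fCOEF = fmem \<sigma> fCOEF"
    using assms by (auto intro!: frame_nmem[OF assms(1)] frame_fmem[OF assms(1)])
  moreover have "env n d s \<sigma>' = env n d s \<sigma>" using assms by (intro env_frame) auto
  moreover have "prefix \<sigma>' = prefix \<sigma>" using assms by (intro prefix_frame) auto
  moreover note frame_out[OF assms(1,4)]
  ultimately show "search_inv n d s f fs \<sigma>' = search_inv n d s f fs \<sigma>"
    "potential n d s \<sigma>' = potential n d s \<sigma>"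
    by (simp_all add: search_inv_def potential_def progress_def)
qed

lemma prefix_upd:
  "prefix (set_nmem nWORDS (nmem \<sigma> nSLOT 0 + j) x \<sigma>) = (prefix \<sigma>)(j := x)"
  "a \<notin> {nWORDS, nSLOT} \<Longrightarrow> prefix (set_nmem a i x \<sigma>) = prefix \<sigma>"
  by (auto simp: prefix_def fun_eq_iff)

text \<open>The slots of earlier words end before slot \<open>r\<close> begins.\<close>

lemma stored_upd:
  assumes "q < r"
  shows "stored n d w (\<lambda>t. ((nmem \<sigma> nWORDS)(r * d + j := x)) (q * d + t)) =
    stored n d w (\<lambda>t. nmem \<sigma> nWORDS (q * d + t))"
proof -
  have "q * d + t \<noteq> r * d + j" if "t < d" for t
  proof -
    have "(q + 1) * d \<le> r * d" using assms by (intro mult_right_mono) auto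
    with that show ?thesis by simp
  qed
  then show ?thesis by (simp add: stored_def)
qed

text \<open>Some remaining word bounds the last letter from above, so this letter is at most
  \<open>2 * n\<close>. Hence the truncated subtraction in \<open>potential\<close> loses
  nothing.\<close>

lemma progress_le:
  assumes "search_inv n d s f fs \<sigma>" and f: "f \<in> free_group_algebra n"
  shows "progress n \<sigma> \<le> d * (2 * n + 1)"
proof (cases "nmem \<sigma> nPOS 0")
  case (Suc j)
  then obtain w where w: "w \<in> Poly_Mapping.keys f" "length w = nmem \<sigma> nTOP 0 - 1" "prefix \<sigma> j \<le> code n (w ! j)"
    using assms by (auto simp: search_inv_def)
  have j: "j < length w" "length w \<le> d" using assms Suc w by (auto simp: search_inv_def)
  have "fst (w ! j) < n" using f w j by (intro reduced_words_nth[of w]) (auto simp: free_group_algebra_def)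
  then have "prefix \<sigma> j \<le> 2 * n" using code_bounds w(3) le_trans by blast
  moreover have "(j + 1) * (2 * n + 1) \<le> d * (2 * n + 1)" using j by (intro mult_right_mono) auto
  ultimately show ?thesis using Suc by (simp add: progress_def)
qed (simp add: progress_def)

lemma search_matches_iff:
  assumes "search_inv n d s f fs \<sigma>" "nmem \<sigma> nTOP 0 = Suc m" "w \<in> Poly_Mapping.keys f - set fs"
  shows "matches n m (prefix \<sigma>) w \<longleftrightarrow>
    length w = m \<and> (\<forall>t<nmem \<sigma> nPOS 0. prefix \<sigma> t = code n (w ! t))"
proof -
  have "nmem \<sigma> nPOS 0 \<le> m" "\<And>t. t < nmem \<sigma> nPOS 0 \<Longrightarrow> prefix \<sigma> t \<noteq> 0"
    "\<And>t. nmem \<sigma> nPOS 0 \<le> t \<Longrightarrow> prefix \<sigma> t = 0"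
    using assms by (auto simp: search_inv_def)
  then show ?thesis unfolding matches_def by (metis le_less_linear less_le_trans)
qed

text \<open>The word that bounds the last letter agrees with all earlier letters. As it does not
  match, its code there is strictly larger; so it remains a witness after the increment, which
  therefore never leaves the alphabet.\<close>

lemma search_advance:
  assumes inv: "search_inv n d s f fs \<sigma>" and f: "f \<in> free_group_algebra n" and m: "nmem \<sigma> nTOP 0 = Suc m"
    and no: "\<And>w. w \<in> Poly_Mapping.keys f - set fs \<Longrightarrow> \<not> matches n m (prefix \<sigma>) w"
    and j: "nmem \<sigma> nPOS 0 = Suc j"
  defines "\<sigma>' \<equiv> set_nmem nWORDS (nmem \<sigma> nSLOT 0 + j) (Suc (prefix \<sigma> j)) \<sigma>"
  shows "search_inv n d s f fs \<sigma>' \<and> potential n d s \<sigma>' < potential n d s \<sigma>"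
proof -
  obtain w where w: "w \<in> Poly_Mapping.keys f - set fs" "length w = m"
    "\<forall>t<j. prefix \<sigma> t = code n (w ! t)" "prefix \<sigma> j \<le> code n (w ! j)"
    using inv m j by (auto simp: search_inv_def)
  have "prefix \<sigma> j \<noteq> code n (w ! j)"
    using no[OF w(1)] w search_matches_iff[OF inv m w(1)] j by (auto simp: less_Suc_eq)
  with w have lt: "prefix \<sigma> j < code n (w ! j)" by simp
  have env: "env n d s \<sigma>'" using inv by (simp add: \<sigma>'_def search_inv_def)
  have p: "prefix \<sigma>' = (prefix \<sigma>)(j := Suc (prefix \<sigma> j))" unfolding \<sigma>'_def by (rule prefix_upd)
  have slot: "nmem \<sigma> nSLOT 0 = length fs * d" using inv by (simp add: search_inv_def)
  have sel: "nmem \<sigma>' nPOS 0 = Suc j" "nmem \<sigma>' nTOP = nmem \<sigma> nTOP" "nmem \<sigma>' nFOUND = nmem \<sigma> nFOUND"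
    "nmem \<sigma>' nSLOT = nmem \<sigma> nSLOT" "fmem \<sigma>' = fmem \<sigma>" "cur_word \<sigma>' = cur_word \<sigma>" "out_terms \<sigma>' = out_terms \<sigma>"
    and words: "nmem \<sigma>' nWORDS = (nmem \<sigma> nWORDS)(length fs * d + j := Suc (prefix \<sigma> j))"
    using j by (simp_all add: \<sigma>'_def slot)
  have st: "stored n d (fs ! q) (\<lambda>t. nmem \<sigma>' nWORDS (q * d + t))" if "q < length fs" for q
    unfolding words stored_upd[OF that] using inv that by (simp add: search_inv_def)
  have inv': "search_inv n d s f fs \<sigma>'"
    unfolding search_inv_def
  proof (intro conjI)
    show "0 < nmem \<sigma>' nPOS 0 \<longrightarrow> (\<exists>w \<in> Poly_Mapping.keys f - set fs. length w = nmem \<sigma>' nTOP 0 - 1 \<and>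
        (\<forall>t < nmem \<sigma>' nPOS 0 - 1. prefix \<sigma>' t = code n (w ! t)) \<and>
        prefix \<sigma>' (nmem \<sigma>' nPOS 0 - 1) \<le> code n (w ! (nmem \<sigma>' nPOS 0 - 1)))"
      using w lt j m by (intro impI bexI[of _ w]) (auto simp: p sel)
    show "\<forall>q<length fs. stored n d (fs ! q) (\<lambda>t. nmem \<sigma>' nWORDS (q * d + t)) \<and>
       fmem \<sigma>' fCOEF q = Poly_Mapping.lookup f (fs ! q)"
      using st inv by (simp add: sel search_inv_def)
    show "\<forall>t < nmem \<sigma>' nPOS 0. 0 < prefix \<sigma>' t" "\<forall>t \<ge> nmem \<sigma>' nPOS 0. prefix \<sigma>' t = 0"
      unfolding p using inv j by (simp_all add: sel search_inv_def)
  qed (use inv env j in \<open>simp_all add: sel search_inv_def\<close>)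
  have "progress n \<sigma>' = Suc (progress n \<sigma>)" using j by (simp add: progress_def p sel)
  with progress_le[OF inv' f] have "potential n d s \<sigma>' < potential n d s \<sigma>"
    by (simp add: potential_def sel)
  with inv' show ?thesis by blast
qed

lemma search_descend:
  assumes inv: "search_inv n d s f fs \<sigma>" and m: "nmem \<sigma> nTOP 0 = Suc m"
    and no: "\<And>w. w \<in> Poly_Mapping.keys f - set fs \<Longrightarrow> \<not> matches n m (prefix \<sigma>) w"
    and j: "nmem \<sigma> nPOS 0 = 0"
  defines "\<sigma>' \<equiv> set_nmem nTOP 0 m \<sigma>"
  shows "search_inv n d s f fs \<sigma>' \<and> potential n d s \<sigma>' < potential n d s \<sigma>"
proof -
  have "length w < m" if "w \<in> Poly_Mapping.keys f - set fs" for w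
  proof -
    have "length w < Suc m" using inv that m by (auto simp: search_inv_def)
    \<comment> \<open>The empty prefix matches every word of length \<open>m\<close>.\<close>
    moreover have "length w \<noteq> m" using no[OF that] search_matches_iff[OF inv m that] j by simp
    ultimately show ?thesis by simp
  qed
  then have "search_inv n d s f fs \<sigma>'"
    using inv m j by (simp add: search_inv_def \<sigma>'_def prefix_upd)
  moreover have "potential n d s \<sigma>' < potential n d s \<sigma>"
    using m by (simp add: potential_def progress_def \<sigma>'_def prefix_upd)
  ultimately show ?thesis by blast
qed

lemma search_extend:
  assumes inv: "search_inv n d s f fs \<sigma>" and f: "f \<in> free_group_algebra n" and m: "nmem \<sigma> nTOP 0 = Suc m"
    and w: "w \<in> Poly_Mapping.keys f - set fs" "matches n m (prefix \<sigma>) w"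
    and j: "nmem \<sigma> nPOS 0 = j" "j < m"
  defines "\<sigma>' \<equiv> set_nmem nPOS 0 (Suc j) (set_nmem nWORDS (nmem \<sigma> nSLOT 0 + j) 1 \<sigma>)"
  shows "search_inv n d s f fs \<sigma>' \<and> potential n d s \<sigma>' < potential n d s \<sigma>"
proof -
  have len: "length w = m" and eq: "\<forall>t<j. prefix \<sigma> t = code n (w ! t)"
    using w search_matches_iff[OF inv m w(1)] j by auto
  have red: "w \<in> reduced_words n" using w f by (auto simp: free_group_algebra_def)
  have env: "env n d s \<sigma>'" using inv by (simp add: \<sigma>'_def search_inv_def)
  have p: "prefix \<sigma>' = (prefix \<sigma>)(j := 1)" unfolding \<sigma>'_def by (simp add: prefix_upd)
  have slot: "nmem \<sigma> nSLOT 0 = length fs * d" using inv by (simp add: search_inv_def)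
  have sel: "nmem \<sigma>' nPOS 0 = Suc j" "nmem \<sigma>' nTOP = nmem \<sigma> nTOP" "nmem \<sigma>' nFOUND = nmem \<sigma> nFOUND"
    "nmem \<sigma>' nSLOT = nmem \<sigma> nSLOT" "fmem \<sigma>' = fmem \<sigma>" "cur_word \<sigma>' = cur_word \<sigma>" "out_terms \<sigma>' = out_terms \<sigma>"
    and words: "nmem \<sigma>' nWORDS = (nmem \<sigma> nWORDS)(length fs * d + j := 1)"
    using j by (simp_all add: \<sigma>'_def slot)
  have st: "stored n d (fs ! q) (\<lambda>t. nmem \<sigma>' nWORDS (q * d + t))" if "q < length fs" for q
    unfolding words stored_upd[OF that] using inv that by (simp add: search_inv_def)
  have inv': "search_inv n d s f fs \<sigma>'"
    unfolding search_inv_def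
  proof (intro conjI)
    show "0 < nmem \<sigma>' nPOS 0 \<longrightarrow> (\<exists>w \<in> Poly_Mapping.keys f - set fs. length w = nmem \<sigma>' nTOP 0 - 1 \<and>
        (\<forall>t < nmem \<sigma>' nPOS 0 - 1. prefix \<sigma>' t = code n (w ! t)) \<and>
        prefix \<sigma>' (nmem \<sigma>' nPOS 0 - 1) \<le> code n (w ! (nmem \<sigma>' nPOS 0 - 1)))"
      \<comment> \<open>\<open>1\<close> is the least code, so every matching word bounds the new
        letter from above.\<close>
      using w len eq j m by (intro impI bexI[of _ w]) (auto simp: p sel code_def)
    show "\<forall>q<length fs. stored n d (fs ! q) (\<lambda>t. nmem \<sigma>' nWORDS (q * d + t)) \<and>
       fmem \<sigma>' fCOEF q = Poly_Mapping.lookup f (fs ! q)"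
      using st inv by (simp add: sel search_inv_def)
    show "\<forall>t < nmem \<sigma>' nPOS 0. 0 < prefix \<sigma>' t" "\<forall>t \<ge> nmem \<sigma>' nPOS 0. prefix \<sigma>' t = 0"
      unfolding p using inv j by (auto simp: sel search_inv_def less_Suc_eq)
  qed (use inv env j m in \<open>simp_all add: sel search_inv_def\<close>)
  have "progress n \<sigma> < progress n \<sigma>'"
  proof (cases j)
    case 0
    then show ?thesis using j by (simp add: progress_def p sel)
  next
    case (Suc i)
    have "fst (w ! i) < n" using reduced_words_nth[OF red, of i] len j Suc by simp
    then have "prefix \<sigma> i \<le> 2 * n" using eq Suc code_bounds[of "w ! i" n] by simp
    \<comment> \<open>A new position adds \<open>2 * n + 1\<close>, which outweighs the change of
      the last letter from at most \<open>2 * n\<close> to \<open>1\<close>.\<close>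
    then show ?thesis using j Suc by (simp add: progress_def p sel)
  qed
  with progress_le[OF inv' f] have "potential n d s \<sigma>' < potential n d s \<sigma>"
    by (simp add: potential_def sel)
  with inv' show ?thesis by blast
qed

lemma search_record:
  fixes \<sigma> \<sigma>' :: "'a::field machine"
  assumes inv: "search_inv n d s f fs \<sigma>" and f: "f \<in> free_group_algebra n" "fga_sparsity f = s"
    and m: "nmem \<sigma> nTOP 0 = Suc m"
    and w: "w \<in> Poly_Mapping.keys f - set fs" "matches n m (prefix \<sigma>) w" and j: "nmem \<sigma> nPOS 0 = m"
    and st: "stored n d w (prefix \<sigma>)"
    and fr: "frame record_com \<sigma> \<sigma>'"
    and post: "nmem \<sigma>' nFOUND 0 = Suc (nmem \<sigma> nFOUND 0)" "nmem \<sigma>' nSLOT 0 = nmem \<sigma> nSLOT 0 + d"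
      "nmem \<sigma>' nPOS 0 = 0" "fmem \<sigma>' fCOEF = (fmem \<sigma> fCOEF)(nmem \<sigma> nFOUND 0 := Poly_Mapping.lookup f w)"
      "cur_word \<sigma>' = []" "out_terms \<sigma>' = out_terms \<sigma> @ [(w, Poly_Mapping.lookup f w)]"
  shows "search_inv n d s f (fs @ [w]) \<sigma>' \<and> potential n d s \<sigma>' < potential n d s \<sigma>"
proof -
  have env: "env n d s \<sigma>'" using env_frame[OF fr] inv by (simp add: search_inv_def)
  have eq: "nmem \<sigma>' nWORDS = nmem \<sigma> nWORDS" "nmem \<sigma>' nTOP = nmem \<sigma> nTOP"
    using frame_nmem[OF fr, of nWORDS] frame_nmem[OF fr, of nTOP] by simp_all
  have old: "nmem \<sigma> nFOUND 0 = length fs" "nmem \<sigma> nSLOT 0 = length fs * d" "distinct fs" "m \<le> d"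
    "set fs \<subseteq> Poly_Mapping.keys f"
    using inv m by (simp_all add: search_inv_def)
  have p: "prefix \<sigma>' t = 0" for t
  proof -
    \<comment> \<open>The next slot begins \<open>d\<close> cells later, and all cells behind the
      complete prefix, whose length is \<open>m \<le> d\<close>, are still \<open>0\<close>.\<close>
    have "prefix \<sigma>' t = prefix \<sigma> (d + t)" by (simp add: prefix_def post eq add.assoc)
    also have "\<dots> = 0" using inv j old(4) by (simp add: search_inv_def)
    finally show ?thesis .
  qed
  have st': "stored n d ((fs @ [w]) ! q) (\<lambda>t. nmem \<sigma>' nWORDS (q * d + t)) \<and>
      fmem \<sigma>' fCOEF q = Poly_Mapping.lookup f ((fs @ [w]) ! q)" if "q < length (fs @ [w])" for q
  proof (cases "q = length fs")
    case True
    then show ?thesis using st old by (simp add: eq post prefix_def[abs_def])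
  next
    case False
    then have "q < length fs" using that by simp
    then show ?thesis using inv by (simp add: eq post old nth_append search_inv_def)
  qed
  have inv': "search_inv n d s f (fs @ [w]) \<sigma>'"
    unfolding search_inv_def
  proof (intro conjI)
    show "\<forall>q<length (fs @ [w]). stored n d ((fs @ [w]) ! q) (\<lambda>t. nmem \<sigma>' nWORDS (q * d + t)) \<and>
       fmem \<sigma>' fCOEF q = Poly_Mapping.lookup f ((fs @ [w]) ! q)" using st' by blast
  qed (use inv env w in \<open>auto simp: post eq p search_inv_def\<close>)
  have "card (set (fs @ [w])) \<le> card (Poly_Mapping.keys f)"
    by (rule card_mono) (use w old in auto)
  moreover have "distinct (fs @ [w])" using w old by auto
  \<comment> \<open>As \<open>w\<close> is new, \<open>s - length fs\<close> is positive and really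
    drops.\<close>
  ultimately have "length fs < s" using f(2) by (simp only: distinct_card) (simp add: fga_sparsity_def)
  then obtain e where e: "s - length fs = Suc e" "s - Suc (length fs) = e"
    by (metis Suc_diff_Suc)
  have "progress n \<sigma>' = 0" by (simp add: progress_def post)
  then have "potential n d s \<sigma>' < potential n d s \<sigma>"
    by (simp add: potential_def post eq old e)
  with inv' show ?thesis by blast
qed

definition step_time :: "nat \<Rightarrow> nat \<Rightarrow> nat \<Rightarrow> nat" where
  "step_time n d s = test_time n d s + (8 + record_time d)"

lemma run_step_com:
  fixes \<sigma> :: "'a::field_char_0 machine"
  assumes inv: "search_inv n d s f fs \<sigma>" and f: "f \<in> free_group_algebra n" "fga_sparsity f = s"
    and top: "0 < nmem \<sigma> nTOP 0"
  shows "run n (black_box f) step_com (step_time n d s)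
    (\<lambda>\<sigma>'. (\<exists>fs. search_inv n d s f fs \<sigma>') \<and> potential n d s \<sigma>' < potential n d s \<sigma>) \<sigma>"
proof -
  let ?Q = "\<lambda>\<sigma>'. (\<exists>fs. search_inv n d s f fs \<sigma>') \<and> potential n d s \<sigma>' < potential n d s \<sigma>"
  let ?R = "Poly_Mapping.keys f - set fs" and ?\<alpha> = "Poly_Mapping.lookup f"
  obtain m where m: "nmem \<sigma> nTOP 0 = Suc m" using top by (cases "nmem \<sigma> nTOP 0") auto
  have fs: "set fs \<subseteq> Poly_Mapping.keys f" "distinct fs" and env: "env n d s \<sigma>" and md: "m \<le> d"
    using inv m by (auto simp: search_inv_def)
  have "length fs \<le> s"
    using fs f(2) card_mono[of "Poly_Mapping.keys f" "set fs"] by (simp add: fga_sparsity_def distinct_card)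
  have red: "Poly_Mapping.keys f \<subseteq> reduced_words n" using f by (simp add: free_group_algebra_def)
  have rec: "recorded n d m ?\<alpha> fs \<sigma>"
    using inv m red by (auto simp: search_inv_def recorded_def)
  have R: "finite ?R" "?R \<subseteq> reduced_words n" "\<And>w. w \<in> ?R \<Longrightarrow> length w \<le> m" "m \<le> d"
    using red inv m md by (auto simp: search_inv_def less_Suc_eq_le)
  let ?tv = "test_value n d m (prefix \<sigma>) ?\<alpha> ?R"
  show ?thesis
    unfolding step_com_def step_time_def
  proof (rule run_SeqI[OF run_test_com[OF env rec f(1) fs \<open>length fs \<le> s\<close>]])
    fix \<sigma>1 assume fr: "frame test_com \<sigma> \<sigma>1"
      and t: "(fmem \<sigma>1 fVAL 0 = 0 \<longrightarrow> (\<forall>k<s. ?tv k = 0)) \<and>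
        (fmem \<sigma>1 fVAL 0 \<noteq> 0 \<longrightarrow> (\<exists>k. fmem \<sigma>1 fVAL 0 = ?tv k \<and> weight_ok n d k \<sigma>1))"
    have inv1: "search_inv n d s f fs \<sigma>1" and pot1: "potential n d s \<sigma>1 = potential n d s \<sigma>"
      using search_inv_frame[OF fr] inv by simp_all
    have pre1: "prefix \<sigma>1 = prefix \<sigma>" using prefix_frame[OF fr] by simp
    have m1: "nmem \<sigma>1 nTOP 0 = Suc m" using frame_nmem[OF fr, of nTOP] m by simp
    have env1: "env n d s \<sigma>1" using inv1 by (simp add: search_inv_def)
    let ?A = "com.If (npos (nv nPOS))
        (NSet nWORDS last_letter (NPlus (NGet nWORDS last_letter) (NConst 1)))
        (nset nTOP (NMinus (nv nTOP) (NConst 1)))"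
    let ?B = "com.If (NLess (nv nPOS) eTOP)
        (NSet nWORDS (NPlus (nv nSLOT) (nv nPOS)) (NConst 1) ;; ninc nPOS 1)
        record_com"
    have "run n (black_box f) (com.If (FEq (fv fVAL) FZero) ?A ?B) (1 + 3 + (1 + 2 + record_time d)) ?Q \<sigma>1"
    proof (rule run_If)
      assume "bval (FEq (fv fVAL) FZero) \<sigma>1"
      then have z: "\<forall>k<s. ?tv k = 0" using t by simp
      have no: "\<not> matches n m (prefix \<sigma>1) w" if w: "w \<in> ?R" for w
      proof
        assume "matches n m (prefix \<sigma>1) w"
        \<comment> \<open>If a remaining word matched, one of the first \<open>card ?R\<close>
          samples would be nonzero, and \<open>card ?R\<close> is at most \<open>s\<close>.\<close>
        with test_value_some[where R = ?R and \<alpha> = ?\<alpha>, OF R _ w] pre1 obtain k where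
          k: "k < card ?R" "?tv k \<noteq> 0" by (auto simp: in_keys_iff)
        have "card ?R \<le> s" using f(2) card_mono[of "Poly_Mapping.keys f" ?R] by (simp add: fga_sparsity_def)
        with z k show False by simp
      qed
      show "run n (black_box f) ?A 3 ?Q \<sigma>1"
      proof (cases "nmem \<sigma>1 nPOS 0")
        case 0
        show ?thesis
          by (rule run_straight_to[where \<sigma>' = "set_nmem nTOP 0 m \<sigma>1"])
            (use search_descend[OF inv1 m1 no 0] 0 pot1 m1 in \<open>auto simp: m1\<close>)
      next
        case (Suc j)
        show ?thesis
          by (rule run_straight_to[where \<sigma>' = "set_nmem nWORDS (nmem \<sigma>1 nSLOT 0 + j) (Suc (prefix \<sigma>1 j)) \<sigma>1"])
            (use search_advance[OF inv1 f(1) m1 no Suc] Suc pot1 in \<open>auto simp: prefix_def\<close>)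
      qed
    next
      assume "\<not> bval (FEq (fv fVAL) FZero) \<sigma>1"
      then obtain k where val: "fmem \<sigma>1 fVAL 0 = ?tv k" "?tv k \<noteq> 0" and ok: "weight_ok n d k \<sigma>1"
        using t by auto
      then obtain w where w: "w \<in> ?R" "matches n m (prefix \<sigma>1) w"
        using test_value_none[where R = ?R and p = "prefix \<sigma>" and \<alpha> = ?\<alpha>, OF R] pre1 by metis
      show "run n (black_box f) ?B (1 + 2 + record_time d) ?Q \<sigma>1"
      proof (rule run_If)
        assume "bval (NLess (nv nPOS) eTOP) \<sigma>1"
        then have j: "nmem \<sigma>1 nPOS 0 < m" using m1 by simp
        from search_extend[OF inv1 f(1) m1 w refl j]
        show "run n (black_box f) (NSet nWORDS (NPlus (nv nSLOT) (nv nPOS)) (NConst 1) ;; ninc nPOS 1) 2 ?Q \<sigma>1"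
          by (intro run_straight) (auto simp: pot1)
      next
        assume "\<not> bval (NLess (nv nPOS) eTOP) \<sigma>1"
        then have j: "nmem \<sigma>1 nPOS 0 = m" using m1 inv1 by (auto simp: search_inv_def)
        have len: "length w = m" and eq: "\<forall>t<m. prefix \<sigma>1 t = code n (w ! t)"
          using w search_matches_iff[OF inv1 m1 w(1)] j by auto
        have full: "prefix \<sigma> t \<noteq> 0" if "t < m" for t
          using inv1 j that pre1 by (auto simp: search_inv_def)
        have st: "stored n d w (prefix \<sigma>1)"
          using eq len md inv1 j by (auto simp: stored_def search_inv_def)
        have wr: "w \<in> reduced_words n" using R w by auto
        have wa: "word_act n d (weight_at n \<sigma>1) w = word_act n d (weight n (prefix \<sigma>) (cell_power k)) w"
          using weight_ok_word_act[OF ok wr] pre1 by simp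
        have wm: "matches n m (prefix \<sigma>) w" using w(2) pre1 by simp
        \<comment> \<open>Value and entry stem from the same sample \<open>k\<close>, so their
          quotient is the coefficient of \<open>w\<close>.\<close>
        note full' = test_value_full(1)[where R = ?R and \<alpha> = ?\<alpha> and k = k, OF R full w(1) wm, folded wa]
          test_value_full(2)[where R = ?R and k = k, OF R full w(1) wm, folded wa]
        have top1: "nmem \<sigma>1 nTOP 0 = Suc (length w)" using m1 len by simp
        have cur: "cur_word \<sigma>1 = []" using inv1 by (simp add: search_inv_def)
        show "run n (black_box f) record_com (record_time d) ?Q \<sigma>1"
        proof (rule run_conseq[OF run_record_com[OF env1 top1 cur wr st, where \<alpha> = "?\<alpha> w"]])
          fix \<sigma>2 :: "'a machine"
          assume fr2: "frame record_com \<sigma>1 \<sigma>2"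
            and "nmem \<sigma>2 nFOUND 0 = Suc (nmem \<sigma>1 nFOUND 0) \<and> nmem \<sigma>2 nSLOT 0 = nmem \<sigma>1 nSLOT 0 + d \<and>
              nmem \<sigma>2 nPOS 0 = 0 \<and> fmem \<sigma>2 fCOEF = (fmem \<sigma>1 fCOEF)(nmem \<sigma>1 nFOUND 0 := ?\<alpha> w) \<and>
              cur_word \<sigma>2 = [] \<and> out_terms \<sigma>2 = out_terms \<sigma>1 @ [(w, ?\<alpha> w)]"
          with search_record[OF inv1 f m1 w j st fr2] pot1 show "?Q \<sigma>2" by auto
        qed (use full' w pre1 val len in simp_all)
      qed
    qed
    then show "run n (black_box f) (com.If (FEq (fv fVAL) FZero) ?A ?B) (8 + record_time d) ?Q \<sigma>1"
      by (rule run_conseq) simp_all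
  qed simp
qed

section \<open>Initialisation and total running time\<close>

definition init_time :: "nat \<Rightarrow> nat \<Rightarrow> nat" where
  "init_time n d = 6 + ((1 + d * 3) + (1 + (2 * n + 1) * 3))"

lemma run_init_com:
  "run n ask init_com (init_time n d) (\<lambda>\<sigma>'. env n d s \<sigma>' \<and> nmem \<sigma>' nTOP 0 = Suc d \<and>
     nmem \<sigma>' nWORDS = (\<lambda>_. 0) \<and> nmem \<sigma>' nSLOT 0 = 0 \<and> nmem \<sigma>' nFOUND 0 = 0 \<and> nmem \<sigma>' nPOS 0 = 0 \<and>
     cur_word \<sigma>' = [] \<and> out_terms \<sigma>' = []) (initial n d s :: 'a::field machine)"
proof -
  let ?Q = "\<lambda>\<sigma>'. env n d s \<sigma>' \<and> nmem \<sigma>' nTOP 0 = Suc d \<and>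
     nmem \<sigma>' nWORDS = (\<lambda>_. 0) \<and> nmem \<sigma>' nSLOT 0 = 0 \<and> nmem \<sigma>' nFOUND 0 = 0 \<and> nmem \<sigma>' nPOS 0 = 0 \<and>
     cur_word \<sigma>' = [] \<and> out_terms \<sigma>' = []"
  let ?\<sigma> = "initial n d s :: 'a machine"
  let ?c0 = "nset nGEN (NGet 0 (NConst 0)) ;; nset nDEG (NGet 0 (NConst 1)) ;; nset nSPARSE (NGet 0 (NConst 2)) ;;
     nset nSTRIDE (NPlus (NPlus (nv nGEN) (nv nGEN)) (NConst 1)) ;;
     nset nDIM (NPlus (quadruple (nv nDEG)) (NConst 2)) ;; nset nTOP (NPlus (nv nDEG) (NConst 1))"
  let ?b1 = "NLess (nv nT) (nv nDEG)" and ?b2 = "NLess (nv nI) (nv nSTRIDE)"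
  let ?c1 = "NSet nROWS (NPlus (nv nT) (NConst 1)) (NPlus (NGet nROWS (nv nT)) (nv nSTRIDE)) ;; ninc nT 1"
  let ?c2 = "FSet fNUMS (NPlus (nv nI) (NConst 1)) (FPlus (FGet fNUMS (nv nI)) FOne) ;; ninc nI 1"
  let ?J = "\<lambda>\<sigma>'. nmem \<sigma>' nGEN 0 = n \<and> nmem \<sigma>' nDEG 0 = d \<and> nmem \<sigma>' nSPARSE 0 = s \<and>
     nmem \<sigma>' nDIM 0 = 4 * d + 2 \<and> nmem \<sigma>' nSTRIDE 0 = 2 * n + 1 \<and> nmem \<sigma>' nTOP 0 = Suc d \<and>
     nmem \<sigma>' nWORDS = (\<lambda>_. 0) \<and> nmem \<sigma>' nSLOT 0 = 0 \<and> nmem \<sigma>' nFOUND 0 = 0 \<and> nmem \<sigma>' nPOS 0 = 0 \<and>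
     nmem \<sigma>' nI 0 = 0 \<and> fmem \<sigma>' fNUMS 0 = 0 \<and> cur_word \<sigma>' = [] \<and> out_terms \<sigma>' = []"
  let ?I1 = "\<lambda>\<sigma>'. ?J \<sigma>' \<and> nmem \<sigma>' nT 0 \<le> d \<and> (\<forall>t \<le> nmem \<sigma>' nT 0. nmem \<sigma>' nROWS t = t * (2 * n + 1))"
  have 0: "?I1 (eff ?c0 ?\<sigma>) \<and> nmem (eff ?c0 ?\<sigma>) nT 0 = 0"
    by (simp add: initial_def)
  have loops: "run n ask (While ?b1 ?c1 ;; While ?b2 ?c2) ((1 + d * 3) + (1 + (2 * n + 1) * 3)) ?Q \<sigma>0"
    if I: "?I1 \<sigma>0" and t0: "nmem \<sigma>0 nT 0 = 0" for \<sigma>0 :: "'a machine"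
  proof (rule run_SeqI)
    show "run n ask (While ?b1 ?c1) (1 + d * 3)
      (\<lambda>\<sigma>'. ?J \<sigma>' \<and> (\<forall>t \<le> d. nmem \<sigma>' nROWS t = t * (2 * n + 1))) \<sigma>0"
    proof (rule run_While[where I = ?I1 and \<mu> = "\<lambda>\<sigma>'. d - nmem \<sigma>' nT 0" and B = 2])
      fix \<sigma>' :: "'a machine" assume I: "?I1 \<sigma>'" and b: "bval ?b1 \<sigma>'"
      obtain t where t: "nmem \<sigma>' nT 0 = t" "t < d" using I b by auto
      have r: "nmem \<sigma>' nROWS t = t * (2 * n + 1)" using I t by blast
      show "run n ask ?c1 2 (\<lambda>\<sigma>''. ?I1 \<sigma>'' \<and> d - nmem \<sigma>'' nT 0 < d - nmem \<sigma>' nT 0) \<sigma>'"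
      proof (rule run_straight_to)
        show "eff ?c1 \<sigma>' = set_nmem nT 0 (Suc t) (set_nmem nROWS (Suc t) (Suc t * (2 * n + 1)) \<sigma>')"
          using I by (simp add: t r add_ac)
        show "?I1 (set_nmem nT 0 (Suc t) (set_nmem nROWS (Suc t) (Suc t * (2 * n + 1)) \<sigma>')) \<and>
          d - nmem (set_nmem nT 0 (Suc t) (set_nmem nROWS (Suc t) (Suc t * (2 * n + 1)) \<sigma>')) nT 0 <
          d - nmem \<sigma>' nT 0"
          using I t by simp
      qed simp_all
    next
      fix \<sigma>' :: "'a machine" assume I: "?I1 \<sigma>'" and b: "\<not> bval ?b1 \<sigma>'"
      then have "nmem \<sigma>' nT 0 = d" by simp
      with I show "?J \<sigma>' \<and> (\<forall>t \<le> d. nmem \<sigma>' nROWS t = t * (2 * n + 1))" by simp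
    qed (use I t0 in simp_all)
  next
    fix \<sigma>1 :: "'a machine" assume J: "?J \<sigma>1 \<and> (\<forall>t \<le> d. nmem \<sigma>1 nROWS t = t * (2 * n + 1))"
    let ?I2 = "\<lambda>\<sigma>'. nmem \<sigma>' nI 0 \<le> 2 * n + 1 \<and> (\<forall>c \<le> nmem \<sigma>' nI 0. fmem \<sigma>' fNUMS c = of_nat c) \<and>
      cur_word \<sigma>' = [] \<and> out_terms \<sigma>' = []"
    show "run n ask (While ?b2 ?c2) (1 + (2 * n + 1) * 3) ?Q \<sigma>1"
    proof (rule run_While[where I = ?I2 and \<mu> = "\<lambda>\<sigma>'. 2 * n + 1 - nmem \<sigma>' nI 0" and B = 2])
      fix \<sigma>' :: "'a machine" assume I: "?I2 \<sigma>'" and fr: "frame ?c2 \<sigma>1 \<sigma>'" and b: "bval ?b2 \<sigma>'"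
      have "nmem \<sigma>' nSTRIDE 0 = 2 * n + 1" using frame_nmem[OF fr, of nSTRIDE] J by simp
      then obtain i where i: "nmem \<sigma>' nI 0 = i" "i < 2 * n + 1" using b by auto
      have r: "fmem \<sigma>' fNUMS i = of_nat i" using I i by blast
      show "run n ask ?c2 2 (\<lambda>\<sigma>''. ?I2 \<sigma>'' \<and> 2 * n + 1 - nmem \<sigma>'' nI 0 < 2 * n + 1 - nmem \<sigma>' nI 0) \<sigma>'"
      proof (rule run_straight_to)
        show "eff ?c2 \<sigma>' = set_nmem nI 0 (Suc i) (set_fmem fNUMS (Suc i) (of_nat (Suc i)) \<sigma>')"
          by (simp add: i r add.commute)
        show "?I2 (set_nmem nI 0 (Suc i) (set_fmem fNUMS (Suc i) (of_nat (Suc i)) \<sigma>')) \<and>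
          2 * n + 1 - nmem (set_nmem nI 0 (Suc i) (set_fmem fNUMS (Suc i) (of_nat (Suc i)) \<sigma>')) nI 0 <
          2 * n + 1 - nmem \<sigma>' nI 0"
          using I i by simp
      qed simp_all
    next
      fix \<sigma>' :: "'a machine" assume I: "?I2 \<sigma>'" and fr: "frame ?c2 \<sigma>1 \<sigma>'" and b: "\<not> bval ?b2 \<sigma>'"
      have eq: "nmem \<sigma>' a = nmem \<sigma>1 a" if "a \<noteq> nI" for a using frame_nmem[OF fr] that by simp
      from I b have "\<forall>c \<le> 2 * n. fmem \<sigma>' fNUMS c = of_nat c" using J by (simp add: eq)
      with I J show "?Q \<sigma>'" by (simp add: eq env_def)
    qed (use J in simp_all)
  qed simp
  show ?thesis
    unfolding init_com_def init_time_def
    by (rule run_straight_Seq[OF _ loops]) (use 0 in simp_all)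
qed

definition total_time :: "nat \<Rightarrow> nat \<Rightarrow> nat \<Rightarrow> nat" where
  "total_time n d s = init_time n d +
     (1 + (s * (d * (2 * n + 1) + 1) + d * (2 * n + 1) + (d + 1)) * (step_time n d s + 1))"

lemma run_reconstruct_com:
  fixes f :: "gword \<Rightarrow>\<^sub>0 'a::field_char_0"
  assumes f: "f \<in> free_group_algebra n" and d: "fga_degree f = d" and s: "fga_sparsity f = s"
  shows "run n (black_box f) reconstruct_com (total_time n d s) (\<lambda>\<sigma>. is_term_list (out_terms \<sigma>) f) (initial n d s)"
  unfolding reconstruct_com_def total_time_def
proof (rule run_SeqI[OF run_init_com[where s = s]])
  fix \<sigma> :: "'a machine"
  assume init: "env n d s \<sigma> \<and> nmem \<sigma> nTOP 0 = Suc d \<and>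
     nmem \<sigma> nWORDS = (\<lambda>_. 0) \<and> nmem \<sigma> nSLOT 0 = 0 \<and> nmem \<sigma> nFOUND 0 = 0 \<and> nmem \<sigma> nPOS 0 = 0 \<and>
     cur_word \<sigma> = [] \<and> out_terms \<sigma> = []"
  have "length w < Suc d" if "w \<in> Poly_Mapping.keys f" for w
    using that unfolding d[symmetric] fga_degree_def by (intro le_imp_less_Suc Max_ge) auto
  then have inv: "search_inv n d s f [] \<sigma>"
    using init by (simp add: search_inv_def prefix_def)
  show "run n (black_box f) (While (npos (nv nTOP)) step_com)
    (1 + (s * (d * (2 * n + 1) + 1) + d * (2 * n + 1) + (d + 1)) * (step_time n d s + 1))
    (\<lambda>\<sigma>. is_term_list (out_terms \<sigma>) f) \<sigma>"
  proof (rule run_While[where I = "\<lambda>\<sigma>. \<exists>fs. search_inv n d s f fs \<sigma>" and \<mu> = "potential n d s"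
        and B = "step_time n d s"])
    show "\<exists>fs. search_inv n d s f fs \<sigma>" using inv by blast
  next
    fix \<sigma>' :: "'a machine" assume "\<exists>fs. search_inv n d s f fs \<sigma>'" and b: "bval (npos (nv nTOP)) \<sigma>'"
    then obtain fs where "search_inv n d s f fs \<sigma>'" by blast
    from run_step_com[OF this f s] b
    show "run n (black_box f) step_com (step_time n d s)
      (\<lambda>\<sigma>''. (\<exists>fs. search_inv n d s f fs \<sigma>'') \<and> potential n d s \<sigma>'' < potential n d s \<sigma>') \<sigma>'"
      by simp
  next
    fix \<sigma>' :: "'a machine" assume "\<exists>fs. search_inv n d s f fs \<sigma>'" and b: "\<not> bval (npos (nv nTOP)) \<sigma>'"
    then obtain fs where fs: "search_inv n d s f fs \<sigma>'" by blast
    \<comment> \<open>With \<open>nTOP\<close> at \<open>0\<close>, a remaining word would have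
      length below \<open>0\<close>.\<close>
    then have "set fs = Poly_Mapping.keys f" using b by (auto simp: search_inv_def)
    with fs show "is_term_list (out_terms \<sigma>') f"
      by (auto simp: search_inv_def is_term_list_def o_def)
  next
    have "potential n d s \<sigma> = s * (d * (2 * n + 1) + 1) + d * (2 * n + 1) + (d + 1)"
      using init by (simp add: potential_def progress_def)
    then show "1 + potential n d s \<sigma> * (step_time n d s + 1) \<le>
      1 + (s * (d * (2 * n + 1) + 1) + d * (2 * n + 1) + (d + 1)) * (step_time n d s + 1)" by simp
  qed
qed simp

lemma poly_bounded_total_time: "poly_bounded total_time"
proof -
  have "poly_bounded (\<lambda>n d s. total_time n d s)"
    unfolding total_time_def init_time_def step_time_def test_time_def sample_time_def build_time_def
      row_time_def record_time_def word_time_def unit_time_def act_time_def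
    by (intro poly_bounded_intros)
  then show ?thesis by simp
qed

theorem theorem2:
  shows "\<exists>(prog :: com) (C :: nat) (k :: nat).
    \<forall>(n :: nat) (d :: nat) (s :: nat) (f :: gword \<Rightarrow>\<^sub>0 'a::field_char_0).
      f \<in> free_group_algebra n \<longrightarrow> fga_degree f = d \<longrightarrow> fga_sparsity f = s \<longrightarrow>
      (\<exists>t \<sigma>. exec n (black_box f) prog (initial n d s) t \<sigma> \<and>
             t \<le> C * (n + d + s + 1) ^ k \<and>
             is_term_list (out_terms \<sigma>) f)"
proof -
  obtain C k where Ck: "\<And>n d s. total_time n d s \<le> C * (n + d + s + 1) ^ k"
    using poly_bounded_total_time unfolding poly_bounded_def by blast
  show ?thesis
  proof (rule exI[of _ reconstruct_com], rule exI[of _ C], rule exI[of _ k], intro allI impI)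
    fix n d s and f :: "gword \<Rightarrow>\<^sub>0 'a"
    assume "f \<in> free_group_algebra n" "fga_degree f = d" "fga_sparsity f = s"
    from run_reconstruct_com[OF this] Ck[of n d s]
    show "\<exists>t \<sigma>. exec n (black_box f) reconstruct_com (initial n d s) t \<sigma> \<and>
             t \<le> C * (n + d + s + 1) ^ k \<and> is_term_list (out_terms \<sigma>) f"
      unfolding run_def by (meson le_trans)
  qed
qed

end
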